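(* Let $\Omega\subseteq[0,1]^d$ be Peano–Jordan measurable with $\mu(\Omega)>0$. The map $\mathcal S^\Omega:\mathcal G_d^\Omega/\mathcal Z\to\mathcal M_\Omega$, sending the class of a reduced GLT sequence to its reduced GLT symbol, is an isometry of pseudometric spaces, where $\mathcal G_d^\Omega/\mathcal Z$ carries the distance $d_{\rm a.c.s.}$ and $\mathcal M_\Omega$ carries the distance $d_{\rm mea}$; that is, if $\{A^\Omega_{\mathbf n}\}_n\sim_{GLT}^\Omega\kappa$ and $\{B^\Omega_{\mathbf n}\}_n\sim_{GLT}^\Omega\xi$, then $$d_{\rm a.c.s.}(\{A^\Omega_{\mathbf n}\}_n,\{B^\Omega_{\mathbf n}\}_n)=d_{\rm mea}(\kappa,\xi).$$
   Context: Fix $d\ge1$ and a sequence of $d$-indices $\mathbf n=\mathbf n(n)=(n_1,\dots,n_d)\in\mathbb N^d$, with $\min_jn_j\to\infty$ as $n\to\infty$; $N(\mathbf n)=\prod_jn_j$. Operations on multi-indices are componentwise, $\mathbf 1=(1,\dots,1)$. Matrices of size $N(\mathbf n)$ have rows and columns indexed by the $d$-indices $\mathbf 1\le\mathbf i\le\mathbf n$ in lexicographic order. $\mu$ is Lebesgue measure. $\Omega$ is Peano–Jordan measurable iff $\chi_\Omega$ is a.e. continuous, i.e. $\mu(\partial\Omega)=0$. a.c.s. convergence. For matrices of size $d_n$, $\{B_{n,m}\}_n\xrightarrow{\text{a.c.s.}}\{A_n\}_n$ as $m\to\infty$ means: for every $m$ there is $n_m$ such that for $n>n_m$ one can write $A_n=B_{n,m}+N_{n,m}+R_{n,m}$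 with spectral norm $\|N_{n,m}\|\le\omega(m)$ and $\mathrm{rank}(R_{n,m})\le c(m)d_n$, where $\omega(m),c(m)\to0$. GLT sequences. For $f\in L^1([-\pi,\pi]^d)$, $T_{\mathbf n}(f)=[f_{\mathbf i-\mathbf j}]_{\mathbf i,\mathbf j=\mathbf 1}^{\mathbf n}$ with $f_{\mathbf k}=(2\pi)^{-d}\int_{[-\pi,\pi]^d}f(\theta)e^{-\mathrm i\,\mathbf k\cdot\theta}d\theta$; for $a:[0,1]^d\to\mathbb C$, $D_{\mathbf n}(a)=\mathrm{diag}(a(\mathbf i/\mathbf n))_{\mathbf i=\mathbf 1}^{\mathbf n}$. A sequence $\{A_{\mathbf n}\}_n$ with $A_{\mathbf n}$ of size $N(\mathbf n)$ is a ($d$-level) GLT sequence with symbol the measurable function $k:[0,1]^d\times[-\pi,\pi]^d\to\mathbb C$, written $\{A_{\mathbf n}\}_n\sim_{GLT}k$, iff there are finitely many (for each $m$) $a_{i,m}\in C^\infty([0,1]^d)$ and trigonometric polynomials $f_{i,m}$ in $d$ variables such that $\sum_ia_{i,m}(x)f_{i,m}(\theta)\to k$ in measure and $\{\sum_iD_{\mathbf n}(a_{i,m})T_{\mathbf n}(f_{i,m})\}_n\xrightarrow{\text{a.c.s.}}\{A_{\mathbf n}\}_n$ as $m\to\infty$ (a standard characterization of GLT sequences). The symbol is unique a.e. Reduced GLT. $d_n^\Omega$ is the number of $\mathbf 1\le\mathbf i\le\mathbf n$ with $\mathbf i/(\mathbf n+\mathbf 1)\in\Omega$; $\phi_{\mathbf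 n}:\{1,\dots,d_n^\Omega\}\to\{\mathbf 1,\dots,\mathbf n\}$ enumerates these $\mathbf i$ in increasing lexicographic order. $R_\Omega$ sends $A_{\mathbf n}$ of size $N(\mathbf n)$ to $[(A_{\mathbf n})_{\phi_{\mathbf n}(i),\phi_{\mathbf n}(j)}]_{i,j=1}^{d_n^\Omega}$, applied to sequences termwise. A sequence $\{S^\Omega_{\mathbf n}\}_n$ is a reduced GLT sequence with respect to $\Omega$ if it equals $R_\Omega(\{A_{\mathbf n}\}_n)$ for some GLT sequence $\{A_{\mathbf n}\}_n\sim_{GLT}k$; its reduced GLT symbol is $s=k|_{\Omega\times[-\pi,\pi]^d}$ (well defined a.e.), written $\{S^\Omega_{\mathbf n}\}_n\sim_{GLT}^\Omega s$. $\mathcal G_d^\Omega$ is the set of reduced GLT sequences with respect to $\Omega$; $\mathcal Z$ is the set of zero-distributed sequences $\{Z^\Omega_{\mathbf n}\}_n$ of matrices of size $d_n^\Omega$, i.e. $\frac1{d_n^\Omega}\sum_{i=1}^{d_n^\Omega}F(\sigma_i(Z^\Omega_{\mathbf n}))\to F(0)$ for all $F\in C_c(\mathbb R)$; $\mathcal M_\Omega$ is the space of measurable functions $\Omega\times[-\pi,\pi]^d\to\mathbb C$ (identified when equal a.e.). The kernel of the linear map (sequence $\mapsto$ symbol) on $\mathcal G^\Omega_d$ is $\mathcal Z$. Distances: $d_{\rm a.c.s.}(\{A^\Omega_{\mathbf n}\}_n,\{B^\Omega_{\mathbf n}\}_n)=\limsup_{n\to\infty}\min_{i=1,\dots,d_n^\Omega+1}\big\{\frac{i-1}{d_n^\Omega}+\sigma_i(A^\Omega_{\mathbf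 n}-B^\Omega_{\mathbf n})\big\}$, with singular values in decreasing order and $\sigma_{d_n^\Omega+1}:=0$; $d_{\rm mea}(f,g)=\inf_{L\ge0}\big\{\frac{\mu\{|f-g|>L\}}{\mu(\Omega)(2\pi)^d}+L\big\}$. *)

theory Defs
  imports
    "HOL-Analysis.Analysis"
    "Jordan_Normal_Form.Schur_Decomposition"
    "Jordan_Normal_Form.DL_Rank"
begin

no_notation Matrix.vec_index (infixl "$" 100)

(* Matrices of varying size are the matrices of Jordan_Normal_Form (rows and columns counted from 0);
   the fixed dimension d is CARD('d), and the linear order on 'd is the order of the coordinates. *)

section \<open>Multi-indices\<close>

(* The d-indices, Z^d and R^d.  Synonyms, because in the notation nat ^ 'd a bare 'd has sort finite
   only, which clashes with {finite, linorder} in the same type. *)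
type_synonym 'd multi_index = "(nat, 'd) Finite_Cartesian_Product.vec"
type_synonym 'd freq_index = "(int, 'd) Finite_Cartesian_Product.vec"
type_synonym 'd point = "(real, 'd) Finite_Cartesian_Product.vec"

definition grid :: "('d :: finite) multi_index \<Rightarrow> 'd multi_index set" where
  "grid n = {i. \<forall>l. 1 \<le> i $ l \<and> i $ l \<le> n $ l}"

definition grid_size :: "('d :: finite) multi_index \<Rightarrow> nat" where
  "grid_size n = (\<Prod>l\<in>UNIV. n $ l)"

definition lex_less :: "('d :: {finite, linorder}) multi_index \<Rightarrow> 'd multi_index \<Rightarrow> bool" where
  "lex_less i j \<longleftrightarrow> (\<exists>l. i $ l < j $ l \<and> (\<forall>l'<l. i $ l' = j $ l'))"

definition lex_pos :: "('d :: {finite, linorder}) multi_index set \<Rightarrow> 'd multi_index \<Rightarrow> nat" where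
  "lex_pos S i = card {j \<in> S. lex_less j i}"

(* For finite S and p < card S: the element number p, counting from 0, of S in increasing
   lexicographic order. *)
definition lex_enum :: "('d :: {finite, linorder}) multi_index set \<Rightarrow> nat \<Rightarrow> 'd multi_index" where
  "lex_enum S = the_inv_into S (lex_pos S)"

definition grid_mat ::
    "('d :: {finite, linorder}) multi_index \<Rightarrow> ('d multi_index \<Rightarrow> 'd multi_index \<Rightarrow> complex) \<Rightarrow> complex mat" where
  "grid_mat n c = Matrix.mat (grid_size n) (grid_size n)
     (\<lambda>(p, q). c (lex_enum (grid n) p) (lex_enum (grid n) q))"

section \<open>Singular values and spectral norm\<close>

(* In decreasing order, repeated according to multiplicity. *)
definition singular_values :: "complex mat \<Rightarrow> real list" where
  "singular_values A = rev (sorted_list_of_multiset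
     (image_mset (\<lambda>z. sqrt (Re z)) (proots (char_poly (mat_adjoint A * A)))))"

(* Counted from 1; zero beyond the number of singular values. *)
definition singular_value :: "complex mat \<Rightarrow> nat \<Rightarrow> real" where
  "singular_value A i =
     (if 1 \<le> i \<and> i \<le> length (singular_values A) then singular_values A ! (i - 1) else 0)"

definition euclid_norm :: "complex Matrix.vec \<Rightarrow> real" where
  "euclid_norm v = sqrt (\<Sum>i<dim_vec v. (cmod (vec_index v i))\<^sup>2)"

definition spectral_norm :: "complex mat \<Rightarrow> real" where
  "spectral_norm A =
     (SUP v\<in>{v \<in> carrier_vec (dim_col A). euclid_norm v \<le> 1}. euclid_norm (mult_mat_vec A v))"

section \<open>Approximating classes of sequences\<close>

(* sz n is the size of the matrices at position n; B m n stands for B_{n,m}. *)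
definition acs_conv ::
    "(nat \<Rightarrow> nat) \<Rightarrow> (nat \<Rightarrow> nat \<Rightarrow> complex mat) \<Rightarrow> (nat \<Rightarrow> complex mat) \<Rightarrow> bool" where
  "acs_conv sz B A \<longleftrightarrow>
     (\<exists>\<omega> c :: nat \<Rightarrow> real. \<omega> \<longlonglongrightarrow> 0 \<and> c \<longlonglongrightarrow> 0 \<and>
       (\<forall>m. \<exists>n0. \<forall>n>n0.
          \<exists>N \<in> carrier_mat (sz n) (sz n). \<exists>R \<in> carrier_mat (sz n) (sz n).
            A n = B m n + N + R \<and> spectral_norm N \<le> \<omega> m \<and>
            real (vec_space.rank (sz n) R) \<le> c m * real (sz n)))"

section \<open>GLT sequences\<close>

definition freq_box :: "('d :: finite) point set" where
  "freq_box = cbox (\<chi> l. - pi) (\<chi> l. pi)"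

definition freq_char :: "'d freq_index \<Rightarrow> ('d :: finite) point \<Rightarrow> complex" where
  "freq_char k \<theta> = cis (\<Sum>l\<in>UNIV. of_int (k $ l) * \<theta> $ l)"

definition trig_poly :: "(('d :: finite) point \<Rightarrow> complex) \<Rightarrow> bool" where
  "trig_poly f \<longleftrightarrow> (\<exists>K c. finite K \<and> f = (\<lambda>\<theta>. \<Sum>k\<in>K. c k * freq_char k \<theta>))"

definition fourier_coeff :: "(('d :: finite) point \<Rightarrow> complex) \<Rightarrow> 'd freq_index \<Rightarrow> complex" where
  "fourier_coeff f k =
     (LINT \<theta>|lebesgue_on freq_box. f \<theta> * freq_char (- k) \<theta>) / of_real ((2 * pi) ^ CARD('d))"

definition toeplitz_mat ::
    "('d :: {finite, linorder}) multi_index \<Rightarrow> ('d point \<Rightarrow> complex) \<Rightarrow> complex mat" where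
  "toeplitz_mat n f = grid_mat n (\<lambda>i j. fourier_coeff f (\<chi> l. int (i $ l) - int (j $ l)))"

definition diag_sampling_mat ::
    "('d :: {finite, linorder}) multi_index \<Rightarrow> ('d point \<Rightarrow> complex) \<Rightarrow> complex mat" where
  "diag_sampling_mat n a =
     grid_mat n (\<lambda>i j. if i = j then a (\<chi> l. real (i $ l) / real (n $ l)) else 0)"

(* Derivatives are taken within S, hence one-sided on the boundary of the cube.  As the cube is
   the closure of its interior, f' x is uniquely determined for x in the cube. *)
primrec Ck_on :: "nat \<Rightarrow> ('d :: finite) point set \<Rightarrow> ('d point \<Rightarrow> complex) \<Rightarrow> bool" where
  "Ck_on 0 S f = continuous_on S f"
| "Ck_on (Suc k) S f =
     (\<exists>f'. (\<forall>x\<in>S. (f has_derivative f' x) (at x within S)) \<and> (\<forall>v. Ck_on k S (\<lambda>x. f' x v)))"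

definition smooth_on_set :: "('d :: finite) point set \<Rightarrow> ('d point \<Rightarrow> complex) \<Rightarrow> bool" where
  "smooth_on_set S f \<longleftrightarrow> (\<forall>k. Ck_on k S f)"

definition conv_in_measure ::
    "'a :: euclidean_space set \<Rightarrow> (nat \<Rightarrow> 'a \<Rightarrow> complex) \<Rightarrow> ('a \<Rightarrow> complex) \<Rightarrow> bool" where
  "conv_in_measure S g k \<longleftrightarrow>
     (\<forall>\<epsilon>>0. (\<lambda>m. measure lebesgue {z \<in> S. cmod (g m z - k z) > \<epsilon>}) \<longlonglongrightarrow> 0)"

(* The sum over i of D_n(a i) T_n(f i), i < r, written entrywise because the library type of
   matrices has no zero common to all sizes. *)
definition glt_approx ::
    "('d :: {finite, linorder}) multi_index \<Rightarrow> nat \<Rightarrow> (nat \<Rightarrow> 'd point \<Rightarrow> complex) \<Rightarrow>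
     (nat \<Rightarrow> 'd point \<Rightarrow> complex) \<Rightarrow> complex mat" where
  "glt_approx n r a f = Matrix.mat (grid_size n) (grid_size n)
     (\<lambda>pq. \<Sum>i<r. (diag_sampling_mat n (a i) * toeplitz_mat n (f i)) $$ pq)"

definition GLT ::
    "(nat \<Rightarrow> ('d :: {finite, linorder}) multi_index) \<Rightarrow> (nat \<Rightarrow> complex mat) \<Rightarrow>
     ('d point \<times> 'd point \<Rightarrow> complex) \<Rightarrow> bool" where
  "GLT \<nu> A k \<longleftrightarrow>
     (\<forall>n. A n \<in> carrier_mat (grid_size (\<nu> n)) (grid_size (\<nu> n))) \<and>
     k \<in> borel_measurable (lebesgue_on (cbox 0 1 \<times> freq_box)) \<and>
     (\<exists>(r :: nat \<Rightarrow> nat) a f.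
        (\<forall>m. \<forall>i<r m. smooth_on_set (cbox 0 1) (a m i) \<and> trig_poly (f m i)) \<and>
        conv_in_measure (cbox 0 1 \<times> freq_box) (\<lambda>m (x, \<theta>). \<Sum>i<r m. a m i x * f m i \<theta>) k \<and>
        acs_conv (\<lambda>n. grid_size (\<nu> n)) (\<lambda>m n. glt_approx (\<nu> n) (r m) (a m) (f m)) A)"

section \<open>Reduced GLT sequences\<close>

definition peano_jordan :: "('d :: finite) point set \<Rightarrow> bool" where
  "peano_jordan \<Omega> \<longleftrightarrow> bounded \<Omega> \<and> frontier \<Omega> \<in> null_sets lebesgue"

definition grid_in :: "('d :: finite) point set \<Rightarrow> 'd multi_index \<Rightarrow> 'd multi_index set" where
  "grid_in \<Omega> n = {i \<in> grid n. (\<chi> l. real (i $ l) / real (n $ l + 1)) \<in> \<Omega>}"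

definition grid_in_size :: "('d :: finite) point set \<Rightarrow> 'd multi_index \<Rightarrow> nat" where
  "grid_in_size \<Omega> n = card (grid_in \<Omega> n)"

definition restrict_mat ::
    "('d :: {finite, linorder}) point set \<Rightarrow> 'd multi_index \<Rightarrow> complex mat \<Rightarrow> complex mat" where
  "restrict_mat \<Omega> n A = Matrix.mat (grid_in_size \<Omega> n) (grid_in_size \<Omega> n)
     (\<lambda>(p, q). A $$ (lex_pos (grid n) (lex_enum (grid_in \<Omega> n) p),
                     lex_pos (grid n) (lex_enum (grid_in \<Omega> n) q)))"

(* Functions on Omega x [-pi,pi]^d are total functions whose values elsewhere are irrelevant. *)
definition reduced_GLT ::
    "(nat \<Rightarrow> ('d :: {finite, linorder}) multi_index) \<Rightarrow> 'd point set \<Rightarrow> (nat \<Rightarrow> complex mat) \<Rightarrow>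
     ('d point \<times> 'd point \<Rightarrow> complex) \<Rightarrow> bool" where
  "reduced_GLT \<nu> \<Omega> S s \<longleftrightarrow>
     (\<exists>A k. GLT \<nu> A k \<and> S = (\<lambda>n. restrict_mat \<Omega> (\<nu> n) (A n)) \<and>
            (\<forall>z \<in> \<Omega> \<times> freq_box. s z = k z))"

definition reduced_GLT_seqs ::
    "(nat \<Rightarrow> ('d :: {finite, linorder}) multi_index) \<Rightarrow> 'd point set \<Rightarrow> (nat \<Rightarrow> complex mat) set" where
  "reduced_GLT_seqs \<nu> \<Omega> = {S. \<exists>s. reduced_GLT \<nu> \<Omega> S s}"

definition zero_distributed ::
    "(nat \<Rightarrow> ('d :: finite) multi_index) \<Rightarrow> 'd point set \<Rightarrow> (nat \<Rightarrow> complex mat) set" where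
  "zero_distributed \<nu> \<Omega> =
     {Z. (\<forall>n. Z n \<in> carrier_mat (grid_in_size \<Omega> (\<nu> n)) (grid_in_size \<Omega> (\<nu> n))) \<and>
         (\<forall>F :: real \<Rightarrow> complex.
            continuous_on UNIV F \<and> (\<exists>K. compact K \<and> (\<forall>x. x \<notin> K \<longrightarrow> F x = 0)) \<longrightarrow>
            (\<lambda>n. (\<Sum>i=1..grid_in_size \<Omega> (\<nu> n). F (singular_value (Z n) i)) /
                 of_nat (grid_in_size \<Omega> (\<nu> n))) \<longlonglongrightarrow> F 0)}"

definition symbol_space ::
    "('d :: finite) point set \<Rightarrow> ('d point \<times> 'd point \<Rightarrow> complex) set" where
  "symbol_space \<Omega> = borel_measurable (lebesgue_on (\<Omega> \<times> freq_box))"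

(* The equivalence relations whose classes form G / Z and the space of measurable functions
   modulo equality almost everywhere. *)
definition seq_rel ::
    "(nat \<Rightarrow> ('d :: {finite, linorder}) multi_index) \<Rightarrow> 'd point set \<Rightarrow>
     ((nat \<Rightarrow> complex mat) \<times> (nat \<Rightarrow> complex mat)) set" where
  "seq_rel \<nu> \<Omega> = {(A, B). A \<in> reduced_GLT_seqs \<nu> \<Omega> \<and> B \<in> reduced_GLT_seqs \<nu> \<Omega> \<and>
                         (\<lambda>n. A n - B n) \<in> zero_distributed \<nu> \<Omega>}"

definition symbol_rel ::
    "('d :: finite) point set \<Rightarrow>
     (('d point \<times> 'd point \<Rightarrow> complex) \<times> ('d point \<times> 'd point \<Rightarrow> complex)) set" where
  "symbol_rel \<Omega> = {(f, g). f \<in> symbol_space \<Omega> \<and> g \<in> symbol_space \<Omega> \<and>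
                          (AE z in lebesgue_on (\<Omega> \<times> freq_box). f z = g z)}"

(* All symbols of members of the class X; this is a single class of symbols exactly when the
   symbol map is well defined at X. *)
definition symbol_map ::
    "(nat \<Rightarrow> ('d :: {finite, linorder}) multi_index) \<Rightarrow> 'd point set \<Rightarrow> (nat \<Rightarrow> complex mat) set \<Rightarrow>
     ('d point \<times> 'd point \<Rightarrow> complex) set" where
  "symbol_map \<nu> \<Omega> X = {s. \<exists>A\<in>X. reduced_GLT \<nu> \<Omega> A s}"

section \<open>Distances\<close>

(* For grid_in_size > 0 the minimum lies in [0,1], so passing from ereal to real loses nothing. *)
definition d_acs ::
    "(nat \<Rightarrow> ('d :: finite) multi_index) \<Rightarrow> 'd point set \<Rightarrow> (nat \<Rightarrow> complex mat) \<Rightarrow> (nat \<Rightarrow> complex mat) \<Rightarrow> real" where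
  "d_acs \<nu> \<Omega> A B = real_of_ereal (limsup (\<lambda>n. ereal (
     let d = grid_in_size \<Omega> (\<nu> n)
     in MIN i\<in>{1..d + 1}. (real i - 1) / real d + singular_value (A n - B n) i)))"

definition d_mea ::
    "('d :: finite) point set \<Rightarrow> ('d point \<times> 'd point \<Rightarrow> complex) \<Rightarrow>
     ('d point \<times> 'd point \<Rightarrow> complex) \<Rightarrow> real" where
  "d_mea \<Omega> f g = (INF L\<in>{0..}.
     measure lebesgue {z \<in> \<Omega> \<times> freq_box. cmod (f z - g z) > L} /
       (measure lebesgue \<Omega> * (2 * pi) ^ CARD('d)) + L)"

definition pseudometric_on :: "'a set \<Rightarrow> ('a \<Rightarrow> 'a \<Rightarrow> real) \<Rightarrow> bool" where
  "pseudometric_on S d \<longleftrightarrow>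
     (\<forall>x\<in>S. \<forall>y\<in>S. 0 \<le> d x y \<and> d x y = d y x) \<and> (\<forall>x\<in>S. d x x = 0) \<and>
     (\<forall>x\<in>S. \<forall>y\<in>S. \<forall>z\<in>S. d x z \<le> d x y + d y z)"

(* The function on classes induced by a function on representatives; meaningful only when d
   respects the equivalence relation in both arguments. *)
definition class_dist :: "('a \<Rightarrow> 'a \<Rightarrow> real) \<Rightarrow> 'a set \<Rightarrow> 'a set \<Rightarrow> real" where
  "class_dist d X Y = the_elem (\<Union>x\<in>X. \<Union>y\<in>Y. {d x y})"

definition isometry_on ::
    "'a set \<Rightarrow> ('a \<Rightarrow> 'a \<Rightarrow> real) \<Rightarrow> 'b set \<Rightarrow> ('b \<Rightarrow> 'b \<Rightarrow> real) \<Rightarrow> ('a \<Rightarrow> 'b) \<Rightarrow> bool" where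
  "isometry_on S d T e \<phi> \<longleftrightarrow>
     \<phi> \<in> S \<rightarrow> T \<and> (\<forall>x\<in>S. \<forall>y\<in>S. e (\<phi> x) (\<phi> y) = d x y)"

end

theory Submission
  imports Defs
begin

text \<open>
  Write \<open>p(X)\<close> for the minimum in the definition of \<open>d_acs\<close>, so that \<open>d_acs(A, B) = limsup p(A - B)\<close>. It is
  the infimum of \<open>r / d + L\<close> over all \<open>r\<close> and \<open>L\<close> such that at most \<open>r\<close> singular values exceed \<open>L\<close>, hence
  subadditive, small on matrices that are sums of one of small norm and one of small rank, and small on matrices
  of small normalized Frobenius norm; \<open>d_mea\<close> is the same functional for the distribution of \<open>|f - g|\<close>.
  By these estimates it suffices to show \<open>p(X\<^sub>n) \<longrightarrow> d_mea(g, 0)\<close> when \<open>X\<^sub>n\<close> is the restriction of a finite sum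
  \<open>\<Sum> D\<^sub>n(a\<^sub>i) T\<^sub>n(f\<^sub>i)\<close> with continuous \<open>a\<^sub>i\<close> and trigonometric polynomials \<open>f\<^sub>i\<close>, and \<open>g = \<Sum> a\<^sub>i f\<^sub>i\<close>. Up to a small Frobenius
  norm such a matrix is block diagonal with circulant blocks of a fixed size \<open>b\<close>, whose eigenvalues are samples of
  \<open>g\<close>, each representing a cell of the same volume. Letting \<open>n\<close> and then \<open>b\<close> tend to infinity proves the claim; the
  grid points near the boundary of \<open>\<Omega>\<close> are negligible because that boundary is a null set.
\<close>

section \<open>Hermitian matrices\<close>

text \<open>The model is in general not close to the banded kernel in operator norm: near the faces
  of a block the two differ by an amount that need not tend to zero. These rows are a fraction of
  order \<open>1 / b\<close> of all rows and each has bounded Euclidean norm, so the normalized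
  squared Frobenius norm is small. By Chebyshev's inequality this bounds the share of singular
  values above a threshold, which is enough for a functional that trades count against size. The
  side \<open>b\<close> stays fixed while \<open>n\<close> grows: freezing the coefficients on a
  block needs \<open>b / n\<close> small, whereas the face rows and the frequency mesh need
  \<open>b\<close> large.

  The limsup turns out to be a limit. Hence distance zero means that \<open>p(A - B)\<close> tends
  to 0, which is the same as \<open>A - B\<close> being zero-distributed. Uniqueness of the symbol
  and the kernel of the symbol map thus come out of the equality of distances: both equivalence
  relations are the zero-distance relations of pseudometrics. As classes of symbols contain all
  almost everywhere equal functions, it remains to see that a symbol may be altered on a null
  set.\<close>

lemma mat_adjoint_dims [simp]:
  "dim_row (mat_adjoint A) = dim_col A" "dim_col (mat_adjoint A) = dim_row A"
  by (simp_all add: mat_adjoint_def)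

lemma mat_adjoint_carrier [simp]: "A \<in> carrier_mat n m \<Longrightarrow> mat_adjoint A \<in> carrier_mat m n"
  by (intro carrier_matI; unfold mat_adjoint_dims; erule carrier_matD)

lemma mat_adjoint_index [simp]:
  assumes "i < dim_col A" "j < dim_row A"
  shows "mat_adjoint A $$ (i, j) = conjugate (A $$ (j, i))"
  using assms by (simp add: mat_adjoint_def mat_of_rows_index)

lemma mat_adjoint_mult:
  fixes A :: "complex mat"
  assumes A: "A \<in> carrier_mat n m" and B: "B \<in> carrier_mat m k"
  shows "mat_adjoint (A * B) = mat_adjoint B * mat_adjoint A"
proof (rule eq_matI)
  fix i j assume "i < dim_row (mat_adjoint B * mat_adjoint A)" "j < dim_col (mat_adjoint B * mat_adjoint A)"
  hence ij: "i < k" "j < n" using A B by auto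
  have "mat_adjoint (A * B) $$ (i,j) = conjugate (\<Sum>l<m. A $$ (j,l) * B $$ (l,i))"
    using A B ij by (simp add: scalar_prod_def atLeast0LessThan)
  also have "\<dots> = (\<Sum>l<m. mat_adjoint B $$ (i,l) * mat_adjoint A $$ (l,j))"
    using A B ij by (simp add: mult.commute)
  also have "\<dots> = (mat_adjoint B * mat_adjoint A) $$ (i,j)"
    using A B ij by (simp add: scalar_prod_def atLeast0LessThan)
  finally show "mat_adjoint (A * B) $$ (i,j) = (mat_adjoint B * mat_adjoint A) $$ (i,j)" .
qed (use A B in auto)

lemma mat_adjoint_adjoint [simp]: "mat_adjoint (mat_adjoint A) = (A :: complex mat)"
  by (rule eq_matI) auto

text \<open>Gram-Schmidt applied to a basis starting with \<open>v\<close> keeps \<open>v\<close> as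
  its first vector and only orthogonalises. Dividing the vectors by their norms makes
  \<open>W\<close> unitary, which is why its first column is a multiple of \<open>v\<close>.\<close>

lemma unitary_with_first_column:
  fixes v :: "complex Matrix.vec"
  assumes v: "v \<in> carrier_vec (Suc n)" and v0: "v \<noteq> 0\<^sub>v (Suc n)"
  shows "\<exists>W \<in> carrier_mat (Suc n) (Suc n). mat_adjoint W * W = 1\<^sub>m (Suc n) \<and> (\<exists>c. col W 0 = c \<cdot>\<^sub>v v)"
proof -
  note sum.lessThan_Suc [simp del]
  interpret cof_vec_space "Suc n" "TYPE(complex)" .
  define ws where "ws = gram_schmidt (Suc n) (basis_completion v)"
  note bc = basis_completion[OF v v0]
  have ws: "set ws \<subseteq> carrier_vec (Suc n)" "corthogonal ws" "length ws = Suc n"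
    using gram_schmidt_result[OF bc(2) bc(4) bc(5) ws_def] bc(6) by auto
  have hdws: "ws ! 0 = v"
  proof -
    obtain vs where "basis_completion v = v # vs" using bc(6,7) by (cases "basis_completion v") auto
    hence "hd ws = v" unfolding ws_def using gram_schmidt_hd[OF v] by simp
    thus ?thesis using ws(3) by (cases ws) auto
  qed
  define N where "N i = (\<Sum>l<Suc n. (cmod (vec_index (ws ! i) l))\<^sup>2)" for i
  have wsc: "ws ! i \<in> carrier_vec (Suc n)" if "i < Suc n" for i
    using ws that by auto
  have e: "(ws ! j) \<bullet>c (ws ! i) = (\<Sum>l<Suc n. cnj (vec_index (ws ! i) l) * vec_index (ws ! j) l)"
    if "i < Suc n" "j < Suc n" for i j
    using wsc[OF that(1)] wsc[OF that(2)]
    by (auto simp: scalar_prod_def atLeast0LessThan mult.commute intro!: sum.cong)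
  have ip: "(\<Sum>l<Suc n. cnj (vec_index (ws ! i) l) * vec_index (ws ! j) l) = (if i = j then of_real (N i) else 0)"
    if "i < Suc n" "j < Suc n" for i j
  proof -
    show ?thesis
    proof (cases "i = j")
      case True
      have "of_real (N j) = (\<Sum>l<Suc n. cnj (vec_index (ws ! j) l) * vec_index (ws ! j) l)"
        unfolding N_def of_real_sum by (intro sum.cong refl) (simp add: complex_norm_square mult.commute del: of_real_power)
      thus ?thesis using True by simp
    next
      case False
      thus ?thesis using corthogonalD[OF ws(2), of j i] that ws(3) e[OF that] by auto
    qed
  qed
  have Npos: "N i > 0" if "i < Suc n" for i
  proof -
    have "(ws ! i) \<bullet>c (ws ! i) \<noteq> 0" using corthogonalD[OF ws(2), of i i] that ws(3) by simp
    moreover have "(ws ! i) \<bullet>c (ws ! i) = of_real (N i)"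
      using ip[OF that that] e[OF that that] by simp
    ultimately have "N i \<noteq> 0" by auto
    moreover have "N i \<ge> 0" unfolding N_def by (intro sum_nonneg) auto
    ultimately show ?thesis by simp
  qed
  define W where "W = Matrix.mat (Suc n) (Suc n) (\<lambda>(l,i). of_real (1 / sqrt (N i)) * vec_index (ws ! i) l)"
  have W: "W \<in> carrier_mat (Suc n) (Suc n)" by (simp add: W_def)
  have "mat_adjoint W * W = 1\<^sub>m (Suc n)"
  proof (rule eq_matI)
    fix i j assume "i < dim_row (1\<^sub>m (Suc n) :: complex mat)" "j < dim_col (1\<^sub>m (Suc n) :: complex mat)"
    hence ij: "i < Suc n" "j < Suc n" by auto
    have "(mat_adjoint W * W) $$ (i,j) = (\<Sum>l<Suc n. cnj (W $$ (l,i)) * W $$ (l,j))"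
      using W ij by (auto simp: scalar_prod_def atLeast0LessThan simp del: sum.lessThan_Suc)
    also have "\<dots> = of_real (1 / sqrt (N i)) * of_real (1 / sqrt (N j)) * (\<Sum>l<Suc n. cnj (vec_index (ws ! i) l) * vec_index (ws ! j) l)"
      unfolding sum_distrib_left W_def using ij by (intro sum.cong) auto
    also have "\<dots> = (1\<^sub>m (Suc n)) $$ (i,j)"
    proof (cases "i = j")
      case True
      have "of_real (1 / sqrt (N i)) * of_real (1 / sqrt (N i)) * of_real (N i) = (of_real (1 / sqrt (N i) * (1 / sqrt (N i)) * N i) :: complex)"
        by (simp only: of_real_mult)
      also have "1 / sqrt (N i) * (1 / sqrt (N i)) * N i = 1"
        using Npos[OF ij(1)] by (simp add: field_simps)
      finally show ?thesis unfolding ip[OF ij] using True ij by simp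
    next
      case False thus ?thesis using ip[OF ij] ij by simp
    qed
    finally show "(mat_adjoint W * W) $$ (i,j) = (1\<^sub>m (Suc n)) $$ (i,j)" .
  qed (use W in auto)
  moreover have "col W 0 = of_real (1 / sqrt (N 0)) \<cdot>\<^sub>v v"
    using v hdws by (intro eq_vecI) (auto simp: W_def)
  ultimately show ?thesis using W by blast
qed

text \<open>Deflation by induction on the size: a unitary change of basis moves an eigenvector to
  the first coordinate, which clears the first column below the diagonal. Being Hermitian survives
  the change of basis, so the first row is cleared as well and the remaining block is again
  Hermitian.\<close>

lemma hermitian_spectral:
  fixes A :: "complex mat"
  assumes "A \<in> carrier_mat n n" "mat_adjoint A = A"
  shows "\<exists>U \<in> carrier_mat n n. \<exists>B \<in> carrier_mat n n.
           diagonal_mat B \<and> mat_adjoint U * U = 1\<^sub>m n \<and> A * U = U * B"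
  using assms
proof (induction n arbitrary: A)
  case 0
  show ?case
    by (rule bexI[of _ "1\<^sub>m 0"], rule bexI[of _ "1\<^sub>m 0"]) (use 0 in \<open>auto simp: diagonal_mat_def intro!: eq_matI\<close>)
next
  case (Suc n)
  note A = Suc.prems(1)
  have "degree (char_poly A) \<noteq> 0" using degree_monic_char_poly[OF A] by simp
  then obtain e where "poly (char_poly A) e = 0"
    using fundamental_theorem_of_algebra_alt[of "char_poly A"] by fastforce
  hence "eigenvalue A e" using eigenvalue_root_char_poly[OF A] by simp
  then obtain v where v: "v \<in> carrier_vec (Suc n)" "v \<noteq> 0\<^sub>v (Suc n)" "A *\<^sub>v v = e \<cdot>\<^sub>v v"
    using A unfolding eigenvalue_def eigenvector_def by auto
  from unitary_with_first_column[OF v(1,2)] obtain W c where W: "W \<in> carrier_mat (Suc n) (Suc n)"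
    and WW: "mat_adjoint W * W = 1\<^sub>m (Suc n)" and c: "col W 0 = c \<cdot>\<^sub>v v" by blast
  have W': "mat_adjoint W \<in> carrier_mat (Suc n) (Suc n)" using W by simp
  have WW2: "W * mat_adjoint W = 1\<^sub>m (Suc n)"
    by (rule mat_mult_left_right_inverse[OF W' W WW])
  define A' where "A' = mat_adjoint W * (A * W)"
  have A': "A' \<in> carrier_mat (Suc n) (Suc n)" unfolding A'_def using A W W' by auto
  have AW: "A * W = W * A'" unfolding A'_def
    using assoc_mult_mat[OF W W', of "A * W" "Suc n"] A W WW2 by auto
  have herm: "mat_adjoint A' = A'"
    unfolding A'_def
    using mat_adjoint_mult[OF W', of "A * W" "Suc n"] mat_adjoint_mult[OF A W] A W W' Suc.prems(2)
      assoc_mult_mat[OF W' A W] by auto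
  have colA: "A' $$ (i,0) = (if i = 0 then e else 0)" if "i < Suc n" for i
  proof -
    have "A' $$ (i,0) = vec_index (col A' 0) i" using that A' by auto
    also have "col A' 0 = mat_adjoint W *\<^sub>v (A *\<^sub>v col W 0)"
    proof -
      have "col A' 0 = mat_adjoint W *\<^sub>v col (A * W) 0"
        unfolding A'_def by (rule col_mult2[OF W', of _ "Suc n"]) (use A W in auto)
      also have "col (A * W) 0 = A *\<^sub>v col W 0"
        by (rule col_mult2[OF A W]) auto
      finally show ?thesis .
    qed
    also have "A *\<^sub>v col W 0 = e \<cdot>\<^sub>v col W 0"
      unfolding c using mult_mat_vec[OF A v(1)] v(3) v(1) by (auto simp: smult_smult_assoc mult.commute)
    also have "mat_adjoint W *\<^sub>v (e \<cdot>\<^sub>v col W 0) = e \<cdot>\<^sub>v (mat_adjoint W *\<^sub>v col W 0)"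
      using mult_mat_vec[OF W', of "col W 0"] W by auto
    also have "mat_adjoint W *\<^sub>v col W 0 = col (mat_adjoint W * W) 0"
      by (rule col_mult2[OF W' W, symmetric]) auto
    also have "vec_index (e \<cdot>\<^sub>v col (mat_adjoint W * W) 0) i = (if i = 0 then e else 0)"
      unfolding WW using that by auto
    finally show ?thesis .
  qed
  have rowA: "A' $$ (0,i) = (if i = 0 then e else 0)" if "i < Suc n" for i
  proof (cases "i = 0")
    case True thus ?thesis using colA by auto
  next
    case False
    have "mat_adjoint A' $$ (0,i) = cnj (A' $$ (i,0))" using A' that by auto
    thus ?thesis using colA[OF that] False herm by simp
  qed
  define A3 where "A3 = Matrix.mat n n (\<lambda>(i,j). A' $$ (Suc i, Suc j))"
  define E where "E = Matrix.mat 1 1 (\<lambda>_. e)"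
  have E: "E \<in> carrier_mat 1 1" by (simp add: E_def)
  have A3: "A3 \<in> carrier_mat n n" by (simp add: A3_def)
  have A'bl: "A' = four_block_mat E (0\<^sub>m 1 n) (0\<^sub>m n 1) A3"
    by (rule eq_matI) (use A' E A3 colA rowA in \<open>auto simp: A3_def E_def\<close>)
  have "mat_adjoint A3 = A3"
  proof (rule eq_matI)
    fix i j assume "i < dim_row A3" "j < dim_col A3"
    hence ij: "i < n" "j < n" using A3 by auto
    have "mat_adjoint A' $$ (Suc i, Suc j) = cnj (A' $$ (Suc j, Suc i))" using A' ij by auto
    thus "mat_adjoint A3 $$ (i,j) = A3 $$ (i,j)" using ij herm by (simp add: A3_def)
  qed (use A3 in auto)
  from Suc.IH[OF A3 this] obtain U3 B3 where U3: "U3 \<in> carrier_mat n n" and B3: "B3 \<in> carrier_mat n n"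
    and d3: "diagonal_mat B3" and u3: "mat_adjoint U3 * U3 = 1\<^sub>m n" and AU3: "A3 * U3 = U3 * B3" by blast
  define F where "F = four_block_mat (1\<^sub>m 1) (0\<^sub>m 1 n) (0\<^sub>m n 1) U3"
  define B where "B = four_block_mat E (0\<^sub>m 1 n) (0\<^sub>m n 1) B3"
  have F: "F \<in> carrier_mat (Suc n) (Suc n)" unfolding F_def using four_block_carrier_mat[of "1\<^sub>m 1" 1 1 U3 n n] U3 by auto
  have B: "B \<in> carrier_mat (Suc n) (Suc n)" unfolding B_def using four_block_carrier_mat[OF E B3] by auto
  have F': "mat_adjoint F = four_block_mat (1\<^sub>m 1) (0\<^sub>m 1 n) (0\<^sub>m n 1) (mat_adjoint U3)"
    by (rule eq_matI) (use U3 in \<open>auto simp: F_def\<close>)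
  have FF: "mat_adjoint F * F = 1\<^sub>m (Suc n)"
    unfolding F' unfolding F_def
    by (subst mult_four_block_mat[of _ 1 1 _ n _ n _ _ 1 _ n])
      (use U3 u3 in \<open>auto intro!: eq_matI\<close>)
  have AF: "A' * F = F * B"
  proof -
    have "A' * F = four_block_mat E (0\<^sub>m 1 n) (0\<^sub>m n 1) (A3 * U3)"
      unfolding A'bl F_def
      by (subst mult_four_block_mat[of _ 1 1 _ n _ n _ _ 1 _ n]) (use E U3 A3 in simp_all)
    moreover have "F * B = four_block_mat E (0\<^sub>m 1 n) (0\<^sub>m n 1) (U3 * B3)"
      unfolding B_def F_def
      by (subst mult_four_block_mat[of _ 1 1 _ n _ n _ _ 1 _ n]) (use E U3 B3 in simp_all)
    ultimately show ?thesis using AU3 by simp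
  qed
  have dB: "diagonal_mat B" unfolding diagonal_mat_def B_def using E B3 d3
    by (auto simp: diagonal_mat_def)
  show ?case
  proof (intro bexI conjI)
    show "mat_adjoint (W * F) * (W * F) = 1\<^sub>m (Suc n)"
    proof -
      have "mat_adjoint (W * F) * (W * F) = mat_adjoint F * mat_adjoint W * (W * F)"
        using mat_adjoint_mult[OF W F] by simp
      also have "\<dots> = mat_adjoint F * (mat_adjoint W * (W * F))"
        by (rule assoc_mult_mat[of _ "Suc n" "Suc n"]) (use W F in auto)
      also have "mat_adjoint W * (W * F) = F"
        using assoc_mult_mat[OF W' W F] WW F by auto
      finally show ?thesis using FF by simp
    qed
    have "A * (W * F) = A * W * F" using assoc_mult_mat[OF A W F] by simp
    also have "\<dots> = W * (A' * F)" unfolding AW using assoc_mult_mat[OF W A' F] by simp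
    also have "\<dots> = W * F * B" unfolding AF using assoc_mult_mat[OF W F B] by simp
    finally show "A * (W * F) = W * F * B" .
  qed (use W F B dB in auto)
qed

section \<open>Singular value counts of kernels on finite sets\<close>

text \<open>Vectors are functions on an arbitrary finite index set, so that multi-indices need no
  enumeration. The form is conjugate-linear in the first argument: \<open>inner_on S (u j) v\<close>
  is the coefficient of \<open>v\<close> along \<open>u j\<close>.\<close>

definition inner_on :: "'i set \<Rightarrow> ('i \<Rightarrow> complex) \<Rightarrow> ('i \<Rightarrow> complex) \<Rightarrow> complex" where
  "inner_on S f g = (\<Sum>i\<in>S. cnj (f i) * g i)"

definition norm_sq :: "'i set \<Rightarrow> ('i \<Rightarrow> complex) \<Rightarrow> real" where
  "norm_sq S f = (\<Sum>i\<in>S. (cmod (f i))\<^sup>2)"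

definition kernel_app :: "'i set \<Rightarrow> ('i \<Rightarrow> 'i \<Rightarrow> complex) \<Rightarrow> ('i \<Rightarrow> complex) \<Rightarrow> 'i \<Rightarrow> complex" where
  "kernel_app S a v = (\<lambda>i. \<Sum>j\<in>S. a i j * v j)"

definition orthonormal :: "'i set \<Rightarrow> 'j set \<Rightarrow> ('j \<Rightarrow> 'i \<Rightarrow> complex) \<Rightarrow> bool" where
  "orthonormal S J u \<longleftrightarrow> finite S \<and> finite J \<and> (\<forall>j\<in>J. \<forall>k\<in>J. inner_on S (u j) (u k) = (if j = k then 1 else 0))"

text \<open>By the min-max principle this says that at most \<open>r\<close> singular values of the kernel \<open>a\<close> on \<open>S\<close> exceed \<open>L\<close>.
  In this form it needs no enumeration of \<open>S\<close>, and subadditivity amounts to joining two lists of constraints.\<close>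

definition sv_bound :: "'i set \<Rightarrow> ('i \<Rightarrow> 'i \<Rightarrow> complex) \<Rightarrow> nat \<Rightarrow> real \<Rightarrow> bool" where
  "sv_bound S a r L \<longleftrightarrow> (\<exists>c :: nat \<Rightarrow> 'i \<Rightarrow> complex. \<forall>v.
     (\<forall>t<r. (\<Sum>i\<in>S. c t i * v i) = 0) \<longrightarrow> norm_sq S (kernel_app S a v) \<le> L\<^sup>2 * norm_sq S v)"

section \<open>Orthonormal families and the min-max principle\<close>

lemma norm_sq_nonneg [simp]: "0 \<le> norm_sq S f"
  by (simp add: norm_sq_def sum_nonneg)

lemma norm_sq_inner_on: "of_real (norm_sq S f) = inner_on S f f"
  unfolding norm_sq_def inner_on_def of_real_sum
  by (intro sum.cong refl) (simp add: complex_norm_square mult.commute del: of_real_power)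

lemma inner_on_cnj: "cnj (inner_on S f g) = inner_on S g f"
  by (simp add: inner_on_def mult.commute)

lemma inner_on_sum_right: "inner_on S f (\<lambda>i. \<Sum>j\<in>J. c j * u j i) = (\<Sum>j\<in>J. c j * inner_on S f (u j))"
  unfolding inner_on_def sum_distrib_left by (subst sum.swap) (simp add: mult_ac)

lemma inner_on_sum_left: "inner_on S (\<lambda>i. \<Sum>j\<in>J. c j * u j i) f = (\<Sum>j\<in>J. cnj (c j) * inner_on S (u j) f)"
  unfolding inner_on_def sum_distrib_left sum_distrib_right cnj_sum 
  by (subst sum.swap) (simp add: mult_ac)

lemma inner_on_diff_left: "inner_on S (\<lambda>i. f i - g i) h = inner_on S f h - inner_on S g h"
  by (simp add: inner_on_def algebra_simps sum_subtractf)

lemma inner_on_diff_right: "inner_on S h (\<lambda>i. f i - g i) = inner_on S h f - inner_on S h g"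
  by (simp add: inner_on_def algebra_simps sum_subtractf)

lemma inner_on_orthonormal_sum:
  assumes "orthonormal S J u" "k \<in> J"
  shows "inner_on S (u k) (\<lambda>i. \<Sum>j\<in>J. c j * u j i) = c k"
proof -
  have "(\<Sum>j\<in>J. c j * inner_on S (u k) (u j)) = (\<Sum>j\<in>J. if k = j then c j else 0)"
    using assms by (intro sum.cong) (auto simp: orthonormal_def)
  thus ?thesis using assms by (simp add: inner_on_sum_right orthonormal_def)
qed

lemma norm_sq_orthonormal_sum:
  assumes "orthonormal S J u"
  shows "norm_sq S (\<lambda>i. \<Sum>j\<in>J. c j * u j i) = (\<Sum>j\<in>J. (cmod (c j))\<^sup>2)"
proof -
  have "complex_of_real (norm_sq S (\<lambda>i. \<Sum>j\<in>J. c j * u j i)) = (\<Sum>j\<in>J. cnj (c j) * c j)"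
    unfolding norm_sq_inner_on using inner_on_orthonormal_sum[OF assms]
    by (subst inner_on_sum_left) (auto intro!: sum.cong)
  also have "\<dots> = of_real (\<Sum>j\<in>J. (cmod (c j))\<^sup>2)"
    unfolding of_real_sum by (intro sum.cong refl) (simp add: complex_norm_square mult.commute del: of_real_power)
  finally show ?thesis using of_real_eq_iff by blast
qed

text \<open>\<open>w\<close> is the orthogonal projection of \<open>v\<close> onto the span of the
  family, so the squared norm of \<open>v - w\<close> is the difference of the two sides.\<close>

lemma bessel:
  assumes "orthonormal S J u"
  shows "(\<Sum>j\<in>J. (cmod (inner_on S (u j) v))\<^sup>2) \<le> norm_sq S v"
proof -
  define w where "w = (\<lambda>i. \<Sum>j\<in>J. inner_on S (u j) v * u j i)"
  have ww: "inner_on S w w = of_real (\<Sum>j\<in>J. (cmod (inner_on S (u j) v))\<^sup>2)"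
    using norm_sq_orthonormal_sum[OF assms] unfolding w_def by (metis norm_sq_inner_on)
  have vw: "inner_on S w v = inner_on S w w"
  proof -
    have "inner_on S w v = (\<Sum>j\<in>J. cnj (inner_on S (u j) v) * inner_on S (u j) v)"
      unfolding w_def by (simp add: inner_on_sum_left)
    also have "\<dots> = inner_on S w w" unfolding ww of_real_sum
      by (intro sum.cong refl) (simp add: complex_norm_square mult.commute del: of_real_power)
    finally show ?thesis .
  qed
  have wv: "inner_on S v w = inner_on S w w"
    using vw inner_on_cnj by metis
  have "complex_of_real (norm_sq S (\<lambda>i. v i - w i)) = inner_on S v v - inner_on S w w"
    unfolding norm_sq_inner_on by (simp add: inner_on_diff_left inner_on_diff_right vw wv)
  also have "\<dots> = of_real (norm_sq S v - (\<Sum>j\<in>J. (cmod (inner_on S (u j) v))\<^sup>2))"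
    using ww by (simp add: norm_sq_inner_on)
  finally have "norm_sq S (\<lambda>i. v i - w i) = norm_sq S v - (\<Sum>j\<in>J. (cmod (inner_on S (u j) v))\<^sup>2)"
    using of_real_eq_iff by blast
  thus ?thesis using norm_sq_nonneg[of S "\<lambda>i. v i - w i"] by linarith
qed

text \<open>Gaussian elimination, one equation at a time: a pivot of the last equation removes one
  unknown from the others, and its value is recovered by back substitution. This is the dimension
  count in the min-max principle.\<close>

lemma underdetermined_system:
  fixes m :: "nat \<Rightarrow> 'j \<Rightarrow> 'a :: field"
  assumes "finite J" "r < card J"
  shows "\<exists>y. (\<exists>j\<in>J. y j \<noteq> 0) \<and> (\<forall>t<r. (\<Sum>j\<in>J. m t j * y j) = 0)"
  using assms
proof (induction r arbitrary: J m)
  case 0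
  then obtain j where "j \<in> J" by (cases "J = {}") auto
  thus ?case by (intro exI[of _ "\<lambda>_. 1"]) auto
next
  case (Suc r)
  show ?case
  proof (cases "\<exists>j0\<in>J. m r j0 \<noteq> 0")
    case False
    from Suc.IH[of J m] Suc.prems obtain y where "\<exists>j\<in>J. y j \<noteq> 0" "\<forall>t<r. (\<Sum>j\<in>J. m t j * y j) = 0"
      by auto
    thus ?thesis using False by (intro exI[of _ y]) (auto simp: less_Suc_eq)
  next
    case True
    then obtain j0 where j0: "j0 \<in> J" "m r j0 \<noteq> 0" by blast
    define J' where "J' = J - {j0}"
    have J': "finite J'" "r < card J'" using Suc.prems j0 by (auto simp: J'_def)
    from Suc.IH[OF this, of "\<lambda>t j. m t j - m t j0 * m r j / m r j0"] obtain y where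
      y: "\<exists>j\<in>J'. y j \<noteq> 0" "\<And>t. t < r \<Longrightarrow> (\<Sum>j\<in>J'. (m t j - m t j0 * m r j / m r j0) * y j) = 0" by blast
    define z where "z = y(j0 := - (\<Sum>j\<in>J'. m r j * y j) / m r j0)"
    have s: "(\<Sum>j\<in>J. m t j * z j) = m t j0 * z j0 + (\<Sum>j\<in>J'. m t j * y j)" for t
    proof -
      have "(\<Sum>j\<in>J. m t j * z j) = m t j0 * z j0 + (\<Sum>j\<in>J'. m t j * z j)"
        unfolding J'_def using Suc.prems(1) j0(1) by (rule sum.remove)
      also have "(\<Sum>j\<in>J'. m t j * z j) = (\<Sum>j\<in>J'. m t j * y j)"
        by (intro sum.cong) (auto simp: z_def J'_def)
      finally show ?thesis .
    qed
    have "(\<Sum>j\<in>J. m t j * z j) = 0" if "t < Suc r" for t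
    proof (cases "t = r")
      case True
      thus ?thesis unfolding s using j0 by (simp add: z_def)
    next
      case False
      hence "0 = (\<Sum>j\<in>J'. (m t j - m t j0 * m r j / m r j0) * y j)" using y(2)[of t] that by auto
      also have "\<dots> = (\<Sum>j\<in>J'. m t j * y j) - (\<Sum>j\<in>J'. m t j0 / m r j0 * (m r j * y j))"
        unfolding sum_subtractf[symmetric] by (intro sum.cong) (auto simp: algebra_simps)
      also have "\<dots> = (\<Sum>j\<in>J. m t j * z j)"
        unfolding s unfolding sum_distrib_left[symmetric] by (simp add: z_def)
      finally show ?thesis by simp
    qed
    moreover have "\<exists>j\<in>J. z j \<noteq> 0" using y(1) by (auto simp: z_def J'_def)
    ultimately show ?thesis by blast
  qed
qed

text \<open>Courant-Fischer, with \<open>\<mu> j\<close> the squared singular values and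
  \<open>u j\<close> the right singular vectors. Forbidding the directions with
  \<open>\<mu> j > L^2\<close> suffices; conversely, fewer constraints than such directions leave a
  nonzero combination of them, which is stretched by more than \<open>L\<close>. The family need not
  span: Bessel's inequality takes the place of Parseval's identity, which matters for the modes of
  the block model.\<close>

lemma sv_bound_orthonormal_iff:
  fixes u :: "'j \<Rightarrow> 'i \<Rightarrow> complex"
  assumes on: "orthonormal S J u" and \<mu>: "\<And>j. j \<in> J \<Longrightarrow> \<mu> j \<ge> 0"
    and a: "\<And>v. norm_sq S (kernel_app S a v) = (\<Sum>j\<in>J. \<mu> j * (cmod (inner_on S (u j) v))\<^sup>2)"
    and L: "L \<ge> 0"
  shows "sv_bound S a r L \<longleftrightarrow> card {j\<in>J. \<mu> j > L\<^sup>2} \<le> r"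
proof
  define K where "K = {j\<in>J. \<mu> j > L\<^sup>2}"
  have fin: "finite S" "finite J" "finite K" using on by (auto simp: orthonormal_def K_def)
  {
    assume "card {j\<in>J. \<mu> j > L\<^sup>2} \<le> r"
    hence cK: "card K \<le> r" by (simp add: K_def)
    obtain e where e: "bij_betw e {..<card K} K"
      using ex_bij_betw_nat_finite[OF fin(3)] by (auto simp: atLeast0LessThan)
    have "norm_sq S (kernel_app S a v) \<le> L\<^sup>2 * norm_sq S v" if "\<forall>t<r. (\<Sum>i\<in>S. cnj (u (e t) i) * v i) = 0" for v
    proof -
      have z: "inner_on S (u j) v = 0" if j: "j \<in> K" for j
      proof -
        obtain t where "t < card K" "j = e t" using e j by (auto simp: bij_betw_def)
        thus ?thesis using \<open>\<forall>t<r. _\<close> cK by (auto simp: inner_on_def)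
      qed
      have "norm_sq S (kernel_app S a v) \<le> (\<Sum>j\<in>J. L\<^sup>2 * (cmod (inner_on S (u j) v))\<^sup>2)"
        unfolding a
      proof (intro sum_mono)
        fix j assume j: "j \<in> J"
        show "\<mu> j * (cmod (inner_on S (u j) v))\<^sup>2 \<le> L\<^sup>2 * (cmod (inner_on S (u j) v))\<^sup>2"
        proof (cases "j \<in> K")
          case False
          thus ?thesis using j by (intro mult_right_mono) (auto simp: K_def)
        qed (simp add: z)
      qed
      also have "\<dots> \<le> L\<^sup>2 * norm_sq S v"
        unfolding sum_distrib_left[symmetric] using bessel[OF on] by (intro mult_left_mono) auto
      finally show ?thesis .
    qed
    thus "sv_bound S a r L" unfolding sv_bound_def by (intro exI[of _ "\<lambda>t i. cnj (u (e t) i)"]) blast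
  }
  {
    assume "sv_bound S a r L"
    then obtain c where c: "\<And>v. (\<forall>t<r. (\<Sum>i\<in>S. c t i * v i) = 0) \<Longrightarrow> norm_sq S (kernel_app S a v) \<le> L\<^sup>2 * norm_sq S v"
      unfolding sv_bound_def by blast
    show "card {j\<in>J. \<mu> j > L\<^sup>2} \<le> r"
    proof (rule ccontr)
      assume "\<not> ?thesis"
      hence "r < card K" by (simp add: K_def)
      from underdetermined_system[OF fin(3) this, of "\<lambda>t j. \<Sum>i\<in>S. c t i * u j i"]
      obtain y where y: "\<exists>j\<in>K. y j \<noteq> 0" "\<And>t. t < r \<Longrightarrow> (\<Sum>j\<in>K. (\<Sum>i\<in>S. c t i * u j i) * y j) = 0" by blast
      \<comment> \<open>Extension by zero from \<open>K\<close> to \<open>J\<close>, so that the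
        expansion formulas over \<open>J\<close> apply.\<close>
      define y' where "y' j = (if j \<in> K then y j else 0)" for j
      define v where "v = (\<lambda>i. \<Sum>j\<in>J. y' j * u j i)"
      have KJ: "K \<subseteq> J" by (auto simp: K_def)
      have v': "v i = (\<Sum>j\<in>K. y j * u j i)" for i
        unfolding v_def by (rule sum.mono_neutral_cong_right[OF fin(2) KJ]) (auto simp: y'_def)
      have "(\<Sum>i\<in>S. c t i * v i) = 0" if "t < r" for t
        using y(2)[OF that] unfolding v' sum_distrib_left sum_distrib_right
        by (subst sum.swap) (simp add: mult_ac)
      hence le: "norm_sq S (kernel_app S a v) \<le> L\<^sup>2 * norm_sq S v" using c by blast
      have "L\<^sup>2 * norm_sq S v = (\<Sum>j\<in>J. L\<^sup>2 * (cmod (y' j))\<^sup>2)"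
        unfolding v_def norm_sq_orthonormal_sum[OF on] sum_distrib_left ..
      also have "\<dots> < (\<Sum>j\<in>J. \<mu> j * (cmod (y' j))\<^sup>2)"
      proof (rule sum_strict_mono_ex1[OF fin(2)])
        show "\<forall>x\<in>J. L\<^sup>2 * (cmod (y' x))\<^sup>2 \<le> \<mu> x * (cmod (y' x))\<^sup>2"
          by (auto simp: y'_def K_def intro!: mult_right_mono)
        from y(1) obtain j where "j \<in> K" "y j \<noteq> 0" by blast
        thus "\<exists>x\<in>J. L\<^sup>2 * (cmod (y' x))\<^sup>2 < \<mu> x * (cmod (y' x))\<^sup>2"
          by (intro bexI[of _ j]) (auto simp: y'_def K_def intro!: mult_strict_right_mono)
      qed
      also have "\<dots> = norm_sq S (kernel_app S a v)"
        unfolding a using inner_on_orthonormal_sum[OF on] by (auto simp: v_def intro!: sum.cong)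
      finally show False using le by simp
    qed
  }
qed

text \<open>For a kernel that is diagonal in an orthonormal family the moduli of the eigenvalues act
  as singular values. This is the exact count used for the block diagonal model.\<close>

lemma sv_bound_diagonal_iff:
  assumes on: "orthonormal S J u" and L: "L \<ge> 0"
  shows "sv_bound S (\<lambda>i k. \<Sum>j\<in>J. l j * u j i * cnj (u j k)) r L \<longleftrightarrow> card {j\<in>J. cmod (l j) > L} \<le> r"
proof -
  have "norm_sq S (kernel_app S (\<lambda>i k. \<Sum>j\<in>J. l j * u j i * cnj (u j k)) v) = (\<Sum>j\<in>J. (cmod (l j))\<^sup>2 * (cmod (inner_on S (u j) v))\<^sup>2)" for v
  proof -
    have "kernel_app S (\<lambda>i k. \<Sum>j\<in>J. l j * u j i * cnj (u j k)) v = (\<lambda>i. \<Sum>j\<in>J. (l j * inner_on S (u j) v) * u j i)"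
      unfolding kernel_app_def inner_on_def sum_distrib_left sum_distrib_right
      by (rule ext, subst sum.swap) (simp add: mult_ac)
    thus ?thesis using norm_sq_orthonormal_sum[OF on, of "\<lambda>j. l j * inner_on S (u j) v"]
      by (simp add: norm_mult power_mult_distrib)
  qed
  from sv_bound_orthonormal_iff[OF on _ this L] 
  have "sv_bound S (\<lambda>i k. \<Sum>j\<in>J. l j * u j i * cnj (u j k)) r L \<longleftrightarrow> card {j\<in>J. (cmod (l j))\<^sup>2 > L\<^sup>2} \<le> r" by simp
  also have "{j\<in>J. (cmod (l j))\<^sup>2 > L\<^sup>2} = {j\<in>J. cmod (l j) > L}"
    using L by (auto simp: power2_less_imp_less intro: power_strict_mono)
  finally show ?thesis .
qed

section \<open>Rules for singular value counts: sums, subsets, reindexing\<close>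

lemma sqrt_norm_sq: "sqrt (norm_sq S f) = L2_set (\<lambda>i. cmod (f i)) S"
  by (simp add: norm_sq_def L2_set_def)

lemma norm_sq_le_iff: "L \<ge> 0 \<Longrightarrow> norm_sq S f \<le> L\<^sup>2 * norm_sq S v \<longleftrightarrow> sqrt (norm_sq S f) \<le> L * sqrt (norm_sq S v)"
  by (metis real_sqrt_le_iff real_sqrt_mult real_sqrt_abs abs_of_nonneg)

text \<open>Weyl's inequality \<open>s_(r+q+1)(a + b) \<le> s_(r+1)(a) + s_(q+1)(b)\<close>: where
  both lists of constraints hold, the triangle inequality of the Euclidean norm applies.\<close>

lemma sv_bound_add:
  assumes "sv_bound S a r L" "sv_bound S b q M" "L \<ge> 0" "M \<ge> 0"
  shows "sv_bound S (\<lambda>i j. a i j + b i j) (r + q) (L + M)"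
proof -
  obtain c where c: "\<And>v. (\<forall>t<r. (\<Sum>i\<in>S. c t i * v i) = 0) \<Longrightarrow> norm_sq S (kernel_app S a v) \<le> L\<^sup>2 * norm_sq S v"
    using assms(1) unfolding sv_bound_def by blast
  obtain d where d: "\<And>v. (\<forall>t<q. (\<Sum>i\<in>S. d t i * v i) = 0) \<Longrightarrow> norm_sq S (kernel_app S b v) \<le> M\<^sup>2 * norm_sq S v"
    using assms(2) unfolding sv_bound_def by blast
  define e where "e t = (if t < r then c t else d (t - r))" for t
  have "norm_sq S (kernel_app S (\<lambda>i j. a i j + b i j) v) \<le> (L + M)\<^sup>2 * norm_sq S v"
    if "\<forall>t<r+q. (\<Sum>i\<in>S. e t i * v i) = 0" for v
  proof -
    have 1: "\<forall>t<r. (\<Sum>i\<in>S. c t i * v i) = 0"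
    proof (intro allI impI)
      fix t assume "t < r"
      thus "(\<Sum>i\<in>S. c t i * v i) = 0" using spec[OF that, of t] by (auto simp: e_def)
    qed
    have 2: "\<forall>t<q. (\<Sum>i\<in>S. d t i * v i) = 0"
    proof (intro allI impI)
      fix t assume "t < q"
      thus "(\<Sum>i\<in>S. d t i * v i) = 0" using spec[OF that, of "t + r"] by (auto simp: e_def)
    qed
    have "sqrt (norm_sq S (kernel_app S (\<lambda>i j. a i j + b i j) v)) = L2_set (\<lambda>i. cmod (kernel_app S a v i + kernel_app S b v i)) S"
      by (simp add: sqrt_norm_sq kernel_app_def algebra_simps sum.distrib)
    also have "\<dots> \<le> L2_set (\<lambda>i. cmod (kernel_app S a v i) + cmod (kernel_app S b v i)) S"
      by (intro L2_set_mono norm_triangle_ineq) auto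
    also have "\<dots> \<le> sqrt (norm_sq S (kernel_app S a v)) + sqrt (norm_sq S (kernel_app S b v))"
      unfolding sqrt_norm_sq by (rule L2_set_triangle_ineq)
    also have "\<dots> \<le> L * sqrt (norm_sq S v) + M * sqrt (norm_sq S v)"
      using c[OF 1] d[OF 2] assms(3,4) by (intro add_mono) (auto simp: norm_sq_le_iff)
    finally show ?thesis using assms(3,4) by (subst norm_sq_le_iff) (auto simp: algebra_simps)
  qed
  thus ?thesis unfolding sv_bound_def by blast
qed

lemma sv_bound_uminus: "sv_bound S (\<lambda>i j. - a i j) r L \<longleftrightarrow> sv_bound S a r L"
  by (simp add: sv_bound_def norm_sq_def kernel_app_def sum_negf)

lemma sv_bound_cong:
  assumes "\<And>i j. i \<in> S \<Longrightarrow> j \<in> S \<Longrightarrow> a i j = b i j"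
  shows "sv_bound S a r L \<longleftrightarrow> sv_bound S b r L"
proof -
  have "norm_sq S (kernel_app S a v) = norm_sq S (kernel_app S b v)" for v
    unfolding norm_sq_def kernel_app_def using assms by (intro sum.cong refl) (simp cong: sum.cong)
  thus ?thesis by (simp add: sv_bound_def)
qed

text \<open>Extending a vector on \<open>T\<close> by zero to \<open>S\<close> preserves its norm,
  and cutting the image back to \<open>T\<close> cannot increase it. This carries estimates for the
  whole grid over to the part in the domain.\<close>

lemma sv_bound_subset:
  assumes "sv_bound S a r L" "T \<subseteq> S" "finite S"
  shows "sv_bound T a r L"
proof -
  obtain c where c: "\<And>v. (\<forall>t<r. (\<Sum>i\<in>S. c t i * v i) = 0) \<Longrightarrow> norm_sq S (kernel_app S a v) \<le> L\<^sup>2 * norm_sq S v"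
    using assms(1) unfolding sv_bound_def by blast
  have "norm_sq T (kernel_app T a v) \<le> L\<^sup>2 * norm_sq T v" if v: "\<forall>t<r. (\<Sum>i\<in>T. c t i * v i) = 0" for v
  proof -
    define w where "w i = (if i \<in> T then v i else 0)" for i
    have ex: "(\<Sum>i\<in>S. f i * w i) = (\<Sum>i\<in>T. f i * v i)" for f
      using assms(2,3) by (intro sum.mono_neutral_cong_right) (auto simp: w_def)
    have "norm_sq T (kernel_app T a v) = norm_sq T (kernel_app S a w)" by (simp add: kernel_app_def ex)
    also have "\<dots> \<le> norm_sq S (kernel_app S a w)" unfolding norm_sq_def using assms(2,3) by (intro sum_mono2) auto
    also have "\<dots> \<le> L\<^sup>2 * norm_sq S w" by (rule c) (use v in \<open>simp add: ex\<close>)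
    also have "norm_sq S w = norm_sq T v"
      unfolding norm_sq_def using assms(2,3) by (intro sum.mono_neutral_cong_right) (auto simp: w_def)
    finally show ?thesis .
  qed
  thus ?thesis unfolding sv_bound_def by blast
qed

lemma sv_bound_reindex:
  assumes f: "bij_betw f T S"
  shows "sv_bound T (\<lambda>i j. a (f i) (f j)) r L \<longleftrightarrow> sv_bound S a r L"
proof -
  define g where "g = inv_into T f"
  have g: "bij_betw g S T" "\<And>x. x \<in> T \<Longrightarrow> g (f x) = x" "\<And>x. x \<in> S \<Longrightarrow> f (g x) = x"
    using f by (auto simp: g_def bij_betw_inv_into bij_betw_inv_into_left bij_betw_inv_into_right)
  have n: "norm_sq T (\<lambda>i. v (f i)) = norm_sq S v" for v
    unfolding norm_sq_def using f by (rule sum.reindex_bij_betw)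
  have s: "(\<Sum>i\<in>T. c (f i) * v (f i)) = (\<Sum>i\<in>S. c i * v i)" for c v :: "_ \<Rightarrow> complex"
    using f by (rule sum.reindex_bij_betw)
  show ?thesis
  proof
    assume "sv_bound T (\<lambda>i j. a (f i) (f j)) r L"
    then obtain c where c: "\<And>v. (\<forall>t<r. (\<Sum>i\<in>T. c t i * v i) = 0) \<Longrightarrow> norm_sq T (kernel_app T (\<lambda>i j. a (f i) (f j)) v) \<le> L\<^sup>2 * norm_sq T v"
      unfolding sv_bound_def by blast
    have "norm_sq S (kernel_app S a v) \<le> L\<^sup>2 * norm_sq S v" if v: "\<forall>t<r. (\<Sum>i\<in>S. c t (g i) * v i) = 0" for v
    proof -
      have "norm_sq T (kernel_app T (\<lambda>i j. a (f i) (f j)) (\<lambda>i. v (f i))) \<le> L\<^sup>2 * norm_sq T (\<lambda>i. v (f i))"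
      proof (rule c, intro allI impI)
        fix t assume "t < r"
        have "(\<Sum>i\<in>T. c t i * v (f i)) = (\<Sum>i\<in>T. c t (g (f i)) * v (f i))" using g(2) by simp
        thus "(\<Sum>i\<in>T. c t i * v (f i)) = 0" using s[of "\<lambda>i. c t (g i)" v] v \<open>t < r\<close> by simp
      qed
      moreover have "kernel_app T (\<lambda>i j. a (f i) (f j)) (\<lambda>i. v (f i)) = (\<lambda>i. kernel_app S a v (f i))"
        unfolding kernel_app_def using s by fast
      ultimately show ?thesis using n by simp
    qed
    thus "sv_bound S a r L" unfolding sv_bound_def by (intro exI[of _ "\<lambda>t i. c t (g i)"]) blast
  next
    assume "sv_bound S a r L"
    then obtain c where c: "\<And>v. (\<forall>t<r. (\<Sum>i\<in>S. c t i * v i) = 0) \<Longrightarrow> norm_sq S (kernel_app S a v) \<le> L\<^sup>2 * norm_sq S v"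
      unfolding sv_bound_def by blast
    have "norm_sq T (kernel_app T (\<lambda>i j. a (f i) (f j)) v) \<le> L\<^sup>2 * norm_sq T v" if v: "\<forall>t<r. (\<Sum>i\<in>T. c t (f i) * v i) = 0" for v
    proof -
      define w where "w i = v (g i)" for i
      have w: "v i = w (f i)" if "i \<in> T" for i using g(2) that by (simp add: w_def)
      have "norm_sq S (kernel_app S a w) \<le> L\<^sup>2 * norm_sq S w"
        
      proof (rule c, intro allI impI)
        fix t assume "t < r"
        have "(\<Sum>i\<in>S. c t i * w i) = (\<Sum>i\<in>T. c t (f i) * v i)"
          unfolding s[symmetric] using w by (intro sum.cong) auto
        thus "(\<Sum>i\<in>S. c t i * w i) = 0" using v \<open>t < r\<close> by simp
      qed
      moreover have "norm_sq T v = norm_sq S w" unfolding n[symmetric] unfolding norm_sq_def using w by (intro sum.cong) auto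
      moreover have "kernel_app T (\<lambda>i j. a (f i) (f j)) v = (\<lambda>i. kernel_app S a w (f i))"
        unfolding kernel_app_def unfolding s[symmetric] using w by (intro ext sum.cong) auto
      ultimately show ?thesis using n by simp
    qed
    thus "sv_bound T (\<lambda>i j. a (f i) (f j)) r L" unfolding sv_bound_def by (intro exI[of _ "\<lambda>t i. c t (f i)"]) blast
  qed
qed

text \<open>The constraints are the coordinates themselves and force \<open>v\<close> to vanish on
  \<open>S\<close>. It follows that the infimum in \<open>acs_size\<close> is over a nonempty
  set.\<close>

lemma sv_bound_card:
  assumes "finite S"
  shows "sv_bound S a (card S) 0"
proof -
  obtain e where e: "bij_betw e {..<card S} S"
    using ex_bij_betw_nat_finite[OF assms] by (auto simp: atLeast0LessThan)
  have "norm_sq S (kernel_app S a v) \<le> 0\<^sup>2 * norm_sq S v" if v: "\<forall>t<card S. (\<Sum>i\<in>S. (if i = e t then 1 else 0) * v i) = 0" for v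
  proof -
    have "v i = 0" if i: "i \<in> S" for i
    proof -
      obtain t where t: "t < card S" "i = e t" using e i by (auto simp: bij_betw_def)
      have "(\<Sum>k\<in>S. (if k = e t then 1 else 0) * v k) = (\<Sum>k\<in>S. if k = e t then v k else 0)"
        by (intro sum.cong) auto
      thus ?thesis using v t i assms by simp
    qed
    hence "kernel_app S a v = (\<lambda>_. 0)" by (simp add: kernel_app_def)
    thus ?thesis by (simp add: norm_sq_def)
  qed
  thus ?thesis unfolding sv_bound_def
    by (intro exI[of _ "\<lambda>t i. if i = e t then 1 else 0"]) blast
qed

text \<open>The matrix form of this infimum is the minimum in the definition of \<open>d_acs\<close>; see \<open>acs_size_matrix\<close> below.\<close>

definition acs_size :: "'i set \<Rightarrow> ('i \<Rightarrow> 'i \<Rightarrow> complex) \<Rightarrow> real" where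
  "acs_size S a = Inf {real r / real (card S) + L | r L. 0 \<le> L \<and> sv_bound S a r L}"

section \<open>Singular values of matrices\<close>

lemma svd_matrix:
  fixes A :: "complex mat"
  assumes A: "A \<in> carrier_mat d d"
  shows "\<exists>u \<mu>. orthonormal {..<d} {..<d} u \<and> (\<forall>j<d. (\<mu> j :: real) \<ge> 0) \<and>
     (\<forall>v. norm_sq {..<d} (kernel_app {..<d} (\<lambda>i j. A $$ (i,j)) v) = (\<Sum>j<d. \<mu> j * (cmod (inner_on {..<d} (u j) v))\<^sup>2)) \<and>
     proots (char_poly (mat_adjoint A * A)) = image_mset (\<lambda>j. of_real (\<mu> j)) (mset_set {..<d})"
proof -
  \<comment> \<open>Right singular vectors are the eigenvectors of the Gram matrix \<open>H\<close>.
    The last conjunct of the claim links its eigenvalues to the roots in the definition of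
    \<open>singular_values\<close>.\<close>
  define H where "H = mat_adjoint A * A"
  have A': "mat_adjoint A \<in> carrier_mat d d" using A by (rule mat_adjoint_carrier)
  have H: "H \<in> carrier_mat d d" unfolding H_def using A' A by (rule mult_carrier_mat)
  have "mat_adjoint H = H" unfolding H_def using mat_adjoint_mult[OF A' A] by simp
  from hermitian_spectral[OF H this] obtain U B where U: "U \<in> carrier_mat d d" and B: "B \<in> carrier_mat d d"
    and dB: "diagonal_mat B" and UU: "mat_adjoint U * U = 1\<^sub>m d" and HU: "H * U = U * B" by blast
  have U': "mat_adjoint U \<in> carrier_mat d d" using U by (rule mat_adjoint_carrier)
  have UU2: "U * mat_adjoint U = 1\<^sub>m d" by (rule mat_mult_left_right_inverse[OF U' U UU])
  define u where "u j i = U $$ (i,j)" for j i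
  define AU where "AU = A * U"
  have AU: "AU \<in> carrier_mat d d" unfolding AU_def using A U by (rule mult_carrier_mat)
  have gramB: "mat_adjoint AU * AU = B"
  proof -
    have "mat_adjoint AU * AU = mat_adjoint U * mat_adjoint A * (A * U)"
      unfolding AU_def mat_adjoint_mult[OF A U] ..
    also have "\<dots> = mat_adjoint U * (mat_adjoint A * (A * U))"
      using assoc_mult_mat[OF U' A' AU] by (simp add: AU_def)
    also have "mat_adjoint A * (A * U) = U * B"
      using assoc_mult_mat[OF A' A U] HU by (simp add: H_def)
    also have "mat_adjoint U * (U * B) = B"
      using assoc_mult_mat[OF U' U B] UU B by simp
    finally show ?thesis .
  qed
  have on: "orthonormal {..<d} {..<d} u"
    unfolding orthonormal_def
  proof (intro conjI ballI)
    fix j k assume jk: "j \<in> {..<d}" "k \<in> {..<d}"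
    have "inner_on {..<d} (u j) (u k) = (mat_adjoint U * U) $$ (j,k)"
      using jk U by (simp add: inner_on_def u_def scalar_prod_def atLeast0LessThan)
    thus "inner_on {..<d} (u j) (u k) = (if j = k then 1 else 0)" unfolding UU using jk by simp
  qed auto
  \<comment> \<open>Defined as squared norms of the images of the \<open>u j\<close> rather than as
    eigenvalues, so that being real and nonnegative needs no argument.\<close>
  define \<mu> where "\<mu> j = norm_sq {..<d} (\<lambda>i. AU $$ (i,j))" for j
  have gram: "inner_on {..<d} (\<lambda>i. AU $$ (i,j)) (\<lambda>i. AU $$ (i,k)) = B $$ (j,k)" if "j < d" "k < d" for j k
  proof -
    have "inner_on {..<d} (\<lambda>i. AU $$ (i,j)) (\<lambda>i. AU $$ (i,k)) = (mat_adjoint AU * AU) $$ (j,k)"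
      using that AU by (simp add: inner_on_def scalar_prod_def atLeast0LessThan)
    thus ?thesis unfolding gramB .
  qed
  have Bj: "B $$ (j,j) = of_real (\<mu> j)" if "j < d" for j
    unfolding \<mu>_def norm_sq_inner_on gram[OF that that] ..
  \<comment> \<open>Completeness of the eigenvectors is the second identity
    \<open>U * mat_adjoint U = 1\<close>.\<close>
  have expand: "v i = (\<Sum>j<d. inner_on {..<d} (u j) v * u j i)" if "i < d" for v i
  proof -
    have "(\<Sum>j<d. inner_on {..<d} (u j) v * u j i) = (\<Sum>k<d. (\<Sum>j<d. u j i * cnj (u j k)) * v k)"
      unfolding inner_on_def sum_distrib_right by (subst sum.swap) (simp add: mult_ac)
    also have "\<dots> = (\<Sum>k<d. (if i = k then 1 else 0) * v k)"
    proof (intro sum.cong refl, goal_cases)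
      case (1 k)
      have "(\<Sum>j<d. u j i * cnj (u j k)) = (U * mat_adjoint U) $$ (i,k)"
        using that 1 U by (simp add: u_def scalar_prod_def atLeast0LessThan)
      thus ?case unfolding UU2 using that 1 by simp
    qed
    also have "\<dots> = v i" using that by (simp add: if_distrib[of "\<lambda>x. x * _"] cong: if_cong)
    finally show ?thesis by simp
  qed
  have "norm_sq {..<d} (kernel_app {..<d} (\<lambda>i j. A $$ (i,j)) v) = (\<Sum>j<d. \<mu> j * (cmod (inner_on {..<d} (u j) v))\<^sup>2)" for v
  proof -
    define c where "c j = inner_on {..<d} (u j) v" for j
    define w where "w = (\<lambda>i. \<Sum>j<d. c j * AU $$ (i,j))"
    have apw: "kernel_app {..<d} (\<lambda>i j. A $$ (i,j)) v i = w i" if "i < d" for i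
    proof -
      have "kernel_app {..<d} (\<lambda>i j. A $$ (i,j)) v i = (\<Sum>k<d. A $$ (i,k) * (\<Sum>j<d. c j * u j k))"
        unfolding kernel_app_def c_def using expand[of _ v] by (intro sum.cong) auto
      also have "\<dots> = (\<Sum>j<d. c j * (\<Sum>k<d. A $$ (i,k) * u j k))"
        unfolding sum_distrib_left by (subst sum.swap) (simp add: mult_ac)
      also have "\<dots> = w i" unfolding w_def
        using A U that by (intro sum.cong) (simp_all add: AU_def u_def scalar_prod_def atLeast0LessThan)
      finally show ?thesis .
    qed
    have "norm_sq {..<d} (kernel_app {..<d} (\<lambda>i j. A $$ (i,j)) v) = norm_sq {..<d} w"
      unfolding norm_sq_def using apw by simp
    moreover have "complex_of_real (norm_sq {..<d} w) = of_real (\<Sum>j<d. \<mu> j * (cmod (c j))\<^sup>2)"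
    proof -
      have "complex_of_real (norm_sq {..<d} w) = (\<Sum>j<d. cnj (c j) * (\<Sum>k<d. c k * B $$ (j,k)))"
        unfolding norm_sq_inner_on w_def inner_on_sum_left inner_on_sum_right using gram by (intro sum.cong refl) simp
      also have "\<dots> = (\<Sum>j<d. cnj (c j) * (c j * B $$ (j,j)))"
      proof (intro sum.cong refl, goal_cases)
        case (1 j)
        have "(\<Sum>k<d. c k * B $$ (j,k)) = (\<Sum>k<d. if j = k then c k * B $$ (j,k) else 0)"
          using dB B 1 by (intro sum.cong) (auto simp: diagonal_mat_def)
        thus ?case using 1 by simp
      qed
      also have "\<dots> = (\<Sum>j<d. of_real (\<mu> j * (cmod (c j))\<^sup>2))"
        by (intro sum.cong refl) (simp add: Bj of_real_mult complex_norm_square mult_ac del: of_real_power)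
      finally show ?thesis by simp
    qed
    ultimately show ?thesis unfolding c_def of_real_eq_iff by simp
  qed
  moreover have "proots (char_poly H) = image_mset (\<lambda>j. of_real (\<mu> j)) (mset_set {..<d})"
  proof -
    have "similar_mat_wit H B U (mat_adjoint U)"
    proof (rule similar_mat_witI[of _ _ d])
      have "H = H * (U * mat_adjoint U)" unfolding UU2 using H by simp
      also have "\<dots> = H * U * mat_adjoint U" using assoc_mult_mat[OF H U U'] by simp
      finally show "H = U * B * mat_adjoint U" unfolding HU .
    qed (use H B U U' UU UU2 in auto)
    hence "char_poly H = char_poly B" using char_poly_similar unfolding similar_mat_def by blast
    also have "\<dots> = (\<Prod>a\<leftarrow>diag_mat B. [:- a, 1:])"
      by (rule char_poly_upper_triangular[OF B]) (use dB B in \<open>auto simp: diagonal_mat_def\<close>)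
    also have "proots \<dots> = mset (diag_mat B)"
    proof -
      have "proots (\<Prod>a\<leftarrow>xs. [:- a, 1:]) = mset xs" for xs :: "complex list"
      proof (induction xs)
        case (Cons x xs)
        have nz: "(\<Prod>a\<leftarrow>xs. [:- a, 1:]) \<noteq> 0" by (auto simp: prod_list_zero_iff)
        show ?case using Cons nz by (simp add: proots_mult del: mult_pCons_left)
      qed simp
      thus ?thesis .
    qed
    also have "mset (diag_mat B) = image_mset (\<lambda>j. of_real (\<mu> j)) (mset_set {..<d})"
    proof -
      have "diag_mat B = map (\<lambda>j. of_real (\<mu> j)) [0..<d]"
        using B Bj unfolding diag_mat_def by auto
      thus ?thesis by (simp add: atLeast0LessThan)
    qed
    finally show ?thesis .
  qed
  ultimately show ?thesis using on unfolding H_def by (intro exI[of _ u] exI[of _ \<mu>]) (auto simp: \<mu>_def)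
qed

text \<open>Connects the variational count with the list in the definition: the
  \<open>\<mu> j\<close> are the squares of the listed values, and a nonnegative root exceeds
  \<open>L\<close> exactly when its square exceeds \<open>L^2\<close>.\<close>

lemma sv_bound_matrix_iff:
  assumes A: "A \<in> carrier_mat d d" and L: "L \<ge> 0"
  shows "sv_bound {..<d} (\<lambda>i j. A $$ (i,j)) r L \<longleftrightarrow> card {i\<in>{1..d}. singular_value A i > L} \<le> r"
    and "length (singular_values A) = d" and "\<forall>x\<in>set (singular_values A). 0 \<le> x"
proof -
  obtain u \<mu> where u: "orthonormal {..<d} {..<d} u" "\<And>j. j < d \<Longrightarrow> (\<mu> j :: real) \<ge> 0"
     "\<And>v. norm_sq {..<d} (kernel_app {..<d} (\<lambda>i j. A $$ (i,j)) v) = (\<Sum>j<d. \<mu> j * (cmod (inner_on {..<d} (u j) v))\<^sup>2)"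
     "proots (char_poly (mat_adjoint A * A)) = image_mset (\<lambda>j. of_real (\<mu> j)) (mset_set {..<d})"
    using svd_matrix[OF A] by blast
  define M where "M = image_mset (\<lambda>j. sqrt (\<mu> j)) (mset_set {..<d})"
  define xs where "xs = singular_values A"
  have xs: "xs = rev (sorted_list_of_multiset M)"
    unfolding xs_def singular_values_def u(4) M_def by (simp add: image_mset.compositionality comp_def)
  have mxs: "mset xs = M" by (simp add: xs)
  show len: "length (singular_values A) = d"
    using mxs unfolding xs_def[symmetric] by (metis M_def size_mset size_image_mset size_mset_set card_lessThan)
  show "\<forall>x\<in>set (singular_values A). 0 \<le> x"
    unfolding xs_def[symmetric] set_mset_mset[symmetric] mxs using u(2) by (auto simp: M_def)
  \<comment> \<open>A shift by one: \<open>singular_value\<close> counts from 1, lists count from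
    0.\<close>
  have "card {i\<in>{1..d}. singular_value A i > L} = card {i. i < length xs \<and> xs ! i > L}"
  proof (rule bij_betw_same_card[of "\<lambda>i. i - 1"], rule bij_betw_byWitness[of _ Suc])
    show "(\<lambda>i. i - 1) ` {i \<in> {1..d}. L < singular_value A i} \<subseteq> {i. i < length xs \<and> xs ! i > L}"
      using len by (auto simp: singular_value_def xs_def[symmetric])
    show "Suc ` {i. i < length xs \<and> xs ! i > L} \<subseteq> {i \<in> {1..d}. L < singular_value A i}"
      using len by (auto simp: singular_value_def xs_def[symmetric])
  qed auto
  also have "\<dots> = size (filter_mset (\<lambda>x. x > L) (mset xs))"
    by (simp add: length_filter_conv_card mset_filter[symmetric] del: mset_filter)
  also have "\<dots> = card {j\<in>{..<d}. sqrt (\<mu> j) > L}"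
    unfolding mxs M_def by (simp add: filter_mset_image_mset filter_mset_mset_set)
  also have "{j\<in>{..<d}. sqrt (\<mu> j) > L} = {j\<in>{..<d}. \<mu> j > L\<^sup>2}"
    using u(2) L by (auto simp: real_less_rsqrt real_less_lsqrt not_le[symmetric] real_le_lsqrt real_sqrt_le_iff sqrt_le_D)
  finally show "sv_bound {..<d} (\<lambda>i j. A $$ (i,j)) r L \<longleftrightarrow> card {i\<in>{1..d}. singular_value A i > L} \<le> r"
    using sv_bound_orthonormal_iff[OF u(1) _ u(3) L, of r] u(2) by simp
qed


lemma singular_value_nonneg:
  assumes "A \<in> carrier_mat d d"
  shows "0 \<le> singular_value A i"
proof (cases "1 \<le> i \<and> i \<le> length (singular_values A)")
  case True
  hence "i - 1 < length (singular_values A)" by linarith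
  thus ?thesis using sv_bound_matrix_iff(3)[OF assms order_refl] True by (simp add: singular_value_def)
qed (auto simp: singular_value_def)

lemma singular_value_antimono:
  assumes "1 \<le> i" "i \<le> j" "A \<in> carrier_mat d d"
  shows "singular_value A j \<le> singular_value A i"
proof (cases "j \<le> length (singular_values A)")
  case True
  have "sorted_wrt (\<ge>) (singular_values A)"
    unfolding singular_values_def by (simp add: sorted_wrt_rev)
  hence "singular_values A ! (j - 1) \<le> singular_values A ! (i - 1)"
    using assms True by (cases "i = j") (auto intro!: sorted_wrt_nth_less[of "(\<ge>)"])
  thus ?thesis using assms True by (simp add: singular_value_def)
next
  case False
  thus ?thesis using singular_value_nonneg[OF assms(3), of i] by (simp add: singular_value_def)
qed

section \<open>Elementary properties of \<open>acs_size\<close>\<close>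

lemma acs_size_bdd_below: "bdd_below {real r / real (card S) + L | r L. 0 \<le> L \<and> sv_bound S a r L}"
  by (rule bdd_belowI[of _ 0]) auto

lemma acs_size_le:
  assumes "sv_bound S a r L" "0 \<le> L"
  shows "acs_size S a \<le> real r / real (card S) + L"
  unfolding acs_size_def by (rule cInf_lower[OF _ acs_size_bdd_below]) (use assms in auto)

lemma acs_size_greatest:
  assumes "finite S" "\<And>r L. 0 \<le> L \<Longrightarrow> sv_bound S a r L \<Longrightarrow> x \<le> real r / real (card S) + L"
  shows "x \<le> acs_size S a"
  unfolding acs_size_def using sv_bound_card[OF assms(1), of a] assms(2) by (intro cInf_greatest) auto

lemma acs_size_nonneg: "finite S \<Longrightarrow> 0 \<le> acs_size S a"
  by (rule acs_size_greatest) auto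

text \<open>Admissible pairs for the summands add up to an admissible pair for the sum; the two
  infima are then taken one at a time.\<close>

lemma acs_size_triangle:
  assumes "finite S"
  shows "acs_size S (\<lambda>i j. a i j + b i j) \<le> acs_size S a + acs_size S b"
proof -
  let ?c = "acs_size S (\<lambda>i j. a i j + b i j)"
  have 1: "?c \<le> (real r / real (card S) + L) + (real q / real (card S) + M)"
    if "sv_bound S a r L" "sv_bound S b q M" "0 \<le> L" "0 \<le> M" for r L q M
    using acs_size_le[OF sv_bound_add[OF that]] that by (simp add: add_divide_distrib)
  have "?c - (real r / real (card S) + L) \<le> acs_size S b" if "sv_bound S a r L" "0 \<le> L" for r L
    by (rule acs_size_greatest[OF assms]) (use 1 that in fastforce)
  hence "?c - acs_size S b \<le> acs_size S a"
    by (intro acs_size_greatest[OF assms]) (simp add: algebra_simps)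
  thus ?thesis by simp
qed

lemma acs_size_uminus: "acs_size S (\<lambda>i j. - a i j) = acs_size S a"
  by (simp add: acs_size_def sv_bound_uminus)

lemma acs_size_diff_triangle:
  assumes "finite S"
  shows "\<bar>acs_size S a - acs_size S b\<bar> \<le> acs_size S (\<lambda>i j. a i j - b i j)"
  using acs_size_triangle[OF assms, of b "\<lambda>i j. a i j - b i j"]
    acs_size_triangle[OF assms, of a "\<lambda>i j. - (a i j - b i j)"]
    acs_size_uminus[of S "\<lambda>i j. a i j - b i j"]
  by (simp add: abs_le_iff)

lemma acs_size_cong:
  assumes "\<And>i j. i \<in> S \<Longrightarrow> j \<in> S \<Longrightarrow> a i j = b i j"
  shows "acs_size S a = acs_size S b"
  by (simp add: acs_size_def sv_bound_cong[of S a b, OF assms])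

lemma acs_size_reindex:
  assumes "bij_betw f T S"
  shows "acs_size T (\<lambda>i j. a (f i) (f j)) = acs_size S a"
  unfolding acs_size_def sv_bound_reindex[OF assms] bij_betw_same_card[OF assms] ..

text \<open>For an admissible pair \<open>(r, L)\<close> with \<open>r < d\<close> the index
  \<open>r + 1\<close> does at least as well, since its singular value is at most \<open>L\<close>.
  Conversely the index \<open>i\<close> gives the admissible pair
  \<open>(i - 1, singular_value A i)\<close>, because only indices before \<open>i\<close> can carry
  larger values.\<close>

lemma acs_size_matrix:
  assumes A: "A \<in> carrier_mat d d"
  shows "(MIN i\<in>{1..d + 1}. (real i - 1) / real d + singular_value A i) = acs_size {..<d} (\<lambda>i j. A $$ (i,j))"
    (is "Min (?f ` _) = _")
proof (rule antisym)
  show "Min (?f ` {1..d + 1}) \<le> acs_size {..<d} (\<lambda>i j. A $$ (i,j))"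
  proof (rule acs_size_greatest)
    fix r L assume L: "0 \<le> (L :: real)" and sv: "sv_bound {..<d} (\<lambda>i j. A $$ (i,j)) r L"
    have "\<exists>i\<in>{1..d + 1}. ?f i \<le> real r / real (card {..<d}) + L"
    proof (cases "r < d")
      case False
      \<comment> \<open>The extra index \<open>d + 1\<close> has the default value 0, which covers
        the pairs with \<open>r \<ge> d\<close>.\<close>
      have "singular_value A (d + 1) = 0"
        using sv_bound_matrix_iff(2)[OF A L] by (simp add: singular_value_def)
      moreover have "real d / real d \<le> real r / real d" using False by (intro divide_right_mono) auto
      ultimately show ?thesis using L by (intro bexI[of _ "d + 1"]) auto
    next
      case True
      have "singular_value A (r + 1) \<le> L"
      proof (rule ccontr)
        assume *: "\<not> ?thesis"
        have "{1..r + 1} \<subseteq> {i\<in>{1..d}. singular_value A i > L}"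
        proof
          fix k assume "k \<in> {1..r+1}"
          thus "k \<in> {i\<in>{1..d}. singular_value A i > L}"
            using singular_value_antimono[of k "r + 1" A d] A * True by auto
        qed
        hence "card {1..r+1} \<le> card {i\<in>{1..d}. singular_value A i > L}" by (intro card_mono) auto
        thus False using sv_bound_matrix_iff(1)[OF A L, of r] sv by simp
      qed
      thus ?thesis using True by (intro bexI[of _ "r + 1"]) auto
    qed
    then obtain i where "i \<in> {1..d+1}" "?f i \<le> real r / real (card {..<d}) + L" by blast
    thus "Min (?f ` {1..d + 1}) \<le> real r / real (card {..<d}) + L"
      by (intro Min.coboundedI[THEN order_trans]) auto
  qed simp
  show "acs_size {..<d} (\<lambda>i j. A $$ (i,j)) \<le> Min (?f ` {1..d + 1})"
  proof (subst Min_ge_iff)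
    show "\<forall>x\<in>?f ` {1..d + 1}. acs_size {..<d} (\<lambda>i j. A $$ (i,j)) \<le> x"
    proof
      fix x assume "x \<in> ?f ` {1..d + 1}"
      then obtain i where i: "i \<in> {1..d+1}" "x = ?f i" by blast
      have "{k\<in>{1..d}. singular_value A k > singular_value A i} \<subseteq> {1..i-1}"
      proof
        fix k assume k: "k \<in> {k\<in>{1..d}. singular_value A k > singular_value A i}"
        hence "k < i" using singular_value_antimono[of i k A d] A i by force
        thus "k \<in> {1..i-1}" using k by auto
      qed
      hence "card {k\<in>{1..d}. singular_value A k > singular_value A i} \<le> card {1..i-1}" by (intro card_mono) auto
      hence "sv_bound {..<d} (\<lambda>i j. A $$ (i,j)) (i - 1) (singular_value A i)"
        using sv_bound_matrix_iff(1)[OF A singular_value_nonneg[OF A]] by simp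
      from acs_size_le[OF this singular_value_nonneg[OF A]]
      show "acs_size {..<d} (\<lambda>i j. A $$ (i,j)) \<le> x" using i by (simp add: of_nat_diff)
    qed
  qed auto
qed

text \<open>Chebyshev's inequality for the squared singular values: their sum is the squared
  Frobenius norm, computed by applying the kernel to the unit vectors, and each one counted in
  \<open>r\<close> exceeds \<open>\<delta>^2\<close>.\<close>

lemma sv_bound_frobenius:
  fixes a :: "'i \<Rightarrow> 'i \<Rightarrow> complex"
  assumes S: "finite S" and \<delta>: "\<delta> > 0"
  shows "\<exists>r. sv_bound S a r \<delta> \<and> real r * \<delta>\<^sup>2 \<le> (\<Sum>i\<in>S. \<Sum>j\<in>S. (cmod (a i j))\<^sup>2)"
proof -
  define d where "d = card S"
  obtain e where e: "bij_betw e {..<d} S"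
    using ex_bij_betw_nat_finite[OF S] by (auto simp: atLeast0LessThan d_def)
  define A where "A = Matrix.mat d d (\<lambda>(i,j). a (e i) (e j))"
  have A: "A \<in> carrier_mat d d" by (simp add: A_def)
  obtain u \<mu> where u: "orthonormal {..<d} {..<d} u" "\<And>j. j < d \<Longrightarrow> (\<mu> j :: real) \<ge> 0"
     "\<And>v. norm_sq {..<d} (kernel_app {..<d} (\<lambda>i j. A $$ (i,j)) v) = (\<Sum>j<d. \<mu> j * (cmod (inner_on {..<d} (u j) v))\<^sup>2)"
    using svd_matrix[OF A] by blast
  define r where "r = card {j\<in>{..<d}. \<mu> j > \<delta>\<^sup>2}"
  have "sv_bound {..<d} (\<lambda>i j. A $$ (i,j)) r \<delta>"
    using sv_bound_orthonormal_iff[OF u(1) _ u(3), of \<delta> r] u(2) \<delta> by (simp add: r_def)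
  also have "sv_bound {..<d} (\<lambda>i j. A $$ (i,j)) r \<delta> \<longleftrightarrow> sv_bound {..<d} (\<lambda>i j. a (e i) (e j)) r \<delta>"
    by (rule sv_bound_cong) (simp add: A_def)
  also have "\<dots> \<longleftrightarrow> sv_bound S a r \<delta>" by (rule sv_bound_reindex[OF e])
  finally have 1: "sv_bound S a r \<delta>" .
  have "real r * \<delta>\<^sup>2 = (\<Sum>j\<in>{j\<in>{..<d}. \<mu> j > \<delta>\<^sup>2}. \<delta>\<^sup>2)" by (simp add: r_def)
  also have "\<dots> \<le> (\<Sum>j\<in>{j\<in>{..<d}. \<mu> j > \<delta>\<^sup>2}. \<mu> j)" by (intro sum_mono) auto
  also have "\<dots> \<le> (\<Sum>j<d. \<mu> j)" using u(2) by (intro sum_mono2) auto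
  also have "\<dots> = (\<Sum>j<d. \<mu> j * norm_sq {..<d} (u j))"
  proof (intro sum.cong refl, goal_cases)
    case (1 j)
    have "complex_of_real (norm_sq {..<d} (u j)) = 1" unfolding norm_sq_inner_on using u(1) 1 by (auto simp: orthonormal_def)
    thus ?case by simp
  qed
  also have "\<dots> = (\<Sum>k<d. \<Sum>j<d. \<mu> j * (cmod (u j k))\<^sup>2)"
    unfolding norm_sq_def sum_distrib_left by (rule sum.swap)
  also have "\<dots> = (\<Sum>k<d. norm_sq {..<d} (kernel_app {..<d} (\<lambda>i j. A $$ (i,j)) (\<lambda>i. if i = k then 1 else 0)))"
  proof (intro sum.cong refl, goal_cases)
    case (1 k)
    have "inner_on {..<d} (u j) (\<lambda>i. if i = k then 1 else 0) = cnj (u j k)" for j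
      using 1 by (simp add: inner_on_def if_distrib[of "\<lambda>x. _ * x"] cong: if_cong)
    thus ?case unfolding u(3) by simp
  qed
  also have "\<dots> = (\<Sum>k<d. \<Sum>i<d. (cmod (a (e i) (e k)))\<^sup>2)"
    by (intro sum.cong refl)
       (auto simp: norm_sq_def kernel_app_def if_distrib[of "\<lambda>x. _ * x"] A_def cong: if_cong intro!: sum.cong)
  also have "\<dots> = (\<Sum>i<d. \<Sum>k<d. (cmod (a (e i) (e k)))\<^sup>2)" by (rule sum.swap)
  also have "\<dots> = (\<Sum>i\<in>S. \<Sum>j\<in>S. (cmod (a i j))\<^sup>2)"
    unfolding sum.reindex_bij_betw[OF e, of "\<lambda>j. (cmod (a _ j))\<^sup>2"]
    by (rule sum.reindex_bij_betw[OF e, of "\<lambda>i. \<Sum>j\<in>S. (cmod (a i j))\<^sup>2"])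
  finally show ?thesis using 1 by blast
qed

text \<open>A maximal independent set \<open>B\<close> of columns has \<open>rank R\<close>
  elements. The coordinates of all columns along one element of \<open>B\<close> form one
  constraint; if all these constraints hold, the combination of the columns with coefficients
  \<open>v\<close> is zero.\<close>

lemma sv_bound_rank:
  fixes R :: "complex mat"
  assumes R: "R \<in> carrier_mat n n"
  shows "sv_bound {..<n} (\<lambda>i j. R $$ (i,j)) (vec_space.rank n R) 0"
proof -
  interpret vec_space "TYPE(complex)" n .
  have cols: "set (cols R) \<subseteq> carrier_vec n" using R cols_dim by blast
  obtain B where B: "finite B" "maximal B (\<lambda>T. T \<subseteq> set (cols R) \<and> lin_indpt T)"
    using maximal_exists_superset[of "set (cols R)" "\<lambda>T. T \<subseteq> set (cols R) \<and> lin_indpt T" "{}"]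
    by (auto simp: lin_dep_def)
  have rk: "rank R = card B" by (rule rank_card_indpt[OF R B(2)])
  have Bs: "B \<subseteq> set (cols R)" "lin_indpt B" using B(2) by (auto simp: maximal_def)
  have Bc: "B \<subseteq> carrier_vec n" using Bs cols by blast
  have "\<exists>a. lincomb a B = col R j" if "j < n" for j
  proof -
    have c: "col R j \<in> set (cols R)" using that R by (simp add: cols_def)
    have "col R j \<in> span B"
    proof (cases "col R j \<in> B")
      case True
      thus ?thesis using Bc in_own_span by blast
    next
      case False
      have "lin_dep (B \<union> {col R j})"
      proof (rule ccontr)
        assume "\<not> ?thesis"
        hence "B \<union> {col R j} \<subseteq> set (cols R) \<and> lin_indpt (B \<union> {col R j})" using c Bs by blast
        hence "B \<union> {col R j} = B" using B(2) unfolding maximal_def by blast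
        thus False using False by blast
      qed
      thus ?thesis using lin_dep_iff_in_span[OF Bc Bs(2) _ False] c cols by blast
    qed
    thus ?thesis using finite_in_span[OF B(1) Bc] by blast
  qed
  then obtain a where a: "\<And>j. j < n \<Longrightarrow> lincomb (a j) B = col R j" by metis
  obtain e where e: "bij_betw e {..<card B} B"
    using ex_bij_betw_nat_finite[OF B(1)] by (auto simp: atLeast0LessThan)
  have "norm_sq {..<n} (kernel_app {..<n} (\<lambda>i j. R $$ (i,j)) v) \<le> 0\<^sup>2 * norm_sq {..<n} v"
    if v: "\<forall>t<rank R. (\<Sum>j<n. a j (e t) * v j) = 0" for v
  proof -
    have z: "(\<Sum>j<n. a j b * v j) = 0" if b: "b \<in> B" for b
    proof -
      obtain t where "t < card B" "b = e t" using e b by (auto simp: bij_betw_def)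
      thus ?thesis using v rk by simp
    qed
    have "kernel_app {..<n} (\<lambda>i j. R $$ (i,j)) v i = 0" if "i < n" for i
    proof -
      have "kernel_app {..<n} (\<lambda>i j. R $$ (i,j)) v i = (\<Sum>j<n. (\<Sum>b\<in>B. a j b * vec_index b i) * v j)"
        unfolding kernel_app_def
      proof (intro sum.cong refl, goal_cases)
        case (1 j)
        have "R $$ (i,j) = vec_index (lincomb (a j) B) i" using a[of j] 1 that R by simp
        thus ?case using lincomb_index[OF that Bc] by simp
      qed
      also have "\<dots> = (\<Sum>b\<in>B. vec_index b i * (\<Sum>j<n. a j b * v j))"
        unfolding sum_distrib_left sum_distrib_right by (subst sum.swap) (simp add: mult_ac)
      also have "\<dots> = 0" using z by simp
      finally show ?thesis .
    qed
    thus ?thesis by (simp add: norm_sq_def)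
  qed
  thus ?thesis unfolding sv_bound_def by (intro exI[of _ "\<lambda>t j. a j (e t)"]) blast
qed

text \<open>By homogeneity it is enough to treat unit vectors, where the supremum in
  \<open>spectral_norm\<close> applies; for that its set of values must be known to be bounded
  above.\<close>

lemma sv_bound_spectral_norm:
  fixes N :: "complex mat"
  assumes N: "N \<in> carrier_mat n n" and le: "spectral_norm N \<le> w"
  shows "sv_bound {..<n} (\<lambda>i j. N $$ (i,j)) 0 w"
proof -
  let ?a = "\<lambda>i j. N $$ (i,j)"
  have eu: "euclid_norm x = sqrt (norm_sq {..<n} (\<lambda>i. vec_index x i))" if "x \<in> carrier_vec n" for x
    using that by (auto simp: euclid_norm_def norm_sq_def)
  have mv: "euclid_norm (N *\<^sub>v Matrix.vec n v) = sqrt (norm_sq {..<n} (kernel_app {..<n} ?a v))" for v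
  proof -
    have "N *\<^sub>v Matrix.vec n v \<in> carrier_vec n" using N by auto
    moreover have "norm_sq {..<n} (\<lambda>i. vec_index (N *\<^sub>v Matrix.vec n v) i) = norm_sq {..<n} (kernel_app {..<n} ?a v)"
      unfolding norm_sq_def kernel_app_def using N by (intro sum.cong) (auto simp: scalar_prod_def atLeast0LessThan)
    ultimately show ?thesis using eu by simp
  qed
  have vec: "x = Matrix.vec n (\<lambda>i. vec_index x i)" if "x \<in> carrier_vec n" for x :: "complex Matrix.vec"
    using that by auto
  \<comment> \<open>A crude operator bound from the Frobenius count: above the level with square
    \<open>F + 1\<close> the count \<open>r\<close> satisfies \<open>r * (F + 1) \<le> F\<close>, so
    it is 0.\<close>
  obtain r where r: "\<And>v. norm_sq {..<n} (kernel_app {..<n} ?a v) \<le> r\<^sup>2 * norm_sq {..<n} v" "r \<ge> 0"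
  proof -
    define F where "F = (\<Sum>i<n. \<Sum>j<n. (cmod (?a i j))\<^sup>2)"
    have F: "F \<ge> 0" unfolding F_def by (intro sum_nonneg) auto
    obtain r where r: "sv_bound {..<n} ?a r (sqrt (F + 1))" "real r * (sqrt (F + 1))\<^sup>2 \<le> F"
      using sv_bound_frobenius[of "{..<n}" "sqrt (F + 1)" ?a] F by (auto simp: F_def)
    have "r = 0"
    proof (rule ccontr)
      assume "r \<noteq> 0"
      hence "1 * (F + 1) \<le> real r * (F + 1)" using F by (intro mult_right_mono) auto
      moreover have "real r * (F + 1) \<le> F" using r(2) F by simp
      ultimately have "1 * (F + 1) \<le> F" by (rule order_trans)
      thus False by simp
    qed
    with r(1) show ?thesis using that[of "sqrt (F+1)"] F unfolding sv_bound_def by auto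
  qed
  have bdd: "bdd_above ((\<lambda>v. euclid_norm (N *\<^sub>v v)) ` {v \<in> carrier_vec (dim_col N). euclid_norm v \<le> 1})"
  proof (rule bdd_aboveI2)
    fix x assume "x \<in> {v \<in> carrier_vec (dim_col N). euclid_norm v \<le> 1}"
    hence x: "x \<in> carrier_vec n" "euclid_norm x \<le> 1" using N by auto
    have "euclid_norm (N *\<^sub>v x) = sqrt (norm_sq {..<n} (kernel_app {..<n} ?a (\<lambda>i. vec_index x i)))"
      using mv[of "\<lambda>i. vec_index x i"] vec[OF x(1)] by simp
    also have "\<dots> \<le> r * euclid_norm x" using r eu[OF x(1)] by (simp add: norm_sq_le_iff[symmetric])
    also have "\<dots> \<le> r" using x(2) r(2) by (simp add: mult_left_le)
    finally show "euclid_norm (N *\<^sub>v x) \<le> r" .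
  qed
  have "norm_sq {..<n} (kernel_app {..<n} ?a v) \<le> w\<^sup>2 * norm_sq {..<n} v" for v
  proof (cases "norm_sq {..<n} v = 0")
    case True
    thus ?thesis using r(1)[of v] by simp
  next
    case False
    define t where "t = sqrt (norm_sq {..<n} v)"
    have t: "t > 0" using False norm_sq_nonneg[of "{..<n}" v] by (simp add: t_def less_le)
    define x where "x = Matrix.vec n (\<lambda>i. v i / of_real t)"
    have "norm_sq {..<n} (\<lambda>i. vec_index x i) = norm_sq {..<n} v / t\<^sup>2"
      by (auto simp: x_def norm_sq_def norm_divide power_divide sum_divide_distrib)
    also have "\<dots> = 1" using t False by (simp add: t_def)
    finally have "euclid_norm x \<le> 1" by (subst eu) (auto simp: x_def)
    hence "euclid_norm (N *\<^sub>v x) \<le> spectral_norm N"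
      unfolding spectral_norm_def using N bdd by (intro cSUP_upper) (auto simp: x_def)
    hence 1: "euclid_norm (N *\<^sub>v x) \<le> w" using le by simp
    have 2: "norm_sq {..<n} (kernel_app {..<n} ?a v) = t\<^sup>2 * norm_sq {..<n} (kernel_app {..<n} ?a (\<lambda>i. v i / of_real t))"
    proof -
      have "kernel_app {..<n} ?a v i = of_real t * kernel_app {..<n} ?a (\<lambda>i. v i / of_real t) i" for i
        unfolding kernel_app_def sum_distrib_left using t by (intro sum.cong) auto
      thus ?thesis unfolding norm_sq_def sum_distrib_left using t by (simp add: norm_mult power_mult_distrib)
    qed
    have "sqrt (norm_sq {..<n} (kernel_app {..<n} ?a (\<lambda>i. v i / of_real t))) \<le> w"
      using 1 mv[of "\<lambda>i. v i / of_real t"] by (simp add: x_def)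
    hence "norm_sq {..<n} (kernel_app {..<n} ?a (\<lambda>i. v i / of_real t)) \<le> w\<^sup>2"
      by (simp add: sqrt_le_D)
    hence "t\<^sup>2 * norm_sq {..<n} (kernel_app {..<n} ?a (\<lambda>i. v i / of_real t)) \<le> t\<^sup>2 * w\<^sup>2"
      by (intro mult_left_mono) auto
    thus ?thesis unfolding 2 by (simp add: t_def mult.commute)
  qed
  thus ?thesis unfolding sv_bound_def by blast
qed

section \<open>Grid matrices as kernels\<close>

lemma lex_less_irrefl: "\<not> lex_less i i"
  by (auto simp: lex_less_def)

lemma lex_less_trans:
  assumes "lex_less i j" "lex_less j k"
  shows "lex_less i k"
proof -
  obtain l where l: "i $ l < j $ l" "\<forall>l'<l. i $ l' = j $ l'" using assms by (auto simp: lex_less_def)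
  obtain m where m: "j $ m < k $ m" "\<forall>l'<m. j $ l' = k $ l'" using assms by (auto simp: lex_less_def)
  show ?thesis unfolding lex_less_def
  proof (rule exI[of _ "min l m"], intro conjI allI impI)
    show "i $ min l m < k $ min l m"
      using l m by (cases l m rule: linorder_cases) (auto simp: min_def)
  qed (use l m in auto)
qed

lemma lex_less_total:
  assumes "i \<noteq> (j :: ('d :: {finite, linorder}) multi_index)"
  shows "lex_less i j \<or> lex_less j i"
proof -
  define D where "D = {l. i $ l \<noteq> j $ l}"
  have "D \<noteq> {}" using assms by (auto simp: D_def Finite_Cartesian_Product.vec_eq_iff)
  hence m: "Min D \<in> D" by (intro Min_in) auto
  have "i $ l' = j $ l'" if "l' < Min D" for l'
  proof (rule ccontr)
    assume "i $ l' \<noteq> j $ l'"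
    hence "Min D \<le> l'" by (intro Min_le) (auto simp: D_def)
    thus False using that by simp
  qed
  thus ?thesis using m unfolding lex_less_def D_def by (metis (mono_tags, lifting) linorder_neqE_nat mem_Collect_eq)
qed

text \<open>The rank of an element strictly increases along the lexicographic order, hence is
  injective; it stays below the cardinality because no element precedes itself.\<close>

lemma lex_pos_bij:
  fixes S :: "('d :: {finite, linorder}) multi_index set"
  assumes S: "finite S"
  shows "bij_betw (lex_pos S) S {..<card S}"
proof -
  have less: "lex_pos S i < lex_pos S j" if "i \<in> S" "j \<in> S" "lex_less i j" for i j
    unfolding lex_pos_def
  proof (rule psubset_card_mono)
    show "{k \<in> S. lex_less k i} \<subset> {k \<in> S. lex_less k j}"
      using that lex_less_trans[of _ i j] lex_less_irrefl[of i] by blast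
  qed (use S in auto)
  have inj: "inj_on (lex_pos S) S"
  proof (rule inj_onI, rule ccontr)
    fix i j assume "i \<in> S" "j \<in> S" "lex_pos S i = lex_pos S j" "i \<noteq> j"
    thus False using less[of i j] less[of j i] lex_less_total[of i j] by auto
  qed
  have "lex_pos S ` S \<subseteq> {..<card S}"
  proof
    fix p assume "p \<in> lex_pos S ` S"
    then obtain i where i: "i \<in> S" "p = lex_pos S i" by blast
    have "{k \<in> S. lex_less k i} \<subset> S" using i lex_less_irrefl[of i] by blast
    from psubset_card_mono[OF S this] show "p \<in> {..<card S}" using i by (simp add: lex_pos_def)
  qed
  moreover have "card (lex_pos S ` S) = card {..<card S}" using card_image[OF inj] by simp
  ultimately have "lex_pos S ` S = {..<card S}" by (intro card_subset_eq) auto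
  thus ?thesis using inj by (simp add: bij_betw_def)
qed

lemma lex_enum_pos:
  assumes "finite S" "i \<in> S"
  shows "lex_enum S (lex_pos S i) = i"
  unfolding lex_enum_def by (rule the_inv_into_f_f) (use lex_pos_bij[OF assms(1)] assms in \<open>auto simp: bij_betw_def\<close>)

lemma lex_pos_enum:
  assumes "finite S" "p < card S"
  shows "lex_pos S (lex_enum S p) = p"
  unfolding lex_enum_def by (rule f_the_inv_into_f) (use lex_pos_bij[OF assms(1)] assms in \<open>auto simp: bij_betw_def\<close>)

lemma lex_enum_bij: "finite S \<Longrightarrow> bij_betw (lex_enum S) {..<card S} S"
  unfolding lex_enum_def by (rule bij_betw_the_inv_into[OF lex_pos_bij])

lemma card_vec_box:
  fixes A :: "'d :: finite \<Rightarrow> nat set"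
  assumes "\<And>l. finite (A l)"
  shows "card {i :: 'd multi_index. \<forall>l. i $ l \<in> A l} = (\<Prod>l\<in>UNIV. card (A l))"
    and "finite {i :: 'd multi_index. \<forall>l. i $ l \<in> A l}"
proof -
  have b: "bij_betw (\<lambda>i l. i $ l) {i :: 'd multi_index. \<forall>l. i $ l \<in> A l} (Pi\<^sub>E UNIV A)"
    by (rule bij_betw_byWitness[of _ "\<lambda>f. \<chi> l. f l"]) (auto simp: PiE_def)
  show "card {i :: 'd multi_index. \<forall>l. i $ l \<in> A l} = (\<Prod>l\<in>UNIV. card (A l))"
    using bij_betw_same_card[OF b] by (simp add: card_PiE)
  show "finite {i :: 'd multi_index. \<forall>l. i $ l \<in> A l}"
    using bij_betw_finite[OF b] assms by (simp add: finite_PiE)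
qed

lemma grid_box: "grid n = {i. \<forall>l. i $ l \<in> {1..n $ l}}"
  by (auto simp: grid_def)

lemma finite_grid [simp]: "finite (grid n)"
  unfolding grid_box by (rule card_vec_box) auto

lemma card_grid: "card (grid n) = grid_size n"
  unfolding grid_box grid_size_def by (subst card_vec_box) auto

lemma grid_in_subset: "grid_in \<Omega> n \<subseteq> grid n"
  by (auto simp: grid_in_def)

lemma finite_grid_in [simp]: "finite (grid_in \<Omega> n)"
  by (rule finite_subset[OF grid_in_subset]) simp

text \<open>Reads a matrix in terms of multi-indices, after which the enumeration no longer matters:
  restricting a matrix to the domain becomes shrinking the index set of one and the same
  kernel.\<close>

definition grid_kernel :: "('d :: {finite, linorder}) multi_index \<Rightarrow> complex mat \<Rightarrow> 'd multi_index \<Rightarrow> 'd multi_index \<Rightarrow> complex" where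
  "grid_kernel n A i j = A $$ (lex_pos (grid n) i, lex_pos (grid n) j)"

lemma lex_pos_grid_less: "i \<in> grid n \<Longrightarrow> lex_pos (grid n) i < grid_size n"
  using lex_pos_bij[OF finite_grid, of n] by (auto simp: bij_betw_def card_grid)

lemma sv_bound_grid_kernel: "sv_bound (grid n) (grid_kernel n A) r L \<longleftrightarrow> sv_bound {..<grid_size n} (\<lambda>i j. A $$ (i,j)) r L"
  using sv_bound_reindex[OF lex_pos_bij[OF finite_grid], of n "\<lambda>i j. A $$ (i,j)" r L]
  by (simp add: grid_kernel_def[abs_def] card_grid)

lemma restrict_mat_carrier: "restrict_mat \<Omega> n A \<in> carrier_mat (grid_in_size \<Omega> n) (grid_in_size \<Omega> n)"
  by (simp add: restrict_mat_def)

lemma restrict_mat_diff_acs_size: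
  "acs_size {..<grid_in_size \<Omega> n} (\<lambda>p q. (restrict_mat \<Omega> n A - restrict_mat \<Omega> n B) $$ (p,q)) =
     acs_size (grid_in \<Omega> n) (\<lambda>i j. grid_kernel n A i j - grid_kernel n B i j)"
proof -
  have "acs_size {..<grid_in_size \<Omega> n} (\<lambda>p q. (restrict_mat \<Omega> n A - restrict_mat \<Omega> n B) $$ (p,q)) =
    acs_size {..<grid_in_size \<Omega> n} (\<lambda>p q. grid_kernel n A (lex_enum (grid_in \<Omega> n) p) (lex_enum (grid_in \<Omega> n) q)
        - grid_kernel n B (lex_enum (grid_in \<Omega> n) p) (lex_enum (grid_in \<Omega> n) q))"
    by (rule acs_size_cong) (simp add: restrict_mat_def grid_kernel_def)
  also have "\<dots> = acs_size (grid_in \<Omega> n) (\<lambda>i j. grid_kernel n A i j - grid_kernel n B i j)"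
    using acs_size_reindex[OF lex_enum_bij[OF finite_grid_in], of \<Omega> n "\<lambda>i j. grid_kernel n A i j - grid_kernel n B i j"]
    by (simp add: grid_in_size_def)
  finally show ?thesis .
qed

text \<open>The diagonal factor leaves a single term of the matrix product, so each summand is a
  coefficient sampled at the row index times a Fourier coefficient at the difference of the
  indices.\<close>

lemma grid_kernel_glt_approx:
  assumes i: "i \<in> grid n" and j: "j \<in> grid n"
  shows "grid_kernel n (glt_approx n r a f) i j =
    (\<Sum>t<r. a t (\<chi> l. real (i $ l) / real (n $ l)) * fourier_coeff (f t) (\<chi> l. int (i $ l) - int (j $ l)))"
proof -
  let ?p = "lex_pos (grid n)"
  have p: "?p i < grid_size n" "?p j < grid_size n" using i j lex_pos_grid_less by auto
  have "(diag_sampling_mat n (a t) * toeplitz_mat n (f t)) $$ (?p i, ?p j) =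
      a t (\<chi> l. real (i $ l) / real (n $ l)) * fourier_coeff (f t) (\<chi> l. int (i $ l) - int (j $ l))" for t
  proof -
    let ?D = "diag_sampling_mat n (a t)" let ?T = "toeplitz_mat n (f t)"
    have d: "?D $$ (?p i, k) = (if k = ?p i then a t (\<chi> l. real (i $ l) / real (n $ l)) else 0)" if "k < grid_size n" for k
    proof -
      have "lex_enum (grid n) k = i \<longleftrightarrow> k = ?p i"
        using lex_enum_pos[OF finite_grid i] lex_pos_enum[OF finite_grid, of k n] that by (auto simp: card_grid)
      thus ?thesis using that p lex_enum_pos[OF finite_grid i] by (auto simp: diag_sampling_mat_def grid_mat_def)
    qed
    have "(?D * ?T) $$ (?p i, ?p j) = (\<Sum>k<grid_size n. ?D $$ (?p i, k) * ?T $$ (k, ?p j))"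
      using p by (simp add: diag_sampling_mat_def toeplitz_mat_def grid_mat_def scalar_prod_def atLeast0LessThan)
    also have "\<dots> = (\<Sum>k<grid_size n. if k = ?p i then a t (\<chi> l. real (i $ l) / real (n $ l)) * ?T $$ (k, ?p j) else 0)"
      using d by (intro sum.cong) auto
    also have "\<dots> = a t (\<chi> l. real (i $ l) / real (n $ l)) * ?T $$ (?p i, ?p j)" using p by simp
    also have "?T $$ (?p i, ?p j) = fourier_coeff (f t) (\<chi> l. int (i $ l) - int (j $ l))"
      using p lex_enum_pos[OF finite_grid i] lex_enum_pos[OF finite_grid j] by (simp add: toeplitz_mat_def grid_mat_def)
    finally show ?thesis .
  qed
  thus ?thesis using p by (simp add: grid_kernel_def glt_approx_def)
qed

section \<open>Fourier coefficients of trigonometric polynomials\<close>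

text \<open>Lebesgue measure on a Euclidean space is by definition the image of a product of copies
  of \<open>interval_measure (\<lambda>x. x)\<close> over the basis, so Fubini for finite products
  applies directly.\<close>

lemma integral_lborel_prod_Basis:
  fixes f :: "'a :: euclidean_space \<Rightarrow> real \<Rightarrow> complex"
  assumes f: "\<And>b. b \<in> Basis \<Longrightarrow> integrable lborel (f b)"
  shows "(LINT x|(lborel :: 'a measure). (\<Prod>b\<in>Basis. f b (x \<bullet> b))) = (\<Prod>b\<in>Basis. LINT y|lborel. f b y)"
proof -
  interpret product_sigma_finite "\<lambda>b :: 'a. interval_measure (\<lambda>x. x)"
    unfolding lborel_eq_real[symmetric] by (intro product_sigma_finite.intro sigma_finite_lborel)
  have m [measurable]: "f b \<in> borel_measurable borel" if "b \<in> Basis" for b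
    using f[OF that] borel_measurable_integrable by simp
  have "(\<lambda>x. \<Prod>b\<in>Basis. f b (x \<bullet> b)) \<in> borel_measurable (borel :: 'a measure)"
    by (intro borel_measurable_prod) measurable
  moreover have "(\<lambda>f. \<Sum>b\<in>Basis. f b *\<^sub>R b) \<in> Pi\<^sub>M Basis (\<lambda>b. interval_measure (\<lambda>x. x)) \<rightarrow>\<^sub>M (borel :: 'a measure)"
    unfolding lborel_eq_real[symmetric] by measurable
  ultimately have "(LINT x|(lborel :: 'a measure). (\<Prod>b\<in>Basis. f b (x \<bullet> b))) =
      (LINT y|Pi\<^sub>M Basis (\<lambda>b :: 'a. interval_measure (\<lambda>x. x)). (\<Prod>b\<in>Basis. f b ((\<Sum>b\<in>Basis. y b *\<^sub>R b) \<bullet> b)))"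
    unfolding lborel_def by (rule integral_distr[rotated])
  also have "\<dots> = (LINT y|Pi\<^sub>M Basis (\<lambda>b :: 'a. interval_measure (\<lambda>x. x)). (\<Prod>b\<in>Basis. f b (y b)))"
    by (simp add: inner_sum_left inner_Basis if_distrib cong: if_cong)
  also have "\<dots> = (\<Prod>b\<in>Basis. LINT y|interval_measure (\<lambda>x. x). f b y)"
    by (rule product_integral_prod) (use f in \<open>auto simp: lborel_eq_real\<close>)
  finally show ?thesis by (simp add: lborel_eq_real)
qed

lemma has_integral_cis_period:
  fixes m :: int
  shows "has_bochner_integral lborel (\<lambda>y. indicator {-pi..pi} y *\<^sub>R cis (of_int m * y)) (if m = 0 then 2 * of_real pi else 0)"
proof (cases "m = 0")
  case True
  have "has_bochner_integral lborel (\<lambda>y. indicator {-pi..pi} y *\<^sub>R (1 :: complex)) (of_real pi - of_real (- pi))"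
    by (rule has_bochner_integral_FTC_Icc) (auto intro!: derivative_eq_intros has_vector_derivative_of_real continuous_intros simp: has_real_derivative_iff_has_vector_derivative[symmetric])
  thus ?thesis using True by simp
next
  case False
  have "((\<lambda>y. cis (of_int m * y) / (\<i> * of_int m)) has_vector_derivative cis (of_int m * y)) (at y within A)" for y A
  proof -
    have "((\<lambda>y. exp (\<i> * of_int m * of_real y) / (\<i> * of_int m)) has_vector_derivative exp (\<i> * of_int m * of_real y)) (at y within A)"
      by (rule has_vector_derivative_real_field) (use False in \<open>auto intro!: derivative_eq_intros\<close>)
    thus ?thesis by (simp add: cis_conv_exp mult_ac)
  qed
  hence "has_bochner_integral lborel (\<lambda>y. indicator {-pi..pi} y *\<^sub>R cis (of_int m * y))
     (cis (of_int m * pi) / (\<i> * of_int m) - cis (of_int m * - pi) / (\<i> * of_int m))"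
    by (intro has_bochner_integral_FTC_Icc) (auto intro!: continuous_intros)
  moreover have "cis (of_int m * pi) = cis (of_int m * - pi)"
    by (auto simp: complex_eq_iff sin_npi_int mult.commute[of _ pi])
  ultimately show ?thesis using False by simp
qed

lemma freq_box_eq: "freq_box = {\<theta>. \<forall>l. -pi \<le> \<theta> $ l \<and> \<theta> $ l \<le> pi}"
  by (auto simp: freq_box_def mem_box_cart)

lemma cis_sum: "finite A \<Longrightarrow> cis (sum f A) = (\<Prod>x\<in>A. cis (f x))"
  by (induction A rule: finite_induct) (auto simp: cis_mult[symmetric])

lemma integral_freq_char:
  "(LINT \<theta>|lebesgue_on freq_box. freq_char k \<theta>) = (if k = 0 then of_real ((2 * pi) ^ CARD('d)) else 0)"
  for k :: "('d :: finite) freq_index"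
proof -
  define f where "f b y = indicator {-pi..pi} y *\<^sub>R cis (of_int (k $ axis_index b) * y)" for b :: "'d point" and y
  have fi: "has_bochner_integral lborel (f b) (if k $ axis_index b = 0 then 2 * of_real pi else 0)" for b
    unfolding f_def by (rule has_integral_cis_period)
  have bij: "bij_betw (\<lambda>l. axis l (1 :: real)) (UNIV :: 'd set) Basis"
    by (rule bij_betw_byWitness[of _ axis_index]) (auto simp: axis_index axis_inverse dest: axis_index)
  have "(LINT \<theta>|lebesgue_on freq_box. freq_char k \<theta>) = (LINT \<theta>|lebesgue. indicator freq_box \<theta> *\<^sub>R freq_char k \<theta>)"
    by (rule integral_restrict_space) (auto simp: freq_box_def)
  also have "\<dots> = (LINT \<theta>|lborel. indicator freq_box \<theta> *\<^sub>R freq_char k \<theta>)"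
    by (rule integral_completion) (auto simp: freq_box_def freq_char_def cis_conv_exp)
  also have "(\<lambda>\<theta>. indicator freq_box \<theta> *\<^sub>R freq_char k \<theta>) = (\<lambda>\<theta>. \<Prod>b\<in>Basis. f b (\<theta> \<bullet> b))"
  proof
    fix \<theta> :: "'d point"
    have "(\<Prod>b\<in>Basis. f b (\<theta> \<bullet> b)) = (\<Prod>l\<in>UNIV. f (axis l 1) (\<theta> \<bullet> axis l 1))"
      by (rule prod.reindex_bij_betw[OF bij, symmetric])
    also have "\<dots> = (\<Prod>l\<in>UNIV. of_real (indicator {-pi..pi} (\<theta> $ l)) * cis (of_int (k $ l) * \<theta> $ l))"
      by (auto simp: f_def inner_axis scaleR_conv_of_real axis_inverse intro!: prod.cong)
    also have "\<dots> = indicator freq_box \<theta> *\<^sub>R freq_char k \<theta>"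
      by (auto simp: prod.distrib freq_char_def cis_sum freq_box_eq indicator_def scaleR_conv_of_real)
    finally show "indicator freq_box \<theta> *\<^sub>R freq_char k \<theta> = (\<Prod>b\<in>Basis. f b (\<theta> \<bullet> b))" by simp
  qed
  also have "(LINT \<theta>|lborel. (\<Prod>b\<in>Basis. f b (\<theta> \<bullet> b))) = (\<Prod>b\<in>Basis. LINT y|lborel. f b y)"
    by (rule integral_lborel_prod_Basis) (use fi has_bochner_integral_iff in blast)
  also have "\<dots> = (\<Prod>b\<in>(Basis :: 'd point set). if k $ axis_index b = 0 then 2 * of_real pi else 0)"
    using fi by (auto simp: has_bochner_integral_iff intro!: prod.cong)
  also have "\<dots> = (\<Prod>l\<in>(UNIV :: 'd set). if k $ l = 0 then 2 * of_real pi else 0)"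
    by (subst prod.reindex_bij_betw[OF bij, symmetric]) (auto intro!: prod.cong)
  also have "\<dots> = (if k = 0 then of_real ((2 * pi) ^ CARD('d)) else 0)"
    by (auto simp: Finite_Cartesian_Product.vec_eq_iff)
  finally show ?thesis .
qed

text \<open>Orthogonality of the characters. It makes the Toeplitz matrix of a trigonometric
  polynomial banded, with the coefficients on its diagonals.\<close>

lemma fourier_coeff_trig_sum:
  assumes K: "finite K"
  shows "fourier_coeff (\<lambda>\<theta>. \<Sum>k\<in>K. c k * freq_char k \<theta>) m = (if m \<in> K then c m else 0)"
proof -
  have int: "integrable (lebesgue_on freq_box) (\<lambda>\<theta>. freq_char k \<theta>)" for k :: "'a freq_index"
    unfolding freq_box_def freq_char_def 
    by (rule continuous_imp_integrable) (auto intro!: continuous_intros)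
  have mult: "freq_char k \<theta> * freq_char (- m) \<theta> = freq_char (k - m) \<theta>" for k \<theta>
    by (simp add: freq_char_def cis_mult sum.distrib[symmetric] algebra_simps sum_negf sum_subtractf)
  have "(LINT \<theta>|lebesgue_on freq_box. (\<Sum>k\<in>K. c k * freq_char k \<theta>) * freq_char (- m) \<theta>) =
      (LINT \<theta>|lebesgue_on freq_box. (\<Sum>k\<in>K. c k * freq_char (k - m) \<theta>))"
    by (simp add: sum_distrib_right mult.assoc mult)
  also have "\<dots> = (\<Sum>k\<in>K. c k * (if k - m = 0 then of_real ((2 * pi) ^ CARD('a)) else 0))"
    by (subst Bochner_Integration.integral_sum) (use int in \<open>auto simp: integral_freq_char intro!: sum.cong\<close>)
  also have "\<dots> = (\<Sum>k\<in>K. if k = m then c m * of_real ((2 * pi) ^ CARD('a)) else 0)"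
    by (intro sum.cong) auto
  also have "\<dots> = (if m \<in> K then c m else 0) * of_real ((2 * pi) ^ CARD('a))"
    using K by simp
  finally show ?thesis unfolding fourier_coeff_def by simp
qed

section \<open>Half-open boxes and products of Lebesgue sets\<close>

text \<open>Half-open, so that the boxes of a mesh are disjoint and still cover. Open on the left
  because grid indices start at 1 and the index \<open>i\<close> owns the cell that ends at
  \<open>i / n\<close>.\<close>

definition hbox :: "('d :: finite) point \<Rightarrow> 'd point \<Rightarrow> 'd point set" where
  "hbox a b = {x. \<forall>l. a $ l < x $ l \<and> x $ l \<le> b $ l}"

lemma hbox_borel [measurable]: "hbox a b \<in> sets borel"
proof -
  have "hbox a b = (\<Inter>l. {x. a $ l < x $ l} \<inter> {x. x $ l \<le> b $ l})" by (auto simp: hbox_def)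
  thus ?thesis by (auto intro!: sets.countable_INT'' simp: countable_finite open_halfspace_component_gt_cart closed_halfspace_component_le_cart borel_open borel_closed)
qed

text \<open>Squeezed between the open and the closed box, which have the same volume.\<close>

lemma emeasure_hbox:
  assumes "\<And>l. a $ l \<le> b $ l"
  shows "emeasure lborel (hbox a b) = ennreal (\<Prod>l\<in>UNIV. b $ l - a $ l)"
proof (rule antisym)
  have c: "emeasure lborel (cbox a b) = ennreal (\<Prod>l\<in>UNIV. b $ l - a $ l)"
    using content_cbox_cart[of a b] assms emeasure_lborel_cbox_finite[of a b]
      emeasure_eq_ennreal_measure[of lborel "cbox a b"] by (simp add: interval_ne_empty_cart less_top)
  have "emeasure lborel (hbox a b) \<le> emeasure lborel (cbox a b)"
    by (intro emeasure_mono) (auto simp: hbox_def mem_box_cart less_imp_le)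
  thus "emeasure lborel (hbox a b) \<le> ennreal (\<Prod>l\<in>UNIV. b $ l - a $ l)" using c by simp
  have "emeasure lborel (box a b) \<le> emeasure lborel (hbox a b)"
    by (intro emeasure_mono) (auto simp: hbox_def mem_box_cart less_imp_le)
  moreover have "emeasure lborel (box a b) = emeasure lborel (cbox a b)"
    by (simp add: emeasure_lborel_box_eq emeasure_lborel_cbox_eq)
  ultimately show "ennreal (\<Prod>l\<in>UNIV. b $ l - a $ l) \<le> emeasure lborel (hbox a b)" using c by simp
qed

lemma measure_hbox:
  assumes "\<And>l. a $ l \<le> b $ l"
  shows "measure lebesgue (hbox a b) = (\<Prod>l\<in>UNIV. b $ l - a $ l)"
  using emeasure_hbox[OF assms] assms by (simp add: measure_def measure_completion prod_nonneg)

lemma emeasure_Times_lborel: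
  fixes A :: "'a :: euclidean_space set" and B :: "'b :: euclidean_space set"
  assumes "A \<in> sets borel" "B \<in> sets borel"
  shows "emeasure lborel (A \<times> B) = emeasure lborel A * emeasure lborel B"
  using lborel.emeasure_pair_measure_Times[of A lborel B] assms by (simp add: lborel_prod)

lemma measure_hbox_Times:
  fixes a b :: "('d :: finite) point" and a' b' :: "('e :: finite) point"
  assumes "\<And>l. a $ l \<le> b $ l" "\<And>l. a' $ l \<le> b' $ l"
  shows "measure lebesgue (hbox a b \<times> hbox a' b') = (\<Prod>l\<in>UNIV. b $ l - a $ l) * (\<Prod>l\<in>UNIV. b' $ l - a' $ l)"
    and "hbox a b \<times> hbox a' b' \<in> lmeasurable"
proof -
  have e: "emeasure lborel (hbox a b \<times> hbox a' b') = ennreal ((\<Prod>l\<in>UNIV. b $ l - a $ l) * (\<Prod>l\<in>UNIV. b' $ l - a' $ l))"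
    using assms by (simp add: emeasure_Times_lborel emeasure_hbox ennreal_mult prod_nonneg)
  have s: "hbox a b \<times> hbox a' b' \<in> sets borel"
    by (simp add: borel_prod[symmetric])
  show "hbox a b \<times> hbox a' b' \<in> lmeasurable"
    using e s by (intro fmeasurableI) (auto simp: emeasure_completion)
  show "measure lebesgue (hbox a b \<times> hbox a' b') = (\<Prod>l\<in>UNIV. b $ l - a $ l) * (\<Prod>l\<in>UNIV. b' $ l - a' $ l)"
    using e s assms by (simp add: measure_completion measure_def prod_nonneg)
qed

lemma measure_hbox_Times_freq_box:
  fixes a b :: "('d :: finite) point"
  assumes "\<And>l. a $ l \<le> b $ l"
  shows "measure lebesgue (hbox a b \<times> (freq_box :: ('e :: finite) point set)) = (\<Prod>l\<in>UNIV. b $ l - a $ l) * (2 * pi) ^ CARD('e)"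
    and "hbox a b \<times> (freq_box :: 'e point set) \<in> lmeasurable"
proof -
  have "measure lborel (cbox (\<chi> l. - pi) (\<chi> l. pi) :: 'e point set) = (2 * pi) ^ CARD('e)"
    by (subst content_cbox_cart) (auto simp: interval_ne_empty_cart)
  hence f: "emeasure lborel (freq_box :: 'e point set) = ennreal ((2 * pi) ^ CARD('e))"
    unfolding freq_box_def using emeasure_lborel_cbox_finite[of "\<chi> l. - pi" "\<chi> l. pi"]
      emeasure_eq_ennreal_measure[of lborel "cbox (\<chi> l. - pi) (\<chi> l. pi) :: 'e point set"] by (simp add: less_top)
  have fb: "(freq_box :: 'e point set) \<in> sets borel" by (simp add: freq_box_def)
  have e: "emeasure lborel (hbox a b \<times> (freq_box :: 'e point set)) = ennreal ((\<Prod>l\<in>UNIV. b $ l - a $ l) * (2 * pi) ^ CARD('e))"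
    using assms by (simp add: emeasure_Times_lborel fb f emeasure_hbox ennreal_mult prod_nonneg)
  have s: "hbox a b \<times> (freq_box :: 'e point set) \<in> sets borel"
    using fb by (simp add: borel_prod[symmetric])
  show "hbox a b \<times> (freq_box :: 'e point set) \<in> lmeasurable"
    using e s by (intro fmeasurableI) (auto simp: emeasure_completion)
  show "measure lebesgue (hbox a b \<times> (freq_box :: 'e point set)) = (\<Prod>l\<in>UNIV. b $ l - a $ l) * (2 * pi) ^ CARD('e)"
    using e s assms by (simp add: measure_completion measure_def prod_nonneg)
qed

lemma null_sets_Times:
  fixes A :: "'a :: euclidean_space set" and B :: "'b :: euclidean_space set"
  assumes "A \<in> null_sets lebesgue"
  shows "A \<times> B \<in> null_sets lebesgue"
proof -
  obtain N where N: "N \<in> null_sets lborel" "A \<subseteq> N" using assms by (auto elim: completion.complete2 simp: null_sets_completion_iff2)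
  have "emeasure lborel (N \<times> (UNIV :: 'b set)) = 0"
    using N(1) by (subst emeasure_Times_lborel) (auto simp: null_sets_def)
  moreover have "N \<times> (UNIV :: 'b set) \<in> sets borel" using N(1) by (simp add: borel_prod[symmetric] null_sets_def)
  ultimately have "N \<times> (UNIV :: 'b set) \<in> null_sets lborel" by (auto simp: null_sets_def)
  moreover have "A \<times> B \<subseteq> N \<times> UNIV" using N by auto
  ultimately show ?thesis using null_sets_completion_subset null_sets_completionI by blast
qed

text \<open>Up to a subset of its null frontier \<open>\<Omega>\<close> is its interior, so
  completeness of Lebesgue measure gives measurability of \<open>\<Omega>\<close> and of the
  product.\<close>

lemma peano_jordan_Times_freq_box:
  fixes \<Omega> :: "('d :: finite) point set"
  assumes "peano_jordan \<Omega>"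
  shows "\<Omega> \<times> (freq_box :: ('e :: finite) point set) \<in> lmeasurable" and "\<Omega> \<in> lmeasurable"
proof -
  have fr: "frontier \<Omega> \<in> null_sets lebesgue" "bounded \<Omega>" using assms by (auto simp: peano_jordan_def)
  have O: "\<Omega> = interior \<Omega> \<union> (\<Omega> \<inter> frontier \<Omega>)"
    using interior_subset closure_subset by (auto simp: frontier_def)
  have m1: "\<Omega> \<inter> frontier \<Omega> \<in> null_sets lebesgue" using fr(1) by (rule null_sets_completion_subset[rotated]) auto
  have s: "\<Omega> \<in> sets lebesgue" 
    by (subst O) (use m1 in \<open>auto intro!: sets.Un simp: null_setsD2\<close>)
  show "\<Omega> \<in> lmeasurable" using s fr(2) by (simp add: bounded_set_imp_lmeasurable)
  have "\<Omega> \<times> (freq_box :: 'e point set) = interior \<Omega> \<times> freq_box \<union> (\<Omega> \<inter> frontier \<Omega>) \<times> freq_box" using O by auto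
  moreover have "interior \<Omega> \<times> (freq_box :: 'e point set) \<in> sets borel"
    by (simp add: borel_prod[symmetric] freq_box_def)
  moreover have "(\<Omega> \<inter> frontier \<Omega>) \<times> (freq_box :: 'e point set) \<in> null_sets lebesgue" by (rule null_sets_Times[OF m1])
  ultimately have "\<Omega> \<times> (freq_box :: 'e point set) \<in> sets lebesgue" by (auto intro!: sets.Un simp: null_setsD2)
  thus "\<Omega> \<times> (freq_box :: 'e point set) \<in> lmeasurable"
    using fr(2) by (intro bounded_set_imp_lmeasurable bounded_Times) (auto simp: freq_box_def)
qed

section \<open>Cells of the grid and the boundary of a Peano--Jordan set\<close>

definition cell :: "('d :: finite) multi_index \<Rightarrow> 'd multi_index \<Rightarrow> 'd point set" where
  "cell n i = hbox (\<chi> l. (real (i $ l) - 1) / real (n $ l)) (\<chi> l. real (i $ l) / real (n $ l))"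

text \<open>Distance at most \<open>b\<close> in every coordinate, written additively because the
  indices are natural numbers. An index near a grid index may lie off the grid.\<close>

definition near :: "nat \<Rightarrow> ('d :: finite) multi_index \<Rightarrow> 'd multi_index \<Rightarrow> bool" where
  "near b i j \<longleftrightarrow> (\<forall>l. i $ l \<le> j $ l + b \<and> j $ l \<le> i $ l + b)"

definition close_pt :: "('d :: finite) multi_index \<Rightarrow> nat \<Rightarrow> 'd multi_index \<Rightarrow> 'd point \<Rightarrow> bool" where
  "close_pt n b i x \<longleftrightarrow> (\<forall>l. \<bar>x $ l - real (i $ l) / real (n $ l)\<bar> \<le> real b / real (n $ l))"

text \<open>At a tame index, membership in \<open>\<Omega>\<close> is constant at scale \<open>b / n\<close>, both for the sampling points
  \<open>j / (n + 1)\<close>, which decide membership in \<open>grid_in\<close>, and for the nearby points of the cube.\<close>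

definition tame :: "('d :: finite) point set \<Rightarrow> 'd multi_index \<Rightarrow> nat \<Rightarrow> 'd multi_index \<Rightarrow> bool" where
  "tame \<Omega> n b i \<longleftrightarrow>
     ((\<forall>j. near b i j \<longrightarrow> j \<in> grid_in \<Omega> n) \<and> (\<forall>x. close_pt n b i x \<longrightarrow> x \<in> \<Omega>)) \<or>
     ((\<forall>j. near b i j \<longrightarrow> j \<notin> grid_in \<Omega> n) \<and> (\<forall>x. close_pt n b i x \<longrightarrow> x \<notin> \<Omega>))"

text \<open>The frontier is compact and null, so an open set \<open>B\<close> of small measure
  contains its neighbourhood of some uniform radius \<open>\<rho>\<close>. A ball meeting both
  \<open>\<Omega>\<close> and its complement is connected, hence meets the frontier, so its centre
  lies in \<open>B\<close>.\<close>

lemma peano_jordan_thick_frontier: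
  fixes \<Omega> :: "('d :: finite) point set"
  assumes "peano_jordan \<Omega>" "\<epsilon> > 0"
  obtains B \<rho> where "B \<in> lmeasurable" "measure lebesgue B < \<epsilon>" "\<rho> > 0"
    "\<And>x y. x \<notin> B \<Longrightarrow> dist x y < \<rho> \<Longrightarrow> y \<in> \<Omega> \<longleftrightarrow> x \<in> \<Omega>"
proof -
  have fr: "frontier \<Omega> \<in> null_sets lebesgue" "bounded \<Omega>" using assms by (auto simp: peano_jordan_def)
  have cf: "compact (frontier \<Omega>)" using fr(2) by (simp add: compact_frontier_bounded)
  have "frontier \<Omega> \<in> sets lebesgue" using fr(1) by auto
  from sets_lebesgue_outer_open[OF this assms(2)] obtain T where
    T: "open T" "frontier \<Omega> \<subseteq> T" "T - frontier \<Omega> \<in> lmeasurable" "emeasure lebesgue (T - frontier \<Omega>) < ennreal \<epsilon>"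
    by blast
  have eT: "emeasure lebesgue T = emeasure lebesgue (T - frontier \<Omega>)"
    using emeasure_Diff_null_set[OF fr(1), of T] T(1) by auto
  have Tm: "T \<in> lmeasurable" using T eT by (intro fmeasurableI) (auto simp: less_top[symmetric] dest: order.strict_trans1)
  have "measure lebesgue T < \<epsilon>"
  proof -
    have "ennreal (measure lebesgue T) < ennreal \<epsilon>"
      using T(4) unfolding eT[symmetric] emeasure_eq_measure2[OF Tm] .
    thus ?thesis by (simp add: ennreal_less_iff)
  qed
  from compact_subset_open_imp_ball_epsilon_subset[OF cf T(1,2)] obtain \<rho> where
    \<rho>: "\<rho> > 0" "(\<Union>x\<in>frontier \<Omega>. ball x \<rho>) \<subseteq> T" by blast
  have main: "y \<in> \<Omega> \<longleftrightarrow> x \<in> \<Omega>" if "x \<notin> T" "dist x y < \<rho>" for x y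
  proof (rule ccontr)
    assume *: "\<not> ?thesis"
    have xy: "x \<in> ball x \<rho>" "y \<in> ball x \<rho>" using that \<rho>(1) by auto
    have "ball x \<rho> \<inter> \<Omega> \<noteq> {}" "ball x \<rho> - \<Omega> \<noteq> {}" using * xy by blast+
    hence "ball x \<rho> \<inter> frontier \<Omega> \<noteq> {}" by (intro connected_Int_frontier) auto
    then obtain z where "z \<in> frontier \<Omega>" "dist x z < \<rho>" by auto
    hence "x \<in> ball z \<rho>" by (simp add: dist_commute)
    hence "x \<in> T" using \<rho>(2) \<open>z \<in> frontier \<Omega>\<close> by blast
    thus False using that by simp
  qed
  show ?thesis by (rule that[OF Tm \<open>measure lebesgue T < \<epsilon>\<close> \<rho>(1) main])
qed

lemma abs_diff_mult_divide:
  fixes x i r :: real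
  assumes "r > 0"
  shows "\<bar>x * r - i\<bar> / r = \<bar>x - i / r\<bar>"
proof -
  have "x - i / r = (x * r - i) / r" using assms by (simp add: field_simps)
  thus ?thesis using assms by (simp add: abs_divide)
qed

lemma mem_cell:
  assumes "\<And>l. n $ l > 0"
  shows "x \<in> cell n i \<longleftrightarrow> (\<forall>l. real (i $ l) - 1 < x $ l * real (n $ l) \<and> x $ l * real (n $ l) \<le> real (i $ l))"
  using assms by (simp add: cell_def hbox_def pos_divide_less_eq pos_le_divide_eq)

lemma measure_cell:
  assumes "\<And>l. n $ l > 0"
  shows "measure lebesgue (cell n i) = 1 / real (grid_size n)"
proof -
  have "measure lebesgue (cell n i) = (\<Prod>l\<in>UNIV. 1 / real (n $ l))"
    unfolding cell_def by (subst measure_hbox) (auto simp: divide_right_mono diff_divide_distrib intro!: prod.cong)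
  thus ?thesis by (simp add: grid_size_def prod_dividef)
qed

lemma cell_lmeasurable: "cell n i \<in> lmeasurable"
proof -
  have "bounded (cell n i)"
    by (rule bounded_subset[of "cbox (\<chi> l. (real (i $ l) - 1) / real (n $ l)) (\<chi> l. real (i $ l) / real (n $ l))"])
      (auto simp: cell_def hbox_def mem_box_cart less_imp_le)
  thus ?thesis by (intro bounded_set_imp_lmeasurable) (auto simp: cell_def)
qed

lemma cell_disjoint:
  assumes "\<And>l. n $ l > 0" "x \<in> cell n i" "x \<in> cell n j"
  shows "i = j"
proof -
  have "i $ l = j $ l" for l
    using assms(2,3) unfolding mem_cell[OF assms(1)] by (smt (verit) of_nat_less_iff of_nat_1 of_nat_add nat_neq_iff Suc_leI of_nat_le_iff of_nat_Suc)
  thus ?thesis by (simp add: Finite_Cartesian_Product.vec_eq_iff)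
qed

lemma cell_exists:
  assumes "\<And>l. n $ l > 0" "x \<in> hbox 0 1"
  shows "\<exists>i\<in>grid n. x \<in> cell n i"
proof -
  define i where "i = (\<chi> l. nat \<lceil>x $ l * real (n $ l)\<rceil>)"
  have x: "0 < x $ l * real (n $ l)" "x $ l * real (n $ l) \<le> real (n $ l)" for l
    using assms by (auto simp: hbox_def mult_left_le_one_le)
  have c: "real (i $ l) = of_int \<lceil>x $ l * real (n $ l)\<rceil>" for l
    using x(1)[of l] by (simp add: i_def)
  have "x \<in> cell n i" unfolding mem_cell[OF assms(1)] c by (auto intro: ceiling_correct[THEN conjunct1])
  moreover have "i \<in> grid n"
  proof -
    have "1 \<le> i $ l" "i $ l \<le> n $ l" for l
      using x[of l] by (auto simp: i_def ceiling_le_iff nat_le_iff Suc_le_eq)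
    thus ?thesis by (simp add: grid_def)
  qed
  ultimately show ?thesis by blast
qed

lemma measure_Union_cells:
  assumes n: "\<And>l. n $ l > 0" and I: "finite I"
  shows "measure lebesgue (\<Union>i\<in>I. cell n i) = real (card I) / real (grid_size n)"
    and "(\<Union>i\<in>I. cell n i) \<in> lmeasurable"
proof -
  have "measure lebesgue (\<Union>i\<in>I. cell n i) = (\<Sum>i\<in>I. measure lebesgue (cell n i))"
    by (rule measure_UNION'[OF I cell_lmeasurable]) (auto simp: pairwise_def disjnt_def dest: cell_disjoint[OF n])
  thus "measure lebesgue (\<Union>i\<in>I. cell n i) = real (card I) / real (grid_size n)"
    by (simp add: measure_cell[OF n])
  show "(\<Union>i\<in>I. cell n i) \<in> lmeasurable" using I cell_lmeasurable by (intro fmeasurable.finite_UN) auto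
qed

text \<open>All points in the definition of \<open>tame\<close> lie within
  \<open>(2 * b + 2) / n\<close> of \<open>x\<close> in each coordinate: the cell accounts for 1,
  nearness for \<open>b\<close>, and the difference between \<open>j / (n + 1)\<close> and
  \<open>j / n\<close> for \<open>b + 1\<close>. The factor \<open>CARD('d)\<close> passes from
  coordinates to Euclidean distance.\<close>

lemma tame_if_cell_off_frontier:
  fixes n :: "('d :: finite) multi_index"
  assumes \<Omega>: "\<Omega> \<subseteq> cbox 0 1" and i: "i \<in> grid n"
    and n: "\<And>l. real CARD('d) * (2 * real b + 2) < \<rho> * real (n $ l)"
    and B: "\<And>x y. x \<notin> B \<Longrightarrow> dist x y < \<rho> \<Longrightarrow> y \<in> \<Omega> \<longleftrightarrow> x \<in> \<Omega>"
    and x: "x \<in> cell n i" "x \<notin> B"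
  shows "tame \<Omega> n b i"
proof -
  have n0: "n $ l > 0" for l using i by (auto simp: grid_def Suc_le_eq intro: less_le_trans)
  have dpos: "real CARD('d) \<ge> 1" by (simp add: Suc_le_eq)
  have \<rho>: "(2 * real b + 2) / real (n $ l) < \<rho> / real CARD('d)" for l
    using n[of l] n0[of l] dpos by (simp add: field_simps)
  have dist: "dist x y < \<rho>" if "\<And>l. \<bar>y $ l - x $ l\<bar> \<le> (2 * real b + 2) / real (n $ l)" for y
  proof -
    have "dist x y \<le> (\<Sum>l\<in>UNIV. \<bar>(x - y) $ l\<bar>)" unfolding dist_norm by (rule norm_le_l1_cart)
    also have "\<dots> < (\<Sum>l\<in>(UNIV :: 'd set). \<rho> / real CARD('d))"
    proof (rule sum_strict_mono)
      fix l :: 'd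
      show "\<bar>(x - y) $ l\<bar> < \<rho> / real CARD('d)" using that[of l] \<rho>[of l] by (simp add: abs_minus_commute)
    qed auto
    finally show ?thesis by simp
  qed
  have xc: "\<bar>real (i $ l) / real (n $ l) - x $ l\<bar> \<le> 1 / real (n $ l)" for l
  proof -
    have "real (i $ l) - 1 < x $ l * real (n $ l)" "x $ l * real (n $ l) \<le> real (i $ l)"
      using x(1) unfolding mem_cell[OF n0] by auto
    hence "\<bar>x $ l * real (n $ l) - real (i $ l)\<bar> / real (n $ l) \<le> 1 / real (n $ l)"
      by (intro divide_right_mono) auto
    also have "\<bar>x $ l * real (n $ l) - real (i $ l)\<bar> / real (n $ l) = \<bar>x $ l - real (i $ l) / real (n $ l)\<bar>"
      by (rule abs_diff_mult_divide) (use n0[of l] in simp)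
    finally show ?thesis by (simp add: abs_minus_commute)
  qed
  have close: "y \<in> \<Omega> \<longleftrightarrow> x \<in> \<Omega>" if "close_pt n b i y" for y
  proof (rule B[OF x(2)], rule dist)
    fix l
    have "\<bar>y $ l - x $ l\<bar> \<le> real b / real (n $ l) + 1 / real (n $ l)"
      using that xc[of l] unfolding close_pt_def by (smt (verit))
    also have "\<dots> \<le> (2 * real b + 2) / real (n $ l)"
      unfolding add_divide_distrib[symmetric] by (intro divide_right_mono) auto
    finally show "\<bar>y $ l - x $ l\<bar> \<le> (2 * real b + 2) / real (n $ l)" .
  qed
  have grid_pt: "(\<chi> l. real (j $ l) / real (n $ l + 1)) \<in> \<Omega> \<longleftrightarrow> x \<in> \<Omega>" if j: "near b i j" for j
  proof (rule B[OF x(2)], rule dist)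
    fix l
    have i1: "i $ l \<le> n $ l" using i by (auto simp: grid_def)
    have j1: "\<bar>real (j $ l) - real (i $ l)\<bar> \<le> real b"
    proof -
      have "i $ l \<le> j $ l + b" "j $ l \<le> i $ l + b" using j by (auto simp: near_def)
      hence "real (i $ l) \<le> real (j $ l) + real b" "real (j $ l) \<le> real (i $ l) + real b" by linarith+
      thus ?thesis by (simp add: abs_le_iff)
    qed
    \<comment> \<open>As \<open>j\<close> may lie off the grid, only \<open>j \<le> n + b\<close> is
      available; this is the origin of the term \<open>b + 1\<close>.\<close>
    have "\<bar>real (j $ l) / real (n $ l + 1) - real (j $ l) / real (n $ l)\<bar> = real (j $ l) / (real (n $ l + 1) * real (n $ l))"
    proof -
      have "real (j $ l) / real (n $ l + 1) - real (j $ l) / real (n $ l) = - (real (j $ l) / (real (n $ l + 1) * real (n $ l)))"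
        using n0[of l] by (simp add: field_simps)
      thus ?thesis by simp
    qed
    also have "\<dots> \<le> (real b + 1) / real (n $ l)"
    proof -
      have "real (j $ l) \<le> real (n $ l) + real b" using j1 i1 by linarith
      also have "\<dots> \<le> (real b + 1) * real (n $ l + 1)" by (simp add: algebra_simps)
      finally show ?thesis using n0[of l] by (simp add: pos_divide_le_eq mult.commute)
    qed
    finally have a: "\<bar>real (j $ l) / real (n $ l + 1) - real (j $ l) / real (n $ l)\<bar> \<le> (real b + 1) / real (n $ l)" .
    have "\<bar>real (j $ l) / real (n $ l) - real (i $ l) / real (n $ l)\<bar> = \<bar>real (j $ l) - real (i $ l)\<bar> / real (n $ l)"
      by (simp add: diff_divide_distrib[symmetric])
    also have "\<dots> \<le> real b / real (n $ l)" using j1 by (intro divide_right_mono) auto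
    finally have "\<bar>real (j $ l) / real (n $ l + 1) - x $ l\<bar> \<le> (real b + 1) / real (n $ l) + real b / real (n $ l) + 1 / real (n $ l)"
      using a xc[of l] by linarith
    also have "\<dots> = (2 * real b + 2) / real (n $ l)" by (simp add: add_divide_distrib[symmetric])
    finally show "\<bar>(\<chi> l. real (j $ l) / real (n $ l + 1)) $ l - x $ l\<bar> \<le> (2 * real b + 2) / real (n $ l)" by simp
  qed
  show ?thesis
  proof (cases "x \<in> \<Omega>")
    case False
    thus ?thesis unfolding tame_def using close grid_pt by (auto simp: grid_in_def)
  next
    case True
    \<comment> \<open>Membership in \<open>grid_in\<close> includes membership in the grid. Moving
      \<open>x\<close> by \<open>t\<close> along an axis in either direction stays in
      \<open>\<Omega>\<close>, hence in the cube; so \<open>x\<close> keeps distance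
      \<open>t\<close> from the faces, which leaves room for \<open>j\<close>.\<close>
    have "j \<in> grid n" if j: "near b i j" for j
    proof -
      have "1 \<le> j $ l \<and> j $ l \<le> n $ l" for l
      proof -
        define t where "t = (2 * real b + 2) / real (n $ l)"
        have t0: "t \<ge> 0" by (simp add: t_def)
        have ax: "x + s *\<^sub>R axis l 1 \<in> \<Omega>" if "\<bar>s\<bar> \<le> t" for s
        proof -
          have "dist x (x + s *\<^sub>R axis l 1) < \<rho>"
            by (rule dist) (use that t0 in \<open>auto simp: t_def axis_def\<close>)
          thus ?thesis using B[OF x(2)] True by blast
        qed
        have "0 \<le> x $ l - t" using subsetD[OF \<Omega> ax[of "-t"]] t0 by (auto simp: mem_box_cart axis_def dest!: spec[of _ l])
        moreover have "x $ l + t \<le> 1" using subsetD[OF \<Omega> ax[of t]] t0 by (auto simp: mem_box_cart axis_def dest!: spec[of _ l])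
        ultimately have xl: "(2 * real b + 2) \<le> x $ l * real (n $ l)" "x $ l * real (n $ l) + (2 * real b + 2) \<le> real (n $ l)"
          using n0[of l] by (auto simp: t_def field_simps)
        have ix: "real (i $ l) - 1 < x $ l * real (n $ l)" "x $ l * real (n $ l) \<le> real (i $ l)"
          using x(1) unfolding mem_cell[OF n0] by auto
        have "i $ l \<le> j $ l + b" "j $ l \<le> i $ l + b" using j by (auto simp: near_def)
        hence "real (i $ l) \<le> real (j $ l) + real b" "real (j $ l) \<le> real (i $ l) + real b" by linarith+
        hence "real (j $ l) \<ge> 1" "real (j $ l) \<le> real (n $ l)" using xl ix by linarith+
        thus ?thesis by linarith
      qed
      thus ?thesis by (simp add: grid_def)
    qed
    thus ?thesis unfolding tame_def using close grid_pt True by (auto simp: grid_in_def)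
  qed
qed

text \<open>The cell of an index that is not tame lies entirely in the small neighbourhood
  \<open>B\<close> of the frontier. The cells are disjoint and of volume
  \<open>1 / grid_size\<close>, so counting them is measuring a part of \<open>B\<close>.\<close>

lemma few_wild_indices:
  fixes \<nu> :: "nat \<Rightarrow> ('d :: finite) multi_index"
  assumes \<nu>: "filterlim (\<lambda>n. Min (range (\<lambda>l. \<nu> n $ l))) at_top sequentially"
    and \<Omega>: "\<Omega> \<subseteq> cbox 0 1" "peano_jordan \<Omega>" and \<epsilon>: "\<epsilon> > 0"
  shows "eventually (\<lambda>n. real (card {i \<in> grid (\<nu> n). \<not> tame \<Omega> (\<nu> n) b i}) \<le> \<epsilon> * real (grid_size (\<nu> n))) sequentially"
proof -
  obtain B \<rho> where B: "B \<in> lmeasurable" "measure lebesgue B < \<epsilon>" "\<rho> > 0"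
    "\<And>x y. x \<notin> B \<Longrightarrow> dist x y < \<rho> \<Longrightarrow> y \<in> \<Omega> \<longleftrightarrow> x \<in> \<Omega>"
    by (rule peano_jordan_thick_frontier[OF \<Omega>(2) \<epsilon>]) blast
  obtain m :: nat where m: "real CARD('d) * (2 * real b + 2) / \<rho> < real m" using reals_Archimedean2 by blast
  \<comment> \<open>The successor also makes every component positive.\<close>
  have "eventually (\<lambda>n. Suc m \<le> Min (range (\<lambda>l. \<nu> n $ l))) sequentially"
    using \<nu> by (auto simp: filterlim_at_top)
  thus ?thesis
  proof eventually_elim
    case (elim n)
    have nl: "Suc m \<le> \<nu> n $ l" for l using elim by (meson Min_le finite_range_imageI finite finite_imageI order_trans rangeI)
    hence n0: "\<nu> n $ l > 0" for l using less_le_trans[of 0 "Suc m"] by blast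
    have n1: "real CARD('d) * (2 * real b + 2) < \<rho> * real (\<nu> n $ l)" for l
    proof -
      have "real CARD('d) * (2 * real b + 2) < real m * \<rho>" using m B(3) by (simp add: pos_divide_less_eq)
      also have "\<dots> \<le> real (\<nu> n $ l) * \<rho>" using nl[of l] B(3) by (intro mult_right_mono) auto
      finally show ?thesis by (simp add: mult.commute)
    qed
    define I where "I = {i \<in> grid (\<nu> n). \<not> tame \<Omega> (\<nu> n) b i}"
    have I: "finite I" by (simp add: I_def)
    have sub: "(\<Union>i\<in>I. cell (\<nu> n) i) \<subseteq> B"
    proof
      fix x assume "x \<in> (\<Union>i\<in>I. cell (\<nu> n) i)"
      then obtain i where i: "i \<in> grid (\<nu> n)" "\<not> tame \<Omega> (\<nu> n) b i" "x \<in> cell (\<nu> n) i"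
        by (auto simp: I_def)
      show "x \<in> B" using tame_if_cell_off_frontier[OF \<Omega>(1) i(1) n1 B(4) i(3)] i(2) by blast
    qed
    have "real (card I) / real (grid_size (\<nu> n)) \<le> measure lebesgue B"
      unfolding measure_Union_cells(1)[OF n0 I, symmetric]
      by (rule measure_mono_fmeasurable[OF sub]) (use measure_Union_cells(2)[OF n0 I] B(1) in auto)
    also have "\<dots> \<le> \<epsilon>" using B(2) by simp
    finally have "real (card I) / real (grid_size (\<nu> n)) \<le> \<epsilon>" .
    moreover have "grid_size (\<nu> n) > 0" using n0 by (simp add: grid_size_def)
    ultimately show ?case by (simp add: I_def pos_divide_le_eq)
  qed
qed

section \<open>Discrete Fourier modes on blocks\<close>

text \<open>Geometric sum of a root of unity; the bound on \<open>m\<close> keeps the root different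
  from 1 unless \<open>m = 0\<close>.\<close>

lemma sum_cis_roots:
  fixes m :: int
  assumes b: "b > 0" and m: "\<bar>m\<bar> < int b"
  shows "(\<Sum>t<b. cis (2 * pi * of_int m * real t / real b)) = (if m = 0 then of_nat b else 0)"
proof (cases "m = 0")
  case False
  define z where "z = cis (2 * pi * of_int m / real b)"
  have pw: "cis (2 * pi * of_int m * real t / real b) = z ^ t" for t
  proof -
    have "real t * (2 * pi * of_int m / real b) = 2 * pi * of_int m * real t / real b" by simp
    thus ?thesis using Complex.DeMoivre[of "2 * pi * of_int m / real b" t] unfolding z_def by metis
  qed
  have "z ^ b = 1" using pw[of b] b by (simp add: cis_multiple_2pi)
  have "z \<noteq> 1"
  proof
    assume "z = 1"
    \<comment> \<open>The roots of unity are indexed by naturals below \<open>b\<close>; a negative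
      \<open>m\<close> is reduced to \<open>k\<close> by conjugation.\<close>
    define k where "k = nat \<bar>m\<bar>"
    have k: "0 < k" "k < b" using m False by (auto simp: k_def)
    have "cis (2 * pi * real k / real b) = 1"
    proof (cases "m \<ge> 0")
      case True
      thus ?thesis using \<open>z = 1\<close> by (simp add: z_def k_def)
    next
      case False
      hence "cis (2 * pi * real k / real b) = cnj z" by (simp add: z_def k_def cis_cnj)
      thus ?thesis using \<open>z = 1\<close> by simp
    qed
    hence "cis (2 * pi * real k / real b) = cis (2 * pi * real 0 / real b)" by simp
    moreover have "inj_on (\<lambda>k. cis (2 * pi * real k / real b)) {..<b}"
      using Complex.bij_betw_roots_unity[OF b] by (auto simp: bij_betw_def)
    ultimately have "k = 0" using k b inj_onD[of "\<lambda>k. cis (2 * pi * real k / real b)" "{..<b}" k 0] by auto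
    thus False using k by simp
  qed
  hence "(\<Sum>t<b. z ^ t) = (z ^ b - 1) / (z - 1)" by (rule geometric_sum)
  thus ?thesis using \<open>z ^ b = 1\<close> False by (simp add: pw)
qed simp

lemma sum_vec_prod:
  fixes f :: "'d :: finite \<Rightarrow> nat \<Rightarrow> complex"
  assumes "\<And>l. finite (A l)"
  shows "(\<Sum>i\<in>{i :: 'd multi_index. \<forall>l. i $ l \<in> A l}. \<Prod>l\<in>UNIV. f l (i $ l)) = (\<Prod>l\<in>UNIV. \<Sum>x\<in>A l. f l x)"
proof -
  have b: "bij_betw (\<lambda>i l. i $ l) {i :: 'd multi_index. \<forall>l. i $ l \<in> A l} (Pi\<^sub>E UNIV A)"
    by (rule bij_betw_byWitness[of _ "\<lambda>f. \<chi> l. f l"]) (auto simp: PiE_def)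
  have "(\<Sum>i\<in>{i :: 'd multi_index. \<forall>l. i $ l \<in> A l}. \<Prod>l\<in>UNIV. f l (i $ l)) = (\<Sum>g\<in>Pi\<^sub>E UNIV A. \<Prod>l\<in>UNIV. f l (g l))"
    by (rule sum.reindex_bij_betw[OF b])
  also have "\<dots> = (\<Prod>l\<in>UNIV. \<Sum>x\<in>A l. f l x)"
    by (rule prod_sum_PiE[symmetric]) (use assms in auto)
  finally show ?thesis .
qed

definition freq_grid :: "nat \<Rightarrow> ('d :: finite) multi_index set" where
  "freq_grid b = {w. \<forall>l. w $ l \<in> {..<b}}"

text \<open>Equidistant mesh starting at \<open>- pi\<close>, so that cells of side
  \<open>2 * pi / b\<close> with these lower corners tile \<open>freq_box\<close> up to its lower
  faces.\<close>

definition angle :: "nat \<Rightarrow> ('d :: finite) multi_index \<Rightarrow> 'd point" where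
  "angle b w = (\<chi> l. - pi + 2 * pi * real (w $ l) / real b)"

text \<open>Cubes of side \<open>b\<close>, numbered by \<open>q\<close> from 0 and open on the left
  because grid indices start at 1.\<close>

definition block :: "nat \<Rightarrow> ('d :: finite) multi_index \<Rightarrow> 'd multi_index set" where
  "block b q = {i. \<forall>l. i $ l \<in> {b * q $ l<..b * q $ l + b}}"

text \<open>Integer-valued, because differences of indices are frequencies.\<close>

definition idx :: "('d :: finite) multi_index \<Rightarrow> 'd freq_index" where
  "idx i = (\<chi> l. int (i $ l))"

lemma finite_freq_grid [simp]: "finite (freq_grid b)"
  unfolding freq_grid_def by (rule card_vec_box(2)) simp

lemma finite_block [simp]: "finite (block b q)"
  and card_block: "card (block b (q :: ('d :: finite) multi_index)) = b ^ CARD('d)"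
  unfolding block_def by (rule card_vec_box(2), simp) (subst card_vec_box(1), auto)

lemma freq_char_prod: "freq_char k \<theta> = (\<Prod>l\<in>UNIV. cis (of_int (k $ l) * \<theta> $ l))"
  by (simp add: freq_char_def cis_sum)

lemma freq_char_add: "freq_char (k + m) \<theta> = freq_char k \<theta> * freq_char m \<theta>"
  by (simp add: freq_char_def cis_mult sum.distrib algebra_simps)

lemma freq_char_cnj: "cnj (freq_char k \<theta>) = freq_char (- k) \<theta>"
  by (simp add: freq_char_def cis_cnj sum_negf)

lemma norm_freq_char [simp]: "cmod (freq_char k \<theta>) = 1"
  by (simp add: freq_char_def)

text \<open>Orthogonality in the frequency variable: it extracts one coefficient of the symbol from
  its values on the mesh. The shift of the mesh by \<open>- pi\<close> only contributes a
  phase.\<close>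

lemma sum_freq_char_angle:
  fixes m :: "('d :: finite) freq_index"
  assumes b: "b > 0" and m: "\<And>l. \<bar>m $ l\<bar> < int b"
  shows "(\<Sum>w\<in>freq_grid b. freq_char m (angle b w)) = (if m = 0 then of_nat (b ^ CARD('d)) else 0)"
proof -
  have "(\<Sum>w\<in>freq_grid b. freq_char m (angle b w)) =
      (\<Prod>l\<in>UNIV. \<Sum>t<b. cis (of_int (m $ l) * (- pi + 2 * pi * real t / real b)))"
    unfolding freq_grid_def freq_char_prod angle_def
    by (subst sum_vec_prod[symmetric]) auto
  also have "\<dots> = (\<Prod>l\<in>UNIV. if m $ l = 0 then of_nat b else 0)"
  proof (intro prod.cong refl, goal_cases)
    case (1 l)
    have "(\<Sum>t<b. cis (of_int (m $ l) * (- pi + 2 * pi * real t / real b))) =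
      cis (- (of_int (m $ l) * pi)) * (\<Sum>t<b. cis (2 * pi * of_int (m $ l) * real t / real b))"
      unfolding sum_distrib_left cis_mult by (intro sum.cong) (auto simp: algebra_simps)
    thus ?case by (simp only: sum_cis_roots[OF b m] split: if_split) auto
  qed
  also have "\<dots> = (if m = 0 then of_nat (b ^ CARD('d)) else 0)"
    by (auto simp: Finite_Cartesian_Product.vec_eq_iff)
  finally show ?thesis .
qed

text \<open>Orthogonality in the space variable. The position of the block contributes only a phase,
  so every run of \<open>b\<close> consecutive indices leads to the same geometric sum.\<close>

lemma sum_freq_char_block:
  fixes q w w' :: "('d :: finite) multi_index"
  assumes b: "b > 0" and w: "w \<in> freq_grid b" "w' \<in> freq_grid b"
  shows "(\<Sum>i\<in>block b q. freq_char (idx i) (angle b w) * cnj (freq_char (idx i) (angle b w'))) =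
     (if w = w' then of_nat (b ^ CARD('d)) else 0)"
proof -
  define m where "m l = int (w $ l) - int (w' $ l)" for l
  have m: "\<bar>m l\<bar> < int b" for l
  proof -
    have "w $ l < b" "w' $ l < b" using w by (auto simp: freq_grid_def)
    thus ?thesis by (simp add: m_def)
  qed
  have e: "freq_char (idx i) (angle b w) * cnj (freq_char (idx i) (angle b w')) =
      (\<Prod>l\<in>UNIV. cis (2 * pi * of_int (m l) * real (i $ l) / real b))" for i
    unfolding freq_char_prod cnj_prod prod.distrib[symmetric] cis_cnj[symmetric] cis_mult
    by (intro prod.cong) (auto simp: idx_def angle_def m_def cis_cnj cis_mult field_simps diff_divide_distrib add_divide_distrib)
  have "(\<Sum>i\<in>block b q. freq_char (idx i) (angle b w) * cnj (freq_char (idx i) (angle b w'))) =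
     (\<Prod>l\<in>UNIV. \<Sum>t\<in>{b * q $ l<..b * q $ l + b}. cis (2 * pi * of_int (m l) * real t / real b))"
    unfolding e block_def by (subst sum_vec_prod[symmetric]) auto
  also have "\<dots> = (\<Prod>l\<in>UNIV. if m l = 0 then of_nat b else 0)"
  proof (intro prod.cong refl, goal_cases)
    case (1 l)
    have bij: "bij_betw (\<lambda>t. b * q $ l + 1 + t) {..<b} {b * q $ l<..b * q $ l + b}"
      by (rule bij_betw_byWitness[of _ "\<lambda>t. t - (b * q $ l + 1)"]) auto
    have "(\<Sum>t\<in>{b * q $ l<..b * q $ l + b}. cis (2 * pi * of_int (m l) * real t / real b)) =
       (\<Sum>t<b. cis (2 * pi * of_int (m l) * real (b * q $ l + 1 + t) / real b))"
      by (rule sum.reindex_bij_betw[OF bij, symmetric])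
    also have "\<dots> = cis (2 * pi * of_int (m l) * real (b * q $ l + 1) / real b) * (\<Sum>t<b. cis (2 * pi * of_int (m l) * real t / real b))"
      unfolding sum_distrib_left cis_mult by (intro sum.cong) (auto simp: algebra_simps add_divide_distrib)
    also have "\<dots> = (if m l = 0 then of_nat b else 0)" using sum_cis_roots[OF b m] by auto
    finally show ?case .
  qed
  also have "\<dots> = (if w = w' then of_nat (b ^ CARD('d)) else 0)"
    by (auto simp: Finite_Cartesian_Product.vec_eq_iff m_def)
  finally show ?thesis .
qed

lemma block_disjoint:
  assumes "i \<in> block b q" "i \<in> block b q'"
  shows "q = q'"
proof -
  have "q $ l = q' $ l" for l
  proof (rule ccontr)
    assume "q $ l \<noteq> q' $ l"
    then consider "q $ l + 1 \<le> q' $ l" | "q' $ l + 1 \<le> q $ l" by linarith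
    thus False
    proof cases
      case 1
      from mult_left_mono[OF this, of b] show False using assms by (auto simp: block_def dest!: spec[of _ l])
    next
      case 2
      from mult_left_mono[OF this, of b] show False using assms by (auto simp: block_def dest!: spec[of _ l])
    qed
  qed
  thus ?thesis by (simp add: Finite_Cartesian_Product.vec_eq_iff)
qed

lemma block_exists:
  assumes "b > 0" "i \<in> grid n"
  shows "i \<in> block b (\<chi> l. (i $ l - 1) div b)"
proof -
  have "b * ((i $ l - 1) div b) < i $ l \<and> i $ l \<le> b * ((i $ l - 1) div b) + b" for l
  proof -
    have "i $ l \<ge> 1" using assms by (auto simp: grid_def)
    moreover have "b * ((i $ l - 1) div b) + (i $ l - 1) mod b = i $ l - 1" by (rule mult_div_mod_eq)
    moreover have "(i $ l - 1) mod b < b" using assms by simp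
    ultimately show ?thesis by linarith
  qed
  thus ?thesis by (simp add: block_def)
qed

lemma block_near:
  assumes "i \<in> block b q" "j \<in> block b q"
  shows "near b i j"
  unfolding near_def
proof
  fix l
  have "b * q $ l < i $ l" "i $ l \<le> b * q $ l + b" "b * q $ l < j $ l" "j $ l \<le> b * q $ l + b"
    using assms by (auto simp: block_def)
  thus "i $ l \<le> j $ l + b \<and> j $ l \<le> i $ l + b" by linarith
qed

section \<open>The block diagonal model of a banded kernel\<close>

text \<open>A symbol sorted by frequency: \<open>h x k\<close> is the coefficient of the character
  \<open>k\<close>, and the finite set \<open>K\<close> is the band. In this form the difference of
  two symbols has the same shape.\<close>

definition grid_symbol :: "'d freq_index set \<Rightarrow> ('d point \<Rightarrow> 'd freq_index \<Rightarrow> complex) \<Rightarrow> ('d :: finite) point \<times> 'd point \<Rightarrow> complex" where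
  "grid_symbol K h z = (\<Sum>k\<in>K. h (fst z) k * freq_char k (snd z))"

definition sample_pt :: "('d :: finite) multi_index \<Rightarrow> 'd multi_index \<Rightarrow> 'd point" where
  "sample_pt n i = (\<chi> l. real (i $ l) / real (n $ l))"

text \<open>The coefficients are sampled at the row index, as in
  \<open>D_n(a) T_n(f)\<close>.\<close>

definition band_kernel ::
    "('d :: finite) multi_index \<Rightarrow> 'd freq_index set \<Rightarrow> ('d point \<Rightarrow> 'd freq_index \<Rightarrow> complex) \<Rightarrow> 'd multi_index \<Rightarrow> 'd multi_index \<Rightarrow> complex" where
  "band_kernel n K h i j = (if idx i - idx j \<in> K then h (sample_pt n i) (idx i - idx j) else 0)"

text \<open>The grid is cut into cubes of the fixed side \<open>b\<close>. On each cube lying entirely in the domain the Fourier modes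
  are approximate eigenvectors of a banded kernel, with eigenvalue the symbol frozen at the corner of the cube;
  \<open>model\<close> is the kernel for which they are exact. It vanishes on the remaining grid points.\<close>

locale block_model =
  fixes n :: "('d :: {finite, linorder}) multi_index" and \<Omega> :: "'d point set" and b :: nat
    and K :: "'d freq_index set" and h :: "'d point \<Rightarrow> 'd freq_index \<Rightarrow> complex"
  assumes b: "b > 0" and K: "finite K" and n0: "\<And>l. n $ l > 0"
begin

definition "full = {q. block b q \<subseteq> grid_in \<Omega> n}"

definition "modes = full \<times> (freq_grid b :: 'd multi_index set)"

text \<open>The lower corner of the block, where the coefficients are frozen. It is not a sampling
  point if \<open>q\<close> has a zero component, but for a full block it lies in the cube.\<close>

definition base :: "'d multi_index \<Rightarrow> 'd point" where
  "base q = (\<chi> l. real (b * q $ l) / real (n $ l))"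

definition lam :: "'d multi_index \<times> 'd multi_index \<Rightarrow> complex" where
  "lam p = grid_symbol K h (base (fst p), angle b (snd p))"

text \<open>The Euclidean norm of a character on a block.\<close>

definition amp :: complex where
  "amp = of_real (sqrt (real (b ^ CARD('d))))"

lemma amp_mult: "amp * amp = of_nat b ^ CARD('d)"
proof -
  have "sqrt (real (b ^ CARD('d))) * sqrt (real (b ^ CARD('d))) = real (b ^ CARD('d))" by simp
  hence "amp * amp = complex_of_real (real (b ^ CARD('d)))" unfolding amp_def of_real_mult[symmetric] by (simp only:)
  thus ?thesis by simp
qed

lemma cnj_amp: "cnj amp = amp"
  by (simp add: amp_def)

text \<open>The conjugate is there because a shift by \<open>k\<close> has the eigenvalue \<open>freq_char k \<theta>\<close> on the conjugate character.\<close>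

definition wave :: "'d multi_index \<times> 'd multi_index \<Rightarrow> 'd multi_index \<Rightarrow> complex" where
  "wave p i = (if i \<in> block b (fst p) then cnj (freq_char (idx i) (angle b (snd p))) / amp else 0)"

definition model :: "'d multi_index \<Rightarrow> 'd multi_index \<Rightarrow> complex" where
  "model i j = (\<Sum>p\<in>modes. lam p * wave p i * cnj (wave p j))"

text \<open>A full block contains its lowest point, from which \<open>q\<close> can be
  recovered.\<close>

lemma finite_full [simp]: "finite full"
proof -
  have "full \<subseteq> (\<lambda>i. \<chi> l. (i $ l - 1) div b) ` grid_in \<Omega> n"
  proof
    fix q assume q: "q \<in> full"
    define i where "i = (\<chi> l. b * q $ l + 1)"
    have i: "i \<in> block b q" using b by (auto simp: i_def block_def)
    hence "i \<in> grid_in \<Omega> n" using q by (auto simp: full_def)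
    moreover have "q = (\<chi> l. (i $ l - 1) div b)"
      using b by (simp add: i_def Finite_Cartesian_Product.vec_eq_iff)
    ultimately show "q \<in> (\<lambda>i. \<chi> l. (i $ l - 1) div b) ` grid_in \<Omega> n" by blast
  qed
  thus ?thesis by (rule finite_subset) simp
qed

lemma finite_modes [simp]: "finite modes"
  by (simp add: modes_def)

lemma card_full_le: "card full * b ^ CARD('d) \<le> grid_size n"
proof -
  have "card (\<Union>q\<in>full. block b q) = (\<Sum>q\<in>full. card (block b q))"
    by (rule card_UN_disjoint) (auto dest: block_disjoint)
  also have "\<dots> = card full * b ^ CARD('d)" by (simp add: card_block)
  finally have "card full * b ^ CARD('d) = card (\<Union>q\<in>full. block b q)" ..
  also have "\<dots> \<le> card (grid n)"
    by (rule card_mono) (use grid_in_subset in \<open>auto simp: full_def\<close>)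
  finally show ?thesis by (simp add: card_grid)
qed

text \<open>Modes on different blocks have disjoint supports; on one block this is the orthogonality
  of the characters.\<close>

lemma modes_orthonormal: "orthonormal (grid_in \<Omega> n) modes wave"
  unfolding orthonormal_def
proof (intro conjI ballI)
  fix p p' assume p: "p \<in> modes" "p' \<in> modes"
  obtain q w q' w' where pq: "p = (q,w)" "p' = (q',w')" by (cases p, cases p')
  have q: "q \<in> full" "q' \<in> full" and w: "w \<in> freq_grid b" "w' \<in> freq_grid b" using p by (auto simp: pq modes_def)
  show "inner_on (grid_in \<Omega> n) (wave p) (wave p') = (if p = p' then 1 else 0)"
  proof (cases "q = q'")
    case False
    hence "cnj (wave p i) * wave p' i = 0" for i using block_disjoint by (auto simp: wave_def pq)
    thus ?thesis using False by (simp add: inner_on_def pq)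
  next
    case True
    have "inner_on (grid_in \<Omega> n) (wave p) (wave p') = (\<Sum>i\<in>block b q. cnj (wave p i) * wave p' i)"
      unfolding inner_on_def using q by (intro sum.mono_neutral_right) (auto simp: full_def wave_def pq)
    also have "\<dots> = (\<Sum>i\<in>block b q. freq_char (idx i) (angle b w) * cnj (freq_char (idx i) (angle b w')) / of_nat (b ^ CARD('d)))"
      using True by (intro sum.cong) (simp_all add: wave_def pq amp_mult cnj_amp)
    also have "\<dots> = (if w = w' then of_nat (b ^ CARD('d)) else 0) / of_nat (b ^ CARD('d))"
      unfolding sum_divide_distrib[symmetric] sum_freq_char_block[OF b w] ..
    also have "\<dots> = (if p = p' then 1 else 0)" using True b by (simp add: pq)
    finally show ?thesis .
  qed
qed auto

text \<open>Only the block containing \<open>i\<close> contributes. On it the model is circulant up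
  to signs: the sum over \<open>w\<close> vanishes unless all components of
  \<open>k - (idx i - idx j)\<close> are multiples of \<open>b\<close>.\<close>

lemma model_row:
  assumes i: "i \<in> block b q" "q \<in> full"
  shows "model i j = (if j \<in> block b q then
    (\<Sum>k\<in>K. h (base q) k * (\<Sum>w\<in>freq_grid b. freq_char (k - (idx i - idx j)) (angle b w))) / of_nat (b ^ CARD('d)) else 0)"
proof -
  have "model i j = (\<Sum>q'\<in>full. \<Sum>w\<in>freq_grid b. lam (q',w) * wave (q',w) i * cnj (wave (q',w) j))"
    unfolding model_def modes_def by (simp add: sum.cartesian_product)
  also have "\<dots> = (\<Sum>q'\<in>full. if q' = q then \<Sum>w\<in>freq_grid b. lam (q,w) * wave (q,w) i * cnj (wave (q,w) j) else 0)"
  proof (intro sum.cong refl)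
    fix q'
    have "wave (q',w) i = 0" if "q' \<noteq> q" for w
      using block_disjoint[OF i(1), of q'] that by (auto simp: wave_def)
    thus "(\<Sum>w\<in>freq_grid b. lam (q',w) * wave (q',w) i * cnj (wave (q',w) j)) =
      (if q' = q then \<Sum>w\<in>freq_grid b. lam (q,w) * wave (q,w) i * cnj (wave (q,w) j) else 0)" by simp
  qed
  also have "\<dots> = (\<Sum>w\<in>freq_grid b. lam (q,w) * wave (q,w) i * cnj (wave (q,w) j))"
    using i(2) by simp
  also have "\<dots> = (if j \<in> block b q then
    (\<Sum>k\<in>K. h (base q) k * (\<Sum>w\<in>freq_grid b. freq_char (k - (idx i - idx j)) (angle b w))) / of_nat (b ^ CARD('d)) else 0)"
  proof (cases "j \<in> block b q")
    case True
    have "lam (q,w) * wave (q,w) i * cnj (wave (q,w) j) =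
        (\<Sum>k\<in>K. h (base q) k * freq_char (k - (idx i - idx j)) (angle b w)) / of_nat (b ^ CARD('d))" for w
    proof -
      have "freq_char (k - (idx i - idx j)) \<theta> = freq_char k \<theta> * cnj (freq_char (idx i) \<theta>) * freq_char (idx j) \<theta>" for k \<theta>
      proof -
        have "k - (idx i - idx j) = k + (- idx i) + idx j" by simp
        thus ?thesis by (simp only: freq_char_add freq_char_cnj)
      qed
      thus ?thesis using True i
        by (simp add: lam_def grid_symbol_def wave_def sum_divide_distrib sum_distrib_left amp_mult[symmetric] cnj_amp mult_ac)
    qed
    thus ?thesis using True
      by (simp add: sum_divide_distrib[symmetric]) (simp add: sum_distrib_left sum.swap[of _ K])
  qed (simp add: wave_def)
  finally show ?thesis .
qed

text \<open>Up to conjugation a row is a combination of the modes with coefficients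
  \<open>lam p * wave p i\<close>, and the squared moduli of \<open>wave p i\<close> sum to at most
  1 by Bessel's inequality for the unit vector at \<open>i\<close>.\<close>

lemma model_row_bound:
  assumes C: "\<And>p. p \<in> modes \<Longrightarrow> cmod (lam p) \<le> C" "0 \<le> C" and i: "i \<in> grid_in \<Omega> n"
  shows "(\<Sum>j\<in>grid_in \<Omega> n. (cmod (model i j))\<^sup>2) \<le> C\<^sup>2"
proof -
  have "(\<Sum>j\<in>grid_in \<Omega> n. (cmod (model i j))\<^sup>2) = norm_sq (grid_in \<Omega> n) (\<lambda>j. \<Sum>p\<in>modes. cnj (lam p * wave p i) * wave p j)"
    unfolding norm_sq_def
  proof (intro sum.cong refl)
    fix j
    have "(\<Sum>p\<in>modes. cnj (lam p * wave p i) * wave p j) = cnj (model i j)" by (simp add: model_def)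
    thus "(cmod (model i j))\<^sup>2 = (cmod (\<Sum>p\<in>modes. cnj (lam p * wave p i) * wave p j))\<^sup>2" by simp
  qed
  also have "\<dots> = (\<Sum>p\<in>modes. (cmod (lam p))\<^sup>2 * (cmod (wave p i))\<^sup>2)"
    unfolding norm_sq_orthonormal_sum[OF modes_orthonormal] by (simp add: norm_mult power_mult_distrib)
  also have "\<dots> \<le> (\<Sum>p\<in>modes. C\<^sup>2 * (cmod (wave p i))\<^sup>2)"
    using C by (intro sum_mono mult_right_mono power_mono) auto
  also have "\<dots> = C\<^sup>2 * (\<Sum>p\<in>modes. (cmod (inner_on (grid_in \<Omega> n) (wave p) (\<lambda>j. if j = i then 1 else 0)))\<^sup>2)"
    using i by (simp add: inner_on_def sum_distrib_left if_distrib[of "\<lambda>x. _ * x"] cong: if_cong)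
  also have "\<dots> \<le> C\<^sup>2 * norm_sq (grid_in \<Omega> n) (\<lambda>j. if j = i then 1 else 0)"
    by (intro mult_left_mono bessel[OF modes_orthonormal]) auto
  also have "norm_sq (grid_in \<Omega> n) (\<lambda>j. if j = i then 1 else 0) = 1"
    using i by (simp add: norm_sq_def if_distrib[of cmod] if_distrib[of "\<lambda>x. x ^ _"] cong: if_cong)
  finally show ?thesis by simp
qed

lemma idx_inj: "inj idx"
  by (rule injI) (simp add: idx_def Finite_Cartesian_Product.vec_eq_iff)

text \<open>Distinct \<open>j\<close> give distinct differences, so at most \<open>card K\<close>
  terms of a row are nonzero.\<close>

lemma band_row_sum:
  assumes f: "\<And>j. idx i - idx j \<notin> K \<Longrightarrow> f j = 0" and bd: "\<And>j. j \<in> T \<Longrightarrow> idx i - idx j \<in> K \<Longrightarrow> f j \<le> (B :: real)"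
    and B: "B \<ge> 0" and T: "finite T"
  shows "(\<Sum>j\<in>T. f j) \<le> real (card K) * B"
proof -
  have "(\<Sum>j\<in>T. f j) = (\<Sum>j\<in>{j\<in>T. idx i - idx j \<in> K}. f j)"
    using T f by (intro sum.mono_neutral_right) auto
  also have "\<dots> \<le> of_nat (card {j\<in>T. idx i - idx j \<in> K}) * B"
    by (rule sum_bounded_above) (use bd in auto)
  also have "card {j\<in>T. idx i - idx j \<in> K} \<le> card K"
    by (rule card_inj_on_le[of "\<lambda>j. idx i - idx j"]) (use K idx_inj in \<open>auto simp: inj_on_def inj_def\<close>)
  finally show ?thesis using B by (simp add: mult_right_mono)
qed

text \<open>For \<open>2 * k \<le> b\<close>: the points whose translates by at most
  \<open>k\<close> in each coordinate stay inside the block. There a kernel of bandwidth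
  \<open>k\<close> does not notice the boundary of the block.\<close>

definition deep :: "nat \<Rightarrow> 'd multi_index \<Rightarrow> 'd multi_index set" where
  "deep k q = {i. \<forall>l. i $ l \<in> {b * q $ l + k<..b * q $ l + b - k}}"

text \<open>On a deep row no frequency wraps around, so the model has exactly the entries of the
  band with \<open>h\<close> taken at the corner of the block instead of the sample point. Each of
  the at most \<open>card K\<close> entries is off by the oscillation \<open>\<eta>\<close> of
  \<open>h\<close>.\<close>

lemma deep_row:
  assumes kb: "2 * k \<le> b" and k: "\<And>\<kappa> l. \<kappa> \<in> K \<Longrightarrow> \<bar>\<kappa> $ l\<bar> \<le> int k"
    and \<eta>: "\<And>x y \<kappa>. x \<in> cbox 0 1 \<Longrightarrow> y \<in> cbox 0 1 \<Longrightarrow> \<kappa> \<in> K \<Longrightarrow> (\<And>l. \<bar>x $ l - y $ l\<bar> \<le> real b / real (n $ l))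
        \<Longrightarrow> cmod (h x \<kappa> - h y \<kappa>) \<le> \<eta>" "0 \<le> \<eta>"
    and q: "q \<in> full" and i: "i \<in> deep k q"
  shows "(\<Sum>j\<in>grid_in \<Omega> n. (cmod (band_kernel n K h i j - model i j))\<^sup>2) \<le> real (card K) * \<eta>\<^sup>2"
proof -
  have ib: "i \<in> block b q"
    unfolding block_def
  proof safe
    fix l
    have "b * q $ l + k < i $ l" "i $ l \<le> b * q $ l + b - k" using i by (auto simp: deep_def)
    thus "i $ l \<in> {b * q $ l<..b * q $ l + b}" by auto
  qed
  have jb: "j \<in> block b q" if "idx i - idx j \<in> K" for j
    unfolding block_def
  proof safe
    fix l
    have "b * q $ l + k < i $ l" "i $ l \<le> b * q $ l + b - k" using i by (auto simp: deep_def)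
    moreover have "\<bar>int (i $ l) - int (j $ l)\<bar> \<le> int k" using k[OF that, of l] by (simp add: idx_def)
    ultimately show "j $ l \<in> {b * q $ l<..b * q $ l + b}" using kb by auto
  qed
  have M: "model i j = (if idx i - idx j \<in> K then h (base q) (idx i - idx j) else 0)" for j
  proof (cases "j \<in> block b q")
    case False
    thus ?thesis using jb model_row[OF ib q, of j] by auto
  next
    case True
    \<comment> \<open>For deep \<open>i\<close> and \<open>j\<close> in the block the components of
      \<open>idx i - idx j\<close> have modulus below \<open>b - k\<close>. Subtracted from
      \<open>\<kappa>\<close> they stay below \<open>b\<close>, so only
      \<open>\<kappa> = idx i - idx j\<close> survives.\<close>
    have s: "(\<Sum>w\<in>freq_grid b. freq_char (\<kappa> - (idx i - idx j)) (angle b w)) = (if \<kappa> = idx i - idx j then of_nat (b ^ CARD('d)) else 0)"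
      if "\<kappa> \<in> K" for \<kappa>
    proof (subst sum_freq_char_angle[OF b])
      fix l
      have "b * q $ l + k < i $ l" "i $ l \<le> b * q $ l + b - k" using i by (auto simp: deep_def)
      moreover have "b * q $ l < j $ l" "j $ l \<le> b * q $ l + b" using True by (auto simp: block_def)
      moreover have "\<bar>\<kappa> $ l\<bar> \<le> int k" using k[OF that] .
      ultimately show "\<bar>(\<kappa> - (idx i - idx j)) $ l\<bar> < int b" using kb by (simp add: idx_def)
    qed auto
    have "(\<Sum>\<kappa>\<in>K. h (base q) \<kappa> * (\<Sum>w\<in>freq_grid b. freq_char (\<kappa> - (idx i - idx j)) (angle b w))) =
       (\<Sum>\<kappa>\<in>K. if \<kappa> = idx i - idx j then h (base q) (idx i - idx j) * of_nat (b ^ CARD('d)) else 0)"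
      by (intro sum.cong refl) (simp add: s)
    thus ?thesis using model_row[OF ib q, of j] True K b by simp
  qed
  have gr: "i \<in> grid n" using ib q grid_in_subset by (auto simp: full_def)
  have x1: "sample_pt n i \<in> cbox 0 1"
    using gr n0 by (auto simp: sample_pt_def mem_box_cart grid_def)
  have bq: "b * q $ l \<le> i $ l" "i $ l \<le> b * q $ l + b" for l using ib by (auto simp: block_def less_imp_le)
  have bn: "b * q $ l \<le> n $ l" for l using bq(1)[of l] gr by (auto simp: grid_def intro: order_trans)
  have x2: "base q \<in> cbox 0 1"
    using bn n0 by (auto simp: base_def mem_box_cart of_nat_mult[symmetric] simp del: of_nat_mult)
  have x3: "\<bar>sample_pt n i $ l - base q $ l\<bar> \<le> real b / real (n $ l)" for l
  proof -
    have "\<bar>real (i $ l) - real (b * q $ l)\<bar> \<le> real b" using bq[of l] by linarith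
    hence "\<bar>real (i $ l) - real (b * q $ l)\<bar> / real (n $ l) \<le> real b / real (n $ l)" by (intro divide_right_mono) auto
    thus ?thesis by (simp add: sample_pt_def base_def diff_divide_distrib[symmetric])
  qed
  show ?thesis
  proof (rule band_row_sum)
    fix j assume "idx i - idx j \<notin> K"
    thus "(cmod (band_kernel n K h i j - model i j))\<^sup>2 = 0" by (simp add: band_kernel_def M)
  next
    fix j assume "idx i - idx j \<in> K"
    thus "(cmod (band_kernel n K h i j - model i j))\<^sup>2 \<le> \<eta>\<^sup>2"
      using \<eta>(1)[OF x1 x2 _ x3] by (auto simp: band_kernel_def M intro!: power_mono)
  qed auto
qed

text \<open>A tame index of the domain lies in a full block, and if it is deep its row error is at
  most \<open>card K * \<eta>^2\<close>. The other rows are merely bounded, but few: they are wild,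
  a fraction of at most \<open>\<beta>\<close>, or close to a face of a full block, a fraction of at
  most \<open>1 - (1 - 2 * k / b) ^ d\<close> with \<open>d\<close> the dimension.\<close>

lemma frobenius_bound:
  assumes kb: "2 * k \<le> b" and k: "\<And>\<kappa> l. \<kappa> \<in> K \<Longrightarrow> \<bar>\<kappa> $ l\<bar> \<le> int k"
    and \<eta>: "\<And>x y \<kappa>. x \<in> cbox 0 1 \<Longrightarrow> y \<in> cbox 0 1 \<Longrightarrow> \<kappa> \<in> K \<Longrightarrow> (\<And>l. \<bar>x $ l - y $ l\<bar> \<le> real b / real (n $ l))
        \<Longrightarrow> cmod (h x \<kappa> - h y \<kappa>) \<le> \<eta>" "0 \<le> \<eta>"
    and C: "\<And>x \<kappa>. x \<in> cbox 0 1 \<Longrightarrow> \<kappa> \<in> K \<Longrightarrow> cmod (h x \<kappa>) \<le> C" "0 \<le> C"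
    and W: "real (card {i \<in> grid n. \<not> tame \<Omega> n b i}) \<le> \<beta> * real (grid_size n)"
  shows "(\<Sum>i\<in>grid_in \<Omega> n. \<Sum>j\<in>grid_in \<Omega> n. (cmod (band_kernel n K h i j - model i j))\<^sup>2) \<le>
     real (grid_size n) * (real (card K) * \<eta>\<^sup>2 +
       2 * (real (card K) * C\<^sup>2 + (real (card K) * C)\<^sup>2) * (\<beta> + (1 - (1 - 2 * real k / real b) ^ CARD('d))))"
proof -
  define S where "S = grid_in \<Omega> n"
  define row where "row i = (\<Sum>j\<in>S. (cmod (band_kernel n K h i j - model i j))\<^sup>2)" for i
  \<comment> \<open>Bounds any row: twice the squared row norm of the banded kernel plus twice that
    of the model, whose eigenvalues have modulus at most \<open>card K * C\<close>.\<close>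
  define C1 where "C1 = 2 * (real (card K) * C\<^sup>2 + (real (card K) * C)\<^sup>2)"
  define N where "N = real (grid_size n)"
  have C1: "C1 \<ge> 0" by (simp add: C1_def)
  have fullgrid: "base q \<in> cbox 0 1" if "q \<in> full" for q
  proof -
    define i where "i = (\<chi> l. b * q $ l + 1)"
    have "i \<in> block b q" using b by (auto simp: i_def block_def)
    hence "i \<in> grid n" using that grid_in_subset by (auto simp: full_def)
    hence bn: "b * q $ l \<le> n $ l" for l by (auto simp: grid_def i_def dest!: spec[of _ l])
    show ?thesis using bn n0 by (auto simp: base_def mem_box_cart of_nat_mult[symmetric] simp del: of_nat_mult)
  qed
  have lamC: "cmod (lam p) \<le> real (card K) * C" if "p \<in> modes" for p
  proof -
    have "cmod (lam p) \<le> (\<Sum>\<kappa>\<in>K. cmod (h (base (fst p)) \<kappa> * freq_char \<kappa> (angle b (snd p))))"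
      unfolding lam_def grid_symbol_def by (auto intro: norm_sum)
    also have "\<dots> \<le> (\<Sum>\<kappa>\<in>K. C)"
      using that fullgrid C(1) by (intro sum_mono) (auto simp: norm_mult modes_def)
    finally show ?thesis by simp
  qed
  have rowC1: "row i \<le> C1" if i: "i \<in> S" for i
  proof -
    have x1: "sample_pt n i \<in> cbox 0 1"
      using i grid_in_subset n0 by (force simp: sample_pt_def mem_box_cart grid_def S_def)
    have "row i \<le> (\<Sum>j\<in>S. 2 * (cmod (band_kernel n K h i j))\<^sup>2 + 2 * (cmod (model i j))\<^sup>2)"
      unfolding row_def
    proof (intro sum_mono)
      fix j
      have "(cmod (band_kernel n K h i j - model i j))\<^sup>2 \<le> (cmod (band_kernel n K h i j) + cmod (model i j))\<^sup>2"
        by (intro power_mono norm_triangle_ineq4) auto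
      also have "\<dots> \<le> 2 * (cmod (band_kernel n K h i j))\<^sup>2 + 2 * (cmod (model i j))\<^sup>2"
        using sum_squares_bound[of "cmod (band_kernel n K h i j)" "cmod (model i j)"] by (simp add: power2_sum)
      finally show "(cmod (band_kernel n K h i j - model i j))\<^sup>2 \<le> 2 * (cmod (band_kernel n K h i j))\<^sup>2 + 2 * (cmod (model i j))\<^sup>2" .
    qed
    also have "\<dots> = 2 * (\<Sum>j\<in>S. (cmod (band_kernel n K h i j))\<^sup>2) + 2 * (\<Sum>j\<in>S. (cmod (model i j))\<^sup>2)"
      by (simp add: sum.distrib sum_distrib_left)
    also have "\<dots> \<le> 2 * (real (card K) * C\<^sup>2) + 2 * (real (card K) * C)\<^sup>2"
    proof (intro add_mono mult_left_mono)
      show "(\<Sum>j\<in>S. (cmod (band_kernel n K h i j))\<^sup>2) \<le> real (card K) * C\<^sup>2"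
        by (rule band_row_sum) (use C x1 in \<open>auto simp: band_kernel_def S_def intro!: power_mono\<close>)
      show "(\<Sum>j\<in>S. (cmod (model i j))\<^sup>2) \<le> (real (card K) * C)\<^sup>2"
        unfolding S_def by (rule model_row_bound) (use lamC C i in \<open>auto simp: S_def\<close>)
    qed auto
    finally show ?thesis by (simp add: C1_def)
  qed
  define wild where "wild = {i \<in> grid n. \<not> tame \<Omega> n b i}"
  define shallow where "shallow = (\<Union>q\<in>full. block b q - deep k q)"
  define E where "E = S \<inter> (wild \<union> shallow)"
  have fE: "finite E" by (simp add: E_def S_def)
  have rowE: "row i \<le> real (card K) * \<eta>\<^sup>2" if i: "i \<in> S" "i \<notin> E" for i
  proof -
    define q where "q = (\<chi> l. (i $ l - 1) div b)"
    have ig: "i \<in> grid n" using i grid_in_subset by (auto simp: S_def)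
    have ib: "i \<in> block b q" unfolding q_def by (rule block_exists[OF b ig])
    have "tame \<Omega> n b i" using i ig by (auto simp: E_def wild_def)
    moreover have "near b i i" by (simp add: near_def)
    ultimately have nr: "j \<in> grid_in \<Omega> n" if "near b i j" for j
      using i(1) that unfolding tame_def S_def by blast
    \<comment> \<open>Everything near a tame index of the domain belongs to the domain, hence so
      does its whole block.\<close>
    have "q \<in> full" unfolding full_def using block_near[OF ib] nr by blast
    moreover have "i \<in> deep k q" using i ib \<open>q \<in> full\<close> by (auto simp: E_def shallow_def)
    ultimately show ?thesis unfolding row_def S_def using deep_row[OF kb k \<eta>] by blast
  qed
  have card_shallow: "real (card shallow) \<le> N * (1 - (1 - 2 * real k / real b) ^ CARD('d))"
  proof -
    have "card (block b q - deep k q) = b ^ CARD('d) - (b - 2 * k) ^ CARD('d)" for q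
    proof -
      have "card (deep k q) = (\<Prod>l\<in>(UNIV :: 'd set). b - 2 * k)"
        unfolding deep_def by (subst card_vec_box(1)) (auto intro!: prod.cong simp: mult_2)
      moreover have "deep k q \<subseteq> block b q" 
      proof
        fix i assume i: "i \<in> deep k q"
        show "i \<in> block b q" unfolding block_def
        proof safe
          fix l
          have "b * q $ l + k < i $ l" "i $ l \<le> b * q $ l + b - k" using i by (auto simp: deep_def)
          thus "i $ l \<in> {b * q $ l<..b * q $ l + b}" by auto
        qed
      qed
      ultimately show ?thesis by (subst card_Diff_subset) (auto simp: card_block intro: finite_subset[OF _ finite_block])
    qed
    hence "card shallow \<le> card full * (b ^ CARD('d) - (b - 2 * k) ^ CARD('d))"
      unfolding shallow_def using card_UN_le[OF finite_full, of "\<lambda>q. block b q - deep k q"] by simp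
    hence "real (card shallow) \<le> real (card full * (b ^ CARD('d) - (b - 2 * k) ^ CARD('d)))" by (simp only: of_nat_le_iff)
    also have "\<dots> = real (card full) * (real b ^ CARD('d) - (real b - 2 * real k) ^ CARD('d))"
      using kb by (simp add: of_nat_diff power_mono)
    also have "\<dots> = real (card full * b ^ CARD('d)) * (1 - (1 - 2 * real k / real b) ^ CARD('d))"
    proof -
      have "(real b - 2 * real k) ^ CARD('d) = real b ^ CARD('d) * (1 - 2 * real k / real b) ^ CARD('d)"
        unfolding power_mult_distrib[symmetric] using b by (simp add: right_diff_distrib)
      thus ?thesis by (simp add: algebra_simps)
    qed
    also have "\<dots> \<le> N * (1 - (1 - 2 * real k / real b) ^ CARD('d))"
    proof (rule mult_right_mono)
      show "real (card full * b ^ CARD('d)) \<le> N" unfolding N_def using card_full_le by (simp only: of_nat_le_iff)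
      have "2 * real k / real b \<le> 1" using kb b by (simp add: divide_le_eq_1)
      thus "0 \<le> 1 - (1 - 2 * real k / real b) ^ CARD('d)" using b by (simp add: power_le_one)
    qed
    finally show ?thesis .
  qed
  have cardE: "real (card E) \<le> N * (\<beta> + (1 - (1 - 2 * real k / real b) ^ CARD('d)))"
  proof -
    have "card E \<le> card (wild \<union> shallow)" unfolding E_def
      by (intro card_mono) (auto simp: wild_def shallow_def)
    also have "\<dots> \<le> card wild + card shallow" by (rule card_Un_le)
    finally show ?thesis using W card_shallow unfolding wild_def N_def by (simp add: algebra_simps)
  qed
  have "(\<Sum>i\<in>S. row i) = (\<Sum>i\<in>S - E. row i) + (\<Sum>i\<in>E. row i)"
    by (rule sum.subset_diff) (auto simp: E_def S_def)
  also have "\<dots> \<le> real (card (S - E)) * (real (card K) * \<eta>\<^sup>2) + real (card E) * C1"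
    using rowE rowC1 by (intro add_mono sum_bounded_above) (auto simp: E_def)
  also have "\<dots> \<le> N * (real (card K) * \<eta>\<^sup>2) + (N * (\<beta> + (1 - (1 - 2 * real k / real b) ^ CARD('d)))) * C1"
  proof (intro add_mono mult_right_mono cardE C1)
    have "card (S - E) \<le> card (grid n)" using grid_in_subset by (intro card_mono) (auto simp: S_def)
    thus "real (card (S - E)) \<le> N" by (simp add: N_def card_grid)
  qed auto
  finally show ?thesis unfolding row_def S_def[symmetric] N_def C1_def by (simp add: algebra_simps)
qed

end

section \<open>Counting eigenvalues of the model by volume\<close>

text \<open>The counterpart of \<open>acs_size\<close> for a function: values of the modulus replace
  singular values, and normalised volume replaces the count. \<open>d_mea\<close> is its value at a
  difference.\<close>

definition mea_size :: "('d :: finite) point set \<Rightarrow> ('d point \<times> 'd point \<Rightarrow> complex) \<Rightarrow> real" where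
  "mea_size \<Omega> g = (INF L\<in>{0..}. measure lebesgue {z \<in> \<Omega> \<times> freq_box. cmod (g z) > L} /
       (measure lebesgue \<Omega> * (2 * pi) ^ CARD('d)) + L)"

lemma null_sets_Times_right:
  fixes A :: "'a :: euclidean_space set" and B :: "'b :: euclidean_space set"
  assumes "B \<in> null_sets lebesgue"
  shows "A \<times> B \<in> null_sets lebesgue"
proof -
  obtain N where N: "N \<in> null_sets lborel" "B \<subseteq> N" using assms by (auto elim: completion.complete2 simp: null_sets_completion_iff2)
  have "emeasure lborel ((UNIV :: 'a set) \<times> N) = 0"
    using N(1) by (subst emeasure_Times_lborel) (auto simp: null_sets_def)
  moreover have "(UNIV :: 'a set) \<times> N \<in> sets borel" using N(1) by (simp add: borel_prod[symmetric] null_sets_def)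
  ultimately have "(UNIV :: 'a set) \<times> N \<in> null_sets lborel" by (auto simp: null_sets_def)
  moreover have "A \<times> B \<subseteq> UNIV \<times> N" using N by auto
  ultimately show ?thesis using null_sets_completion_subset null_sets_completionI by blast
qed

lemma cbox_minus_hbox_null: "cbox a b - hbox a b \<in> null_sets lebesgue"
proof -
  have "cbox a b - box a b \<in> null_sets lebesgue"
    using negligible_frontier_interval[of a b] by (simp add: negligible_iff_null_sets)
  thus ?thesis by (rule null_sets_completion_subset[rotated]) (auto simp: hbox_def mem_box_cart less_imp_le)
qed

lemma super_level_lmeasurable:
  assumes "E \<in> lmeasurable" "f \<in> borel_measurable (lebesgue_on E)"
  shows "{z \<in> E. cmod (f z) > (L :: real)} \<in> lmeasurable"
proof -
  have "{z \<in> space (lebesgue_on E). L < cmod (f z)} \<in> sets (lebesgue_on E)"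
    by (rule borel_measurable_less) (use assms in auto)
  hence "{z \<in> E. cmod (f z) > L} \<in> sets lebesgue"
    using assms(1) by (simp add: sets_restrict_space_iff fmeasurable_def)
  thus ?thesis by (rule fmeasurableI2[OF assms(1), rotated]) auto
qed

lemma grid_symbol_continuous:
  assumes "\<And>\<kappa>. \<kappa> \<in> K \<Longrightarrow> continuous_on (cbox 0 1) (\<lambda>x. h x \<kappa>)"
  shows "continuous_on (cbox 0 1 \<times> freq_box) (grid_symbol K h)"
  unfolding grid_symbol_def[abs_def] freq_char_def
  by (intro continuous_intros continuous_on_compose2[OF assms]) auto

lemma cube_Times_freq_box_lmeasurable:
  "(cbox 0 1 :: ('d :: finite) point set) \<times> (freq_box :: 'd point set) \<in> lmeasurable"
  unfolding freq_box_def cbox_Pair_eq[symmetric] by (rule lmeasurable_cbox)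

context block_model
begin

text \<open>All these cells have the same volume, so counting modes is measuring a union of cells.\<close>

definition mode_cell :: "'d multi_index \<times> 'd multi_index \<Rightarrow> ('d point \<times> 'd point) set" where
  "mode_cell p = hbox (base (fst p)) (\<chi> l. real (b * fst p $ l + b) / real (n $ l)) \<times>
     hbox (angle b (snd p)) (\<chi> l. angle b (snd p) $ l + 2 * pi / real b)"

text \<open>The factors \<open>b\<close> of the two boxes cancel, so a mode weighs as much as one
  grid cell times the whole frequency box.\<close>

lemma measure_mode_cell:
  "measure lebesgue (mode_cell p) = (2 * pi) ^ CARD('d) / real (grid_size n)" "mode_cell p \<in> lmeasurable"
proof -
  have le: "base q $ l \<le> (\<chi> l. real (b * q $ l + b) / real (n $ l)) $ l" for q l
    by (simp add: base_def divide_right_mono)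
  have le': "angle b w $ l \<le> (\<chi> l. angle b w $ l + 2 * pi / real b) $ l" for w l by simp
  show "mode_cell p \<in> lmeasurable" unfolding mode_cell_def by (rule measure_hbox_Times(2)[OF le le'])
  have "measure lebesgue (mode_cell p) = (\<Prod>l\<in>(UNIV :: 'd set). real b / real (n $ l)) * (\<Prod>l\<in>(UNIV :: 'd set). 2 * pi / real b)"
    unfolding mode_cell_def measure_hbox_Times(1)[OF le le'] by (simp add: base_def diff_divide_distrib[symmetric])
  also have "\<dots> = (2 * pi) ^ CARD('d) / real (grid_size n)"
    using b by (simp add: prod_dividef grid_size_def power_divide)
  finally show "measure lebesgue (mode_cell p) = (2 * pi) ^ CARD('d) / real (grid_size n)" .
qed

text \<open>Rescaled to integer bounds, which turns disjointness of cells and the location of a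
  point into statements about naturals.\<close>

lemma mem_mode_cell:
  "(x, \<theta>) \<in> mode_cell (q, w) \<longleftrightarrow> (\<forall>l. real (b * q $ l) < x $ l * real (n $ l) \<and> x $ l * real (n $ l) \<le> real (b * q $ l + b)) \<and>
     (\<forall>l. real (w $ l) < (\<theta> $ l + pi) * real b / (2 * pi) \<and> (\<theta> $ l + pi) * real b / (2 * pi) \<le> real (w $ l) + 1)"
proof -
  have 1: "base q $ l < x $ l \<longleftrightarrow> real (b * q $ l) < x $ l * real (n $ l)" for l
    using n0[of l] by (simp add: base_def pos_divide_less_eq del: of_nat_mult)
  have 2: "x $ l \<le> real (b * q $ l + b) / real (n $ l) \<longleftrightarrow> x $ l * real (n $ l) \<le> real (b * q $ l + b)" for l
    using n0[of l] by (simp add: pos_le_divide_eq del: of_nat_mult of_nat_add)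
  have 3: "angle b w $ l < \<theta> $ l \<longleftrightarrow> real (w $ l) < (\<theta> $ l + pi) * real b / (2 * pi)" for l
    using b by (simp add: angle_def pos_less_divide_eq field_simps)
  have 4: "\<theta> $ l \<le> angle b w $ l + 2 * pi / real b \<longleftrightarrow> (\<theta> $ l + pi) * real b / (2 * pi) \<le> real (w $ l) + 1" for l
    using b by (simp add: angle_def pos_divide_le_eq field_simps)
  show ?thesis by (simp add: mode_cell_def hbox_def 1 2 3 4 del: of_nat_mult of_nat_add)
qed

lemma nat_interval_unique:
  fixes r :: real and c e :: nat
  assumes "real a < r" "r \<le> real a + 1" "real c < r" "r \<le> real c + 1"
  shows "a = c"
  using assms by linarith

lemma mode_cell_disjoint:
  assumes "z \<in> mode_cell p" "z \<in> mode_cell p'"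
  shows "p = p'"
proof -
  obtain x \<theta> q w q' w' where z: "z = (x, \<theta>)" "p = (q, w)" "p' = (q', w')" by (cases z, cases p, cases p')
  have m: "real (b * q $ l) < x $ l * real (n $ l)" "x $ l * real (n $ l) \<le> real (b * q $ l + b)"
       "real (b * q' $ l) < x $ l * real (n $ l)" "x $ l * real (n $ l) \<le> real (b * q' $ l + b)"
       "real (w $ l) < (\<theta> $ l + pi) * real b / (2 * pi)" "(\<theta> $ l + pi) * real b / (2 * pi) \<le> real (w $ l) + 1"
       "real (w' $ l) < (\<theta> $ l + pi) * real b / (2 * pi)" "(\<theta> $ l + pi) * real b / (2 * pi) \<le> real (w' $ l) + 1" for l
    using assms unfolding z mem_mode_cell by auto
  have "w $ l = w' $ l" for l using nat_interval_unique[OF m(5) m(6) m(7) m(8)] .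
  moreover have "q $ l = q' $ l" for l
  proof (rule ccontr)
    have lt: "b * q $ l < b * q' $ l + b" "b * q' $ l < b * q $ l + b"
      using less_le_trans[OF m(1) m(4), of l] less_le_trans[OF m(3) m(2), of l] by (simp_all only: of_nat_less_iff)
    assume "q $ l \<noteq> q' $ l"
    then consider "q $ l + 1 \<le> q' $ l" | "q' $ l + 1 \<le> q $ l" by linarith
    thus False
    proof cases
      case 1
      from mult_left_mono[OF this, of b] lt show False by simp
    next
      case 2
      from mult_left_mono[OF this, of b] lt show False by simp
    qed
  qed
  ultimately show ?thesis by (simp add: z Finite_Cartesian_Product.vec_eq_iff)
qed

lemma measure_Union_mode_cells:
  assumes "finite P"
  shows "measure lebesgue (\<Union>p\<in>P. mode_cell p) = real (card P) * ((2 * pi) ^ CARD('d) / real (grid_size n))"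
    and "(\<Union>p\<in>P. mode_cell p) \<in> lmeasurable"
proof -
  have "measure lebesgue (\<Union>p\<in>P. mode_cell p) = (\<Sum>p\<in>P. measure lebesgue (mode_cell p))"
    by (rule measure_UNION'[OF assms measure_mode_cell(2)]) (auto simp: pairwise_def disjnt_def dest: mode_cell_disjoint)
  thus "measure lebesgue (\<Union>p\<in>P. mode_cell p) = real (card P) * ((2 * pi) ^ CARD('d) / real (grid_size n))"
    by (simp add: measure_mode_cell)
  show "(\<Union>p\<in>P. mode_cell p) \<in> lmeasurable" using assms measure_mode_cell(2) by (intro fmeasurable.finite_UN) auto
qed

definition "wild = {i \<in> grid n. \<not> tame \<Omega> n b i}"

lemma wild_cells:
  "measure lebesgue (\<Union>i\<in>wild. cell n i \<times> (freq_box :: 'd point set)) \<le> real (card wild) * ((2 * pi) ^ CARD('d) / real (grid_size n))"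
  "(\<Union>i\<in>wild. cell n i \<times> (freq_box :: 'd point set)) \<in> lmeasurable"
proof -
  have le: "(\<chi> l. (real (i $ l) - 1) / real (n $ l)) $ l \<le> (\<chi> l. real (i $ l) / real (n $ l)) $ l" for i :: "'d multi_index" and l
    by (simp add: divide_right_mono)
  have m: "cell n i \<times> (freq_box :: 'd point set) \<in> lmeasurable" for i
    unfolding cell_def by (rule measure_hbox_Times_freq_box(2)[OF le])
  have v: "measure lebesgue (cell n i \<times> (freq_box :: 'd point set)) = (2 * pi) ^ CARD('d) / real (grid_size n)" for i
    unfolding cell_def measure_hbox_Times_freq_box(1)[OF le]
    by (simp add: diff_divide_distrib[symmetric] grid_size_def prod_dividef)
  have f: "finite wild" by (simp add: wild_def)
  show "(\<Union>i\<in>wild. cell n i \<times> (freq_box :: 'd point set)) \<in> lmeasurable"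
    using f m by (intro fmeasurable.finite_UN) auto
  have "measure lebesgue (\<Union>i\<in>wild. cell n i \<times> (freq_box :: 'd point set)) \<le> (\<Sum>i\<in>wild. measure lebesgue (cell n i \<times> (freq_box :: 'd point set)))"
    by (rule measure_UNION_le[OF f]) (use m in \<open>auto simp: fmeasurable_def\<close>)
  thus "measure lebesgue (\<Union>i\<in>wild. cell n i \<times> (freq_box :: 'd point set)) \<le> real (card wild) * ((2 * pi) ^ CARD('d) / real (grid_size n))"
    by (simp add: v)
qed

lemma cell_close_pt:
  assumes "x \<in> cell n i"
  shows "close_pt n b i x"
  unfolding close_pt_def
proof
  fix l
  have "real (i $ l) - 1 < x $ l * real (n $ l)" "x $ l * real (n $ l) \<le> real (i $ l)"
    using assms unfolding mem_cell[OF n0] by auto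
  hence "\<bar>x $ l * real (n $ l) - real (i $ l)\<bar> \<le> real b" using b by linarith
  hence "\<bar>x $ l * real (n $ l) - real (i $ l)\<bar> / real (n $ l) \<le> real b / real (n $ l)" by (intro divide_right_mono) auto
  also have "\<bar>x $ l * real (n $ l) - real (i $ l)\<bar> / real (n $ l) = \<bar>x $ l - real (i $ l) / real (n $ l)\<bar>"
    by (rule abs_diff_mult_divide) (use n0[of l] in simp)
  finally show "\<bar>x $ l - real (i $ l) / real (n $ l)\<bar> \<le> real b / real (n $ l)" .
qed

lemma tame_cell:
  assumes "x \<in> cell n i" "tame \<Omega> n b i"
  shows "x \<in> \<Omega> \<longleftrightarrow> i \<in> grid_in \<Omega> n" and "near b i j \<Longrightarrow> j \<in> grid_in \<Omega> n \<longleftrightarrow> x \<in> \<Omega>"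
  using assms(2) cell_close_pt[OF assms(1)] unfolding tame_def by (auto simp: near_def)

text \<open>The cell of a tame index lies in \<open>\<Omega>\<close> or misses it according to
  \<open>grid_in\<close>. Hence the union of the cells of the domain indices differs from
  \<open>\<Omega>\<close> only on wild cells and on the lower faces of the cube, which are
  null.\<close>

lemma grid_in_size_approx:
  assumes \<Omega>: "\<Omega> \<subseteq> cbox 0 1" "peano_jordan \<Omega>"
  shows "\<bar>real (card (grid_in \<Omega> n)) / real (grid_size n) - measure lebesgue \<Omega>\<bar> \<le> real (card wild) / real (grid_size n)"
proof -
  define S where "S = grid_in \<Omega> n"
  have fS: "finite S" "finite wild" by (auto simp: S_def wild_def)
  have \<Omega>m: "\<Omega> \<in> lmeasurable" using peano_jordan_Times_freq_box(2)[OF \<Omega>(2)] .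
  note mU = measure_Union_cells[OF n0]
  have "measure lebesgue \<Omega> \<le> measure lebesgue ((\<Union>i\<in>S. cell n i) \<union> (\<Union>i\<in>wild. cell n i) \<union> (cbox 0 1 - hbox 0 1))"
  proof (rule measure_mono_fmeasurable)
    show "\<Omega> \<subseteq> (\<Union>i\<in>S. cell n i) \<union> (\<Union>i\<in>wild. cell n i) \<union> (cbox 0 1 - hbox 0 1)"
    proof
      fix x assume x: "x \<in> \<Omega>"
      show "x \<in> (\<Union>i\<in>S. cell n i) \<union> (\<Union>i\<in>wild. cell n i) \<union> (cbox 0 1 - hbox 0 1)"
      proof (cases "x \<in> hbox 0 1")
        case True
        then obtain i where i: "i \<in> grid n" "x \<in> cell n i" using cell_exists[OF n0] by blast
        thus ?thesis using tame_cell(1)[OF i(2)] x by (auto simp: wild_def S_def)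
      qed (use x \<Omega> in auto)
    qed
    show "(\<Union>i\<in>S. cell n i) \<union> (\<Union>i\<in>wild. cell n i) \<union> (cbox 0 1 - hbox 0 1) \<in> lmeasurable"
      by (intro fmeasurable.Un mU(2) fS fmeasurableI_null_sets cbox_minus_hbox_null)
  qed (use \<Omega>m in auto)
  also have "\<dots> = measure lebesgue ((\<Union>i\<in>S. cell n i) \<union> (\<Union>i\<in>wild. cell n i))"
    using mU(2)[OF fS(1)] mU(2)[OF fS(2)] by (intro measure_Un_null_set cbox_minus_hbox_null) auto
  also have "\<dots> \<le> measure lebesgue (\<Union>i\<in>S. cell n i) + measure lebesgue (\<Union>i\<in>wild. cell n i)"
    by (rule measure_Un_le) (use mU(2)[OF fS(1)] mU(2)[OF fS(2)] in auto)
  also have "\<dots> = real (card S) / real (grid_size n) + real (card wild) / real (grid_size n)"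
    using mU(1)[OF fS(1)] mU(1)[OF fS(2)] by simp
  finally have 1: "measure lebesgue \<Omega> \<le> real (card S) / real (grid_size n) + real (card wild) / real (grid_size n)" .
  have "real (card (S - wild)) / real (grid_size n) = measure lebesgue (\<Union>i\<in>S - wild. cell n i)"
    using mU(1)[of "S - wild"] fS by simp
  also have "\<dots> \<le> measure lebesgue \<Omega>"
  proof (rule measure_mono_fmeasurable[OF _ _ \<Omega>m])
    show "(\<Union>i\<in>S - wild. cell n i) \<subseteq> \<Omega>"
    proof
      fix x assume "x \<in> (\<Union>i\<in>S - wild. cell n i)"
      then obtain i where i: "i \<in> grid_in \<Omega> n" "i \<notin> wild" "x \<in> cell n i" by (auto simp: S_def)
      hence "tame \<Omega> n b i" using grid_in_subset by (auto simp: wild_def)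
      thus "x \<in> \<Omega>" using tame_cell(1)[OF i(3)] i(1) by simp
    qed
    show "(\<Union>i\<in>S - wild. cell n i) \<in> sets lebesgue" using mU(2)[of "S - wild"] fS by auto
  qed
  finally have "real (card (S - wild)) / real (grid_size n) \<le> measure lebesgue \<Omega>" .
  moreover have "real (card S) / real (grid_size n) \<le> real (card (S - wild)) / real (grid_size n) + real (card wild) / real (grid_size n)"
  proof -
    have "card S \<le> card (S - wild) + card wild" using card_Un_le[of "S - wild" wild] fS
      by (intro order_trans[OF card_mono[of "(S - wild) \<union> wild" S]]) auto
    hence "real (card S) \<le> real (card (S - wild)) + real (card wild)" by linarith
    thus ?thesis unfolding add_divide_distrib[symmetric] by (intro divide_right_mono) auto
  qed
  ultimately show ?thesis using 1 unfolding S_def by linarith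
qed

end

text \<open>\<open>osc\<close> is uniform continuity of the symbol at the scale of a mode cell: the
  eigenvalue of a mode and the symbol on its cell differ by at most \<open>\<eta>\<close>, so
  counting compares the levels \<open>L\<close> and \<open>L + \<eta>\<close>.\<close>

locale symbol_model = block_model n \<Omega> b K h
  for n :: "('d :: {finite, linorder}) multi_index" and \<Omega> b K h +
  fixes \<eta> :: real
  assumes \<Omega>: "\<Omega> \<subseteq> cbox 0 1" "peano_jordan \<Omega>"
    and cont: "continuous_on (cbox 0 1 \<times> freq_box) (grid_symbol K h)"
    and osc: "\<And>x y \<theta> \<theta>'. x \<in> cbox 0 1 \<Longrightarrow> y \<in> cbox 0 1 \<Longrightarrow> \<theta> \<in> freq_box \<Longrightarrow> \<theta>' \<in> freq_box \<Longrightarrow>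
      (\<And>l. \<bar>x $ l - y $ l\<bar> \<le> real b / real (n $ l)) \<Longrightarrow> (\<And>l. \<bar>\<theta> $ l - \<theta>' $ l\<bar> \<le> 2 * pi / real b) \<Longrightarrow>
      cmod (grid_symbol K h (x, \<theta>) - grid_symbol K h (y, \<theta>')) \<le> \<eta>"
begin

lemma super_level_measurable: "{z \<in> \<Omega> \<times> freq_box. cmod (grid_symbol K h z) > L} \<in> lmeasurable"
proof -
  have m: "\<Omega> \<times> (freq_box :: 'd point set) \<in> lmeasurable" by (rule peano_jordan_Times_freq_box(1)[OF \<Omega>(2)])
  have "continuous_on (\<Omega> \<times> freq_box) (grid_symbol K h)"
    using \<Omega>(1) by (intro continuous_on_subset[OF cont]) auto
  hence "grid_symbol K h \<in> borel_measurable (lebesgue_on (\<Omega> \<times> freq_box))"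
    using m by (intro continuous_imp_measurable_on_sets_lebesgue) auto
  thus ?thesis by (rule super_level_lmeasurable[OF m])
qed

text \<open>A full block ends inside the grid, so its cell lies in the cube. The point itself may be
  outside \<open>\<Omega>\<close>: only the grid index of its cell is known to belong to the domain,
  which is why wild cells appear in the counts.\<close>

lemma mode_cell_osc:
  assumes p: "p \<in> modes" and z: "z \<in> mode_cell p"
  shows "cmod (grid_symbol K h z - lam p) \<le> \<eta>" and "snd z \<in> freq_box"
    and "\<exists>i\<in>grid_in \<Omega> n. fst z \<in> cell n i"
proof -
  obtain x \<theta> q w where zp: "z = (x, \<theta>)" "p = (q, w)" by (cases z, cases p)
  have q: "q \<in> full" and w: "w $ l < b" for l using p by (auto simp: zp modes_def freq_grid_def)
  have m: "real (b * q $ l) < x $ l * real (n $ l)" "x $ l * real (n $ l) \<le> real (b * q $ l + b)"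
       "real (w $ l) < (\<theta> $ l + pi) * real b / (2 * pi)" "(\<theta> $ l + pi) * real b / (2 * pi) \<le> real (w $ l) + 1" for l
    using z unfolding zp mem_mode_cell by auto
  have bn: "b * q $ l + b \<le> n $ l" for l
  proof -
    \<comment> \<open>The last point of the block; as it lies in the grid, the block does not exceed
      \<open>n\<close>.\<close>
    define i where "i = (\<chi> l. b * q $ l + b)"
    have "i \<in> block b q" using b by (auto simp: i_def block_def)
    hence "i \<in> grid n" using q grid_in_subset by (auto simp: full_def)
    thus ?thesis by (auto simp: grid_def i_def)
  qed
  have bnr: "real (b * q $ l + b) \<le> real (n $ l)" for l using bn by (simp only: of_nat_le_iff)
  have x1: "x \<in> hbox 0 1"
  proof -
    have "0 < x $ l \<and> x $ l \<le> 1" for l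
    proof -
      have "0 < x $ l * real (n $ l)" using m(1)[of l] by (rule le_less_trans[rotated]) simp
      moreover have "x $ l * real (n $ l) \<le> 1 * real (n $ l)" using m(2)[of l] bnr[of l] by simp
      ultimately show ?thesis using n0[of l] by (simp add: zero_less_mult_iff)
    qed
    thus ?thesis by (simp add: hbox_def)
  qed
  have x2: "x \<in> cbox 0 1" using x1 by (auto simp: hbox_def mem_box_cart less_imp_le)
  have bq: "base q \<in> cbox 0 1"
  proof -
    have "b * q $ l \<le> n $ l" for l using bn[of l] by linarith
    thus ?thesis using n0 by (auto simp: base_def mem_box_cart of_nat_mult[symmetric] simp del: of_nat_mult)
  qed
  have th: "angle b w $ l < \<theta> $ l" "\<theta> $ l \<le> angle b w $ l + 2 * pi / real b" for l
    using m(3,4)[of l] b by (simp_all add: angle_def field_simps)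
  have ang: "- pi \<le> angle b w $ l" "angle b w $ l + 2 * pi / real b \<le> pi" for l
  proof -
    show "- pi \<le> angle b w $ l" by (simp add: angle_def)
    have "real (w $ l) + 1 \<le> real b" using w[of l] by linarith
    hence "(2 * pi) * ((real (w $ l) + 1) / real b) \<le> (2 * pi) * 1" using b by (intro mult_left_mono) auto
    thus "angle b w $ l + 2 * pi / real b \<le> pi" by (simp add: angle_def add_divide_distrib algebra_simps)
  qed
  have \<theta>1: "\<theta> \<in> freq_box"
  proof -
    have "- pi \<le> \<theta> $ l \<and> \<theta> $ l \<le> pi" for l using th[of l] ang[of l] by linarith
    thus ?thesis by (simp add: freq_box_eq)
  qed
  have a1: "angle b w \<in> freq_box"
  proof -
    have "angle b w $ l \<le> pi" for l using ang(2)[of l] b by (smt (verit) divide_nonneg_nonneg of_nat_0_le_iff pi_ge_zero)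
    thus ?thesis using ang(1) by (auto simp: freq_box_eq)
  qed
  show "snd z \<in> freq_box" using \<theta>1 by (simp add: zp)
  show "cmod (grid_symbol K h z - lam p) \<le> \<eta>"
    unfolding zp lam_def fst_conv snd_conv
  proof (rule osc[OF x2 bq \<theta>1 a1])
    fix l
    have "\<bar>x $ l * real (n $ l) - real (b * q $ l)\<bar> \<le> real b" using m(1,2)[of l] unfolding of_nat_add by linarith
    hence "\<bar>x $ l * real (n $ l) - real (b * q $ l)\<bar> / real (n $ l) \<le> real b / real (n $ l)" by (intro divide_right_mono) auto
    also have "\<bar>x $ l * real (n $ l) - real (b * q $ l)\<bar> / real (n $ l) = \<bar>x $ l - base q $ l\<bar>"
      using n0[of l] by (subst abs_diff_mult_divide) (simp_all add: base_def)
    finally show "\<bar>x $ l - base q $ l\<bar> \<le> real b / real (n $ l)" .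
    show "\<bar>\<theta> $ l - angle b w $ l\<bar> \<le> 2 * pi / real b" using th[of l] by linarith
  qed
  obtain i where i: "i \<in> grid n" "x \<in> cell n i" using cell_exists[OF n0 x1] by blast
  have "i \<in> block b q"
    unfolding block_def
  proof safe
    fix l
    have "real (i $ l) - 1 < x $ l * real (n $ l)" "x $ l * real (n $ l) \<le> real (i $ l)" using i(2) unfolding mem_cell[OF n0] by auto
    hence "real (b * q $ l) < real (i $ l)" "real (i $ l) < real (b * q $ l + b) + 1" using m(1,2)[of l] by linarith+
    hence "b * q $ l < i $ l" "i $ l < b * q $ l + b + 1" by linarith+
    thus "i $ l \<in> {b * q $ l<..b * q $ l + b}" by auto
  qed
  thus "\<exists>i\<in>grid_in \<Omega> n. fst z \<in> cell n i" using q i(2) by (auto simp: full_def zp)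
qed

text \<open>Apart from wild cells, the cells of modes with an eigenvalue above
  \<open>L + \<eta>\<close> lie in the superlevel set of the symbol at \<open>L\<close>.\<close>

lemma count_upper:
  "real (card {p \<in> modes. cmod (lam p) > L + \<eta>}) * ((2 * pi) ^ CARD('d) / real (grid_size n)) \<le>
     measure lebesgue {z \<in> \<Omega> \<times> freq_box. cmod (grid_symbol K h z) > L} + real (card wild) * ((2 * pi) ^ CARD('d) / real (grid_size n))"
proof -
  define P where "P = {p \<in> modes. cmod (lam p) > L + \<eta>}"
  define G where "G = {z \<in> \<Omega> \<times> freq_box. cmod (grid_symbol K h z) > L}"
  define Wc where "Wc = (\<Union>i\<in>wild. cell n i \<times> (freq_box :: 'd point set))"
  have fP: "finite P" by (simp add: P_def)
  have GW: "G \<in> lmeasurable" "Wc \<in> lmeasurable" unfolding G_def Wc_def by (rule super_level_measurable, rule wild_cells(2))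
  have "measure lebesgue (\<Union>p\<in>P. mode_cell p) \<le> measure lebesgue (G \<union> Wc)"
  proof (rule measure_mono_fmeasurable)
    show "(\<Union>p\<in>P. mode_cell p) \<subseteq> G \<union> Wc"
    proof
      fix z assume "z \<in> (\<Union>p\<in>P. mode_cell p)"
      then obtain p where p: "p \<in> modes" "cmod (lam p) > L + \<eta>" "z \<in> mode_cell p" by (auto simp: P_def)
      obtain i where i: "i \<in> grid_in \<Omega> n" "fst z \<in> cell n i" using mode_cell_osc(3)[OF p(1,3)] by blast
      have "cmod (lam p) - cmod (grid_symbol K h z) \<le> cmod (lam p - grid_symbol K h z)" by (rule norm_triangle_ineq2)
      also have "\<dots> \<le> \<eta>" using mode_cell_osc(1)[OF p(1,3)] by (simp add: norm_minus_commute)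
      finally have "cmod (grid_symbol K h z) > L" using p(2) by simp
      moreover have ig: "i \<in> grid n" using i(1) grid_in_subset by auto
      ultimately show "z \<in> G \<union> Wc"
        using tame_cell(1)[OF i(2)] i mode_cell_osc(2)[OF p(1,3)]
        by (cases "tame \<Omega> n b i") (auto simp: G_def Wc_def wild_def mem_Times_iff)
    qed
    show "(\<Union>p\<in>P. mode_cell p) \<in> sets lebesgue" using measure_Union_mode_cells(2)[OF fP] by auto
    show "G \<union> Wc \<in> lmeasurable" using GW by (rule fmeasurable.Un)
  qed
  also have "\<dots> \<le> measure lebesgue G + measure lebesgue Wc" by (rule measure_Un_le) (use GW in auto)
  also have "\<dots> \<le> measure lebesgue G + real (card wild) * ((2 * pi) ^ CARD('d) / real (grid_size n))"
    using wild_cells(1) by (simp add: Wc_def)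
  finally show ?thesis unfolding measure_Union_mode_cells(1)[OF fP] by (simp add: P_def G_def)
qed

text \<open>Almost every point of the superlevel set that lies in the cell of a tame index belongs
  to the cell of some mode, because its block is full; the eigenvalue of that mode has modulus above
  \<open>L\<close>.\<close>

lemma count_lower:
  "measure lebesgue {z \<in> \<Omega> \<times> freq_box. cmod (grid_symbol K h z) > L + \<eta>} \<le>
     real (card {p \<in> modes. cmod (lam p) > L}) * ((2 * pi) ^ CARD('d) / real (grid_size n)) + real (card wild) * ((2 * pi) ^ CARD('d) / real (grid_size n))"
proof -
  define P where "P = {p \<in> modes. cmod (lam p) > L}"
  define G where "G = {z \<in> \<Omega> \<times> freq_box. cmod (grid_symbol K h z) > L + \<eta>}"
  define Wc where "Wc = (\<Union>i\<in>wild. cell n i \<times> (freq_box :: 'd point set))"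
  define Pc where "Pc = (\<Union>p\<in>P. mode_cell p)"
  \<comment> \<open>The lower faces of the cube and of the frequency box, which half-open cells do
    not reach.\<close>
  define Z where "Z = (cbox 0 1 - hbox 0 1) \<times> (UNIV :: 'd point set) \<union> (UNIV :: 'd point set) \<times> (freq_box - hbox (\<chi> l. - pi) (\<chi> l. pi))"
  have fP: "finite P" by (simp add: P_def)
  have Z: "Z \<in> null_sets lebesgue" unfolding Z_def freq_box_def
    by (intro null_sets.Un null_sets_Times null_sets_Times_right cbox_minus_hbox_null)
  have GW: "Pc \<in> lmeasurable" "Wc \<in> lmeasurable" "G \<in> lmeasurable"
    unfolding G_def Pc_def Wc_def by (rule measure_Union_mode_cells(2)[OF fP], rule wild_cells(2), rule super_level_measurable)
  have "measure lebesgue G \<le> measure lebesgue ((Pc \<union> Wc) \<union> Z)"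
  proof (rule measure_mono_fmeasurable)
    show "G \<subseteq> (Pc \<union> Wc) \<union> Z"
    proof
      fix z assume "z \<in> G"
      then obtain x \<theta> where z: "z = (x, \<theta>)" "x \<in> \<Omega>" "\<theta> \<in> freq_box" "cmod (grid_symbol K h z) > L + \<eta>"
        by (cases z) (auto simp: G_def)
      show "z \<in> (Pc \<union> Wc) \<union> Z"
      proof (cases "x \<in> hbox 0 1 \<and> \<theta> \<in> hbox (\<chi> l. - pi) (\<chi> l. pi)")
        case False
        thus ?thesis using z \<Omega>(1) by (auto simp: Z_def)
      next
        case True
        then obtain i where i: "i \<in> grid n" "x \<in> cell n i" using cell_exists[OF n0] by blast
        show ?thesis
        proof (cases "tame \<Omega> n b i")
          case False
          thus ?thesis using i z by (auto simp: Wc_def wild_def)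
        next
          case tame: True
          define q where "q = (\<chi> l. (i $ l - 1) div b)"
          have ib: "i \<in> block b q" unfolding q_def by (rule block_exists[OF b i(1)])
          have qf: "q \<in> full" unfolding full_def
            using block_near[OF ib] tame_cell(2)[OF i(2) tame] z(2) by blast
          \<comment> \<open>Cells are closed on the right, so the index is the ceiling less 1 and
            not the floor.\<close>
          define w where "w = (\<chi> l. nat (\<lceil>(\<theta> $ l + pi) * real b / (2 * pi)\<rceil> - 1))"
          have t: "0 < (\<theta> $ l + pi) * real b / (2 * pi)" "(\<theta> $ l + pi) * real b / (2 * pi) \<le> real b" for l
          proof -
            have th: "- pi < \<theta> $ l" "\<theta> $ l \<le> pi" using True by (auto simp: hbox_def)
            show "0 < (\<theta> $ l + pi) * real b / (2 * pi)" using th b by (auto intro!: divide_pos_pos mult_pos_pos)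
            have "(\<theta> $ l + pi) * real b \<le> (2 * pi) * real b" using th by (intro mult_right_mono) auto
            thus "(\<theta> $ l + pi) * real b / (2 * pi) \<le> real b" by (simp add: pos_divide_le_eq mult_ac)
          qed
          have wr: "real (w $ l) = of_int \<lceil>(\<theta> $ l + pi) * real b / (2 * pi)\<rceil> - 1" for l
            using t(1)[of l] by (simp add: w_def)
          have wb: "w \<in> freq_grid b"
          proof -
            have "real (w $ l) < real b" for l
              unfolding wr using t(2)[of l] ceiling_le_iff[of "(\<theta> $ l + pi) * real b / (2 * pi)" "int b"] by simp
            thus ?thesis by (simp add: freq_grid_def)
          qed
          have zc: "z \<in> mode_cell (q, w)"
            unfolding z mem_mode_cell
          proof (intro conjI allI)
            fix l
            have c: "real (i $ l) - 1 < x $ l * real (n $ l)" "x $ l * real (n $ l) \<le> real (i $ l)"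
              using i(2) unfolding mem_cell[OF n0] by auto
            have "b * q $ l + 1 \<le> i $ l" "i $ l \<le> b * q $ l + b" using ib by (auto simp: block_def Suc_le_eq)
            hence "real (b * q $ l + 1) \<le> real (i $ l)" "real (i $ l) \<le> real (b * q $ l + b)" by (simp_all only: of_nat_le_iff)
            thus "real (b * q $ l) < x $ l * real (n $ l)" "x $ l * real (n $ l) \<le> real (b * q $ l + b)" using c by linarith+
            show "real (w $ l) < (\<theta> $ l + pi) * real b / (2 * pi)" "(\<theta> $ l + pi) * real b / (2 * pi) \<le> real (w $ l) + 1"
              unfolding wr using ceiling_correct[of "(\<theta> $ l + pi) * real b / (2 * pi)"] by linarith+
          qed
          have pm: "(q, w) \<in> modes" using qf wb by (simp add: modes_def)
          have "cmod (grid_symbol K h z) - cmod (lam (q, w)) \<le> cmod (grid_symbol K h z - lam (q, w))" by (rule norm_triangle_ineq2)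
          also have "\<dots> \<le> \<eta>" by (rule mode_cell_osc(1)[OF pm zc])
          finally have "cmod (lam (q, w)) > L" using z(4) by simp
          thus ?thesis using pm zc by (auto simp: Pc_def P_def)
        qed
      qed
    qed
    show "G \<in> sets lebesgue" using GW by auto
    show "(Pc \<union> Wc) \<union> Z \<in> lmeasurable" by (intro fmeasurable.Un GW fmeasurableI_null_sets Z)
  qed
  also have "\<dots> = measure lebesgue (Pc \<union> Wc)" using GW Z by (intro measure_Un_null_set) auto
  also have "\<dots> \<le> measure lebesgue Pc + measure lebesgue Wc" by (rule measure_Un_le) (use GW in auto)
  also have "\<dots> \<le> real (card P) * ((2 * pi) ^ CARD('d) / real (grid_size n)) + real (card wild) * ((2 * pi) ^ CARD('d) / real (grid_size n))"
    using wild_cells(1) unfolding Pc_def measure_Union_mode_cells(1)[OF fP] by (simp add: Wc_def)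
  finally show ?thesis by (simp add: P_def G_def)
qed

end

section \<open>The limit for banded kernels\<close>

lemma mea_size_bdd_below:
  "bdd_below ((\<lambda>L. measure lebesgue {z \<in> \<Omega> \<times> freq_box. cmod (g z) > L} /
       (measure lebesgue \<Omega> * (2 * pi) ^ CARD('d)) + L) ` {0..})" for \<Omega> :: "('d :: finite) point set"
  by (rule bdd_belowI2[of _ 0]) simp

lemma mea_size_le:
  fixes \<Omega> :: "('d :: finite) point set"
  assumes "0 \<le> L"
  shows "mea_size \<Omega> g \<le> measure lebesgue {z \<in> \<Omega> \<times> freq_box. cmod (g z) > L} / (measure lebesgue \<Omega> * (2 * pi) ^ CARD('d)) + L"
  unfolding mea_size_def by (rule cINF_lower[OF mea_size_bdd_below]) (use assms in auto)

lemma mea_size_greatest: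
  fixes \<Omega> :: "('d :: finite) point set"
  assumes "\<And>L. 0 \<le> L \<Longrightarrow> m \<le> measure lebesgue {z \<in> \<Omega> \<times> freq_box. cmod (g z) > L} / (measure lebesgue \<Omega> * (2 * pi) ^ CARD('d)) + L"
  shows "m \<le> mea_size \<Omega> g"
  unfolding mea_size_def by (rule cINF_greatest) (use assms in auto)

context symbol_model
begin

text \<open>Let \<open>N\<close> be the number of grid points, \<open>D\<close> the number of those
  in the domain and \<open>\<mu>\<close> the volume of \<open>\<Omega>\<close>. Replacing
  \<open>N / D\<close> by \<open>1 / \<mu>\<close> costs \<open>2 * \<beta> / \<mu>^2\<close>, the
  wild cells cost at most \<open>\<beta> * (N / D)\<close>, hence
  \<open>2 * \<beta> / \<mu>\<close>, and the shift of the level costs \<open>\<eta>\<close>. The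
  condition \<open>\<beta> \<le> \<mu> / 2\<close> keeps \<open>D / N\<close> at least
  \<open>\<mu> / 2\<close>.\<close>

lemma model_acs_size:
  assumes \<mu>: "measure lebesgue \<Omega> > 0" and \<beta>: "\<beta> \<le> measure lebesgue \<Omega> / 2"
    and W: "real (card wild) \<le> \<beta> * real (grid_size n)" and \<eta>: "0 \<le> \<eta>"
  shows "\<bar>acs_size (grid_in \<Omega> n) model - mea_size \<Omega> (grid_symbol K h)\<bar> \<le>
     2 * \<beta> / (measure lebesgue \<Omega>)\<^sup>2 + 2 * \<beta> / measure lebesgue \<Omega> + \<eta>"
    and "real (grid_size n) / real (card (grid_in \<Omega> n)) \<le> 2 / measure lebesgue \<Omega>"
    and "card (grid_in \<Omega> n) > 0"
proof -
  define \<mu> where "\<mu> = measure lebesgue \<Omega>"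
  define N where "N = real (grid_size n)"
  define D where "D = real (card (grid_in \<Omega> n))"
  define T where "T = (2 * pi) ^ CARD('d)"
  define m where "m L = measure lebesgue {z \<in> \<Omega> \<times> freq_box. cmod (grid_symbol K h z) > L}" for L
  define e where "e = 2 * \<beta> / \<mu>\<^sup>2 + 2 * \<beta> / \<mu>"
  have \<mu>0: "\<mu> > 0" and \<beta>\<mu>: "\<beta> \<le> \<mu> / 2" using \<mu> \<beta> by (auto simp: \<mu>_def)
  have N0: "N > 0" using n0 by (auto simp: N_def grid_size_def intro!: prod_pos)
  have T0: "T > 0" by (simp add: T_def)
  have W': "real (card wild) / N \<le> \<beta>" using W N0 by (simp add: N_def pos_divide_le_eq)
  moreover have "0 \<le> real (card wild) / N" using N0 by simp
  ultimately have \<beta>0: "\<beta> \<ge> 0" by linarith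
  have DN: "\<bar>D / N - \<mu>\<bar> \<le> \<beta>"
    using grid_in_size_approx[OF \<Omega>] W' unfolding D_def N_def \<mu>_def by linarith
  hence DN2: "D / N \<ge> \<mu> / 2" using \<beta>\<mu> by linarith
  hence "D / N > 0" using \<mu>0 by linarith
  hence D0: "D > 0" using N0 by (simp add: zero_less_divide_iff)
  thus "card (grid_in \<Omega> n) > 0" by (simp add: D_def)
  have s: "N / D \<le> 2 / \<mu>" using DN2 D0 N0 \<mu>0 by (simp add: field_simps)
  thus "real (grid_size n) / real (card (grid_in \<Omega> n)) \<le> 2 / measure lebesgue \<Omega>" by (simp add: N_def D_def \<mu>_def)
  have s2: "\<bar>N / D - 1 / \<mu>\<bar> \<le> 2 * \<beta> / \<mu>\<^sup>2"
  proof -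
    have "N / D - 1 / \<mu> = - ((D / N - \<mu>) * (N / D) / \<mu>)" using D0 N0 \<mu>0 by (simp add: field_simps)
    hence "\<bar>N / D - 1 / \<mu>\<bar> = \<bar>D / N - \<mu>\<bar> * (N / D) / \<mu>" using D0 N0 \<mu>0 by (simp add: abs_mult)
    also have "\<dots> \<le> \<beta> * (2 / \<mu>) / \<mu>" using DN s \<mu>0 D0 N0 \<beta>0 by (intro divide_right_mono mult_mono) auto
    finally show ?thesis by (simp add: power2_eq_square mult_ac)
  qed
  have \<beta>s: "\<beta> * (N / D) \<le> 2 * \<beta> / \<mu>" using mult_left_mono[OF s \<beta>0] by (simp add: mult_ac)
  \<comment> \<open>As \<open>m L / T \<le> 1\<close>, the error of the normalisation is not
    amplified.\<close>
  have mT: "0 \<le> m L" "m L \<le> T" for L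
  proof -
    have "m L \<le> measure lebesgue ((cbox 0 1 :: 'd point set) \<times> (freq_box :: 'd point set))"
      unfolding m_def
    proof (rule measure_mono_fmeasurable)
      show "(cbox 0 1 :: 'd point set) \<times> (freq_box :: 'd point set) \<in> lmeasurable"
        by (rule cube_Times_freq_box_lmeasurable)
    qed (use \<Omega> super_level_measurable in auto)
    also have "\<dots> = measure lborel (cbox 0 1 :: 'd point set) * measure lborel (freq_box :: 'd point set)"
    proof -
      have "emeasure lborel ((cbox 0 1 :: 'd point set) \<times> (freq_box :: 'd point set)) = emeasure lborel (cbox 0 1 :: 'd point set) * emeasure lborel (freq_box :: 'd point set)"
        by (rule emeasure_Times_lborel) (auto simp: freq_box_def)
      moreover have "(cbox 0 1 :: 'd point set) \<times> (freq_box :: 'd point set) \<in> sets borel"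
        by (simp add: borel_prod[symmetric] freq_box_def)
      ultimately show ?thesis by (simp add: measure_def measure_completion enn2real_mult)
    qed
    also have "measure lborel (cbox 0 1 :: 'd point set) = 1" by (subst content_cbox_cart) (auto simp: interval_ne_empty_cart)
    also have "measure lborel (freq_box :: 'd point set) = T"
      unfolding freq_box_def T_def by (subst content_cbox_cart) (auto simp: interval_ne_empty_cart)
    finally show "m L \<le> T" by simp
    show "0 \<le> m L" by (simp add: m_def)
  qed
  have cmp: "\<bar>m L / T * (N / D) - m L / (\<mu> * T)\<bar> \<le> 2 * \<beta> / \<mu>\<^sup>2" for L
  proof -
    have "m L / T * (N / D) - m L / (\<mu> * T) = m L / T * (N / D - 1 / \<mu>)"
      by (simp add: right_diff_distrib)
    hence "\<bar>m L / T * (N / D) - m L / (\<mu> * T)\<bar> = m L / T * \<bar>N / D - 1 / \<mu>\<bar>"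
      using mT[of L] T0 by (simp add: abs_mult)
    also have "\<dots> \<le> 1 * \<bar>N / D - 1 / \<mu>\<bar>" using mT[of L] T0 by (intro mult_right_mono) auto
    finally show ?thesis using s2 by simp
  qed
  have up: "acs_size (grid_in \<Omega> n) model \<le> m L / (\<mu> * T) + L + (e + \<eta>)" if L: "0 \<le> L" for L
  proof -
    define c where "c = real (card {p \<in> modes. cmod (lam p) > L + \<eta>})"
    have "sv_bound (grid_in \<Omega> n) model (card {p \<in> modes. cmod (lam p) > L + \<eta>}) (L + \<eta>)"
      using sv_bound_diagonal_iff[OF modes_orthonormal, of "L + \<eta>" lam] L \<eta> by (simp add: model_def[abs_def])
    from acs_size_le[OF this] have "acs_size (grid_in \<Omega> n) model \<le> c / D + (L + \<eta>)" using L \<eta> by (simp add: c_def D_def)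
    \<comment> \<open>Inserts the volume \<open>T / N\<close> of a mode cell, which turns the count
      into a measure.\<close>
    also have "c / D = c * (T / N) / T * (N / D)" using N0 T0 by simp
    also have "\<dots> \<le> (m L + real (card wild) * (T / N)) / T * (N / D)"
      using count_upper[of L] T0 N0 D0 by (intro mult_right_mono divide_right_mono) (auto simp: c_def m_def T_def N_def)
    also have "\<dots> = m L / T * (N / D) + (real (card wild) / N) * (N / D)" using T0 N0 by (simp add: add_divide_distrib distrib_right)
    also have "\<dots> \<le> (m L / (\<mu> * T) + 2 * \<beta> / \<mu>\<^sup>2) + \<beta> * (N / D)"
      using cmp[of L] W' N0 D0 by (intro add_mono mult_right_mono) auto
    finally show ?thesis using \<beta>s by (simp add: e_def)
  qed
  have low: "mea_size \<Omega> (grid_symbol K h) \<le> real r / real (card (grid_in \<Omega> n)) + L + (e + \<eta>)"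
    if L: "0 \<le> L" and sv: "sv_bound (grid_in \<Omega> n) model r L" for r L
  proof -
    define c where "c = real (card {p \<in> modes. cmod (lam p) > L})"
    have cr: "c \<le> real r" using sv sv_bound_diagonal_iff[OF modes_orthonormal L, of lam r] by (simp add: c_def model_def[abs_def])
    have "mea_size \<Omega> (grid_symbol K h) \<le> m (L + \<eta>) / (\<mu> * T) + (L + \<eta>)"
      using mea_size_le[of "L + \<eta>" \<Omega> "grid_symbol K h"] L \<eta> by (simp add: m_def \<mu>_def T_def)
    also have "m (L + \<eta>) / (\<mu> * T) \<le> m (L + \<eta>) / T * (N / D) + 2 * \<beta> / \<mu>\<^sup>2" using cmp[of "L + \<eta>"] by linarith
    also have "m (L + \<eta>) / T * (N / D) \<le> (c * (T / N) + real (card wild) * (T / N)) / T * (N / D)"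
      using count_lower[of L] T0 N0 D0 by (intro mult_right_mono divide_right_mono) (auto simp: c_def m_def T_def N_def)
    also have "\<dots> = c / D + (real (card wild) / N) * (N / D)" using T0 N0 by (simp add: add_divide_distrib distrib_right)
    also have "\<dots> \<le> real r / D + \<beta> * (N / D)"
      using cr W' N0 D0 by (intro add_mono mult_right_mono divide_right_mono) auto
    finally show ?thesis using \<beta>s by (simp add: e_def D_def)
  qed
  have "acs_size (grid_in \<Omega> n) model - (e + \<eta>) \<le> mea_size \<Omega> (grid_symbol K h)"
    by (rule mea_size_greatest) (use up in \<open>force simp: m_def \<mu>_def T_def\<close>)
  moreover have "mea_size \<Omega> (grid_symbol K h) - (e + \<eta>) \<le> acs_size (grid_in \<Omega> n) model"
    by (rule acs_size_greatest) (use low in \<open>force+\<close>)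
  ultimately show "\<bar>acs_size (grid_in \<Omega> n) model - mea_size \<Omega> (grid_symbol K h)\<bar> \<le>
     2 * \<beta> / (measure lebesgue \<Omega>)\<^sup>2 + 2 * \<beta> / measure lebesgue \<Omega> + \<eta>"
    by (simp add: e_def \<mu>_def abs_le_iff)
qed

end

lemma dist_le_componentwise:
  fixes x y :: "('d :: finite) point"
  assumes "\<And>l. \<bar>x $ l - y $ l\<bar> \<le> t"
  shows "dist x y \<le> real CARD('d) * t"
proof -
  have "dist x y \<le> (\<Sum>l\<in>UNIV. \<bar>(x - y) $ l\<bar>)" unfolding dist_norm by (rule norm_le_l1_cart)
  also have "\<dots> \<le> (\<Sum>l\<in>(UNIV :: 'd set). t)" using assms by (intro sum_mono) auto
  finally show ?thesis by simp
qed

text \<open>The error budget is \<open>\<delta> + 3 * \<epsilon> / 8\<close> for the passage to the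
  model and twice \<open>\<epsilon> / 8\<close> for the model itself, in total
  \<open>7 * \<epsilon> / 8\<close>. The oscillation bounds are fixed before \<open>b\<close>, then
  \<open>\<beta>\<close>, and only then \<open>n\<close> is taken large.\<close>

theorem band_kernel_acs_size_tendsto:
  fixes \<nu> :: "nat \<Rightarrow> ('d :: {finite, linorder}) multi_index" and \<Omega> :: "'d point set"
  assumes \<nu>: "filterlim (\<lambda>n. Min (range (\<lambda>l. \<nu> n $ l))) at_top sequentially"
    and \<Omega>: "\<Omega> \<subseteq> cbox 0 1" "peano_jordan \<Omega>" "measure lebesgue \<Omega> > 0"
    and K: "finite K" and h: "\<And>\<kappa>. \<kappa> \<in> K \<Longrightarrow> continuous_on (cbox 0 1) (\<lambda>x. h x \<kappa>)"
  shows "(\<lambda>n. acs_size (grid_in \<Omega> (\<nu> n)) (band_kernel (\<nu> n) K h)) \<longlonglongrightarrow> mea_size \<Omega> (grid_symbol K h)"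
proof (rule LIMSEQ_I)
  fix \<epsilon> :: real assume \<epsilon>: "0 < \<epsilon>"
  define \<mu> where "\<mu> = measure lebesgue \<Omega>"
  define \<delta> where "\<delta> = \<epsilon> / 4"
  define d where "d = CARD('d)"
  have d0: "real d \<ge> 1" by (simp add: d_def Suc_le_eq)
  have \<mu>: "\<mu> > 0" and \<delta>: "\<delta> > 0" using \<Omega> \<epsilon> by (auto simp: \<mu>_def \<delta>_def)
  define gs where "gs = grid_symbol K h"
  have comp: "compact ((cbox 0 1 :: 'd point set) \<times> (freq_box :: 'd point set))"
    by (intro compact_Times) (auto simp: freq_box_def)
  have cont: "continuous_on ((cbox 0 1 :: 'd point set) \<times> freq_box) gs"
    unfolding gs_def by (rule grid_symbol_continuous[OF h])
  obtain C where C: "\<And>x \<kappa>. x \<in> cbox 0 1 \<Longrightarrow> \<kappa> \<in> K \<Longrightarrow> cmod (h x \<kappa>) \<le> C" "0 \<le> C"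
  proof -
    have "\<exists>B. \<forall>x\<in>cbox 0 1. cmod (h x \<kappa>) \<le> B" if "\<kappa> \<in> K" for \<kappa>
    proof -
      have "compact ((\<lambda>x. h x \<kappa>) ` cbox 0 1)" by (intro compact_continuous_image h that compact_cbox)
      hence "bounded ((\<lambda>x. h x \<kappa>) ` cbox 0 1)" by (rule compact_imp_bounded)
      thus ?thesis by (auto simp: bounded_iff)
    qed
    then obtain B where B: "\<And>\<kappa> x. \<kappa> \<in> K \<Longrightarrow> x \<in> cbox 0 1 \<Longrightarrow> cmod (h x \<kappa>) \<le> B \<kappa>" by metis
    have "cmod (h x \<kappa>) \<le> (\<Sum>\<kappa>\<in>K. \<bar>B \<kappa>\<bar>)" if "x \<in> cbox 0 1" "\<kappa> \<in> K" for x \<kappa>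
    proof -
      have "\<bar>B \<kappa>\<bar> \<le> (\<Sum>\<kappa>\<in>K. \<bar>B \<kappa>\<bar>)" by (rule member_le_sum) (use that K in auto)
      thus ?thesis using B[OF that(2,1)] by linarith
    qed
    moreover have "0 \<le> (\<Sum>\<kappa>\<in>K. \<bar>B \<kappa>\<bar>)" by (rule sum_nonneg) simp
    ultimately show ?thesis by (rule that)
  qed
  define C1 where "C1 = 2 * (real (card K) * C\<^sup>2 + (real (card K) * C)\<^sup>2)"
  have C1: "C1 \<ge> 0" by (simp add: C1_def)
  obtain k :: nat where k: "\<And>\<kappa> l. \<kappa> \<in> K \<Longrightarrow> \<bar>\<kappa> $ l\<bar> \<le> int k"
  proof -
    have "\<bar>\<kappa> $ l\<bar> \<le> int (\<Sum>\<kappa>\<in>K. \<Sum>l\<in>UNIV. nat \<bar>\<kappa> $ l\<bar>)" if "\<kappa> \<in> K" for \<kappa> l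
    proof -
      have "nat \<bar>\<kappa> $ l\<bar> \<le> (\<Sum>l\<in>UNIV. nat \<bar>\<kappa> $ l\<bar>)" by (rule member_le_sum) auto
      also have "\<dots> \<le> (\<Sum>\<kappa>\<in>K. \<Sum>l\<in>UNIV. nat \<bar>\<kappa> $ l\<bar>)" by (rule member_le_sum[of \<kappa> K]) (use that K in auto)
      finally show ?thesis by linarith
    qed
    thus ?thesis by (rule that)
  qed
  \<comment> \<open>Turns a squared Frobenius norm per grid point into a normalised count:
    \<open>2 / \<mu>\<close> bounds the ratio of grid size to domain size, and
    \<open>\<delta>^2\<close> comes from Chebyshev's inequality.\<close>
  define fac where "fac = 2 / \<mu> / \<delta>\<^sup>2"
  have fac: "fac > 0" using \<mu> \<delta> by (simp add: fac_def)
  obtain \<delta>1 where \<delta>1: "\<delta>1 > 0" "\<And>z z'. z \<in> cbox 0 1 \<times> freq_box \<Longrightarrow> z' \<in> cbox 0 1 \<times> freq_box \<Longrightarrow> dist z z' < \<delta>1 \<Longrightarrow> cmod (gs z - gs z') < \<epsilon> / 8"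
    using compact_uniformly_continuous[OF cont comp, unfolded uniformly_continuous_on_def, rule_format, of "\<epsilon> / 8"] \<epsilon>
    by (auto simp: dist_norm norm_minus_commute)
  \<comment> \<open>Chosen so that the deep rows contribute at most \<open>\<epsilon> / 8\<close>;
    the summand 1 keeps the denominator positive for an empty band.\<close>
  define \<eta>1 where "\<eta>1 = sqrt (\<epsilon> / 8 / fac / (real (card K) + 1))"
  have \<eta>1: "\<eta>1 > 0" using \<epsilon> fac by (simp add: \<eta>1_def add_nonneg_pos)
  have \<eta>1b: "real (card K) * \<eta>1\<^sup>2 * fac \<le> \<epsilon> / 8"
  proof -
    have "\<eta>1\<^sup>2 = \<epsilon> / 8 / fac / (real (card K) + 1)" unfolding \<eta>1_def using \<epsilon> fac by (intro real_sqrt_pow2) auto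
    hence "real (card K) * \<eta>1\<^sup>2 * fac = (real (card K) / (real (card K) + 1)) * (\<epsilon> / 8)" using fac by simp
    also have "\<dots> \<le> 1 * (\<epsilon> / 8)" using \<epsilon> by (intro mult_right_mono) auto
    finally show ?thesis by simp
  qed
  obtain \<delta>2 where \<delta>2: "\<delta>2 > 0" "\<And>x y \<kappa>. x \<in> cbox 0 1 \<Longrightarrow> y \<in> cbox 0 1 \<Longrightarrow> \<kappa> \<in> K \<Longrightarrow> dist x y < \<delta>2 \<Longrightarrow> cmod (h x \<kappa> - h y \<kappa>) \<le> \<eta>1"
  proof -
    have "\<exists>t>0. \<forall>x\<in>cbox 0 1. \<forall>y\<in>cbox 0 1. dist x y < t \<longrightarrow> cmod (h x \<kappa> - h y \<kappa>) < \<eta>1" if "\<kappa> \<in> K" for \<kappa>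
      using compact_uniformly_continuous[OF h[OF that] compact_cbox, unfolded uniformly_continuous_on_def, rule_format, of "\<eta>1"] \<eta>1
      by (auto simp: dist_norm norm_minus_commute) 
    then obtain t where t: "\<And>\<kappa>. \<kappa> \<in> K \<Longrightarrow> t \<kappa> > 0" "\<And>\<kappa> x y. \<kappa> \<in> K \<Longrightarrow> x\<in>cbox 0 1 \<Longrightarrow> y\<in>cbox 0 1 \<Longrightarrow> dist x y < t \<kappa> \<Longrightarrow> cmod (h x \<kappa> - h y \<kappa>) < \<eta>1" by metis
    define t0 where "t0 = Min (insert 1 (t ` K))"
    have "t0 > 0" using t(1) K by (simp add: t0_def)
    moreover have "t0 \<le> t \<kappa>" if "\<kappa> \<in> K" for \<kappa> using that K by (simp add: t0_def)
    ultimately show ?thesis using t(2) that by (meson less_le_trans less_imp_le)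
  qed
  \<comment> \<open>\<open>b\<close> is made large enough for the frequency mesh to be fine and for
    the rows near block faces to be few; it does not depend on \<open>n\<close>.\<close>
  obtain b :: nat where b: "b > 0" "2 * k \<le> b" "real d * (2 * pi / real b) < \<delta>1 / 2"
      "C1 * (1 - (1 - 2 * real k / real b) ^ d) * fac < \<epsilon> / 8"
  proof -
    have "(\<lambda>b. real d * (2 * pi / real b)) \<longlonglongrightarrow> real d * 0"
      by (intro tendsto_mult tendsto_const lim_const_over_n)
    hence 1: "eventually (\<lambda>b. real d * (2 * pi / real b) < \<delta>1 / 2) sequentially"
      by (rule order_tendstoD) (use \<delta>1 in simp)
    have "(\<lambda>b. C1 * (1 - (1 - 2 * real k / real b) ^ d) * fac) \<longlonglongrightarrow> C1 * (1 - (1 - 0) ^ d) * fac"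
      by (intro tendsto_intros lim_const_over_n)
    hence 2: "eventually (\<lambda>b. C1 * (1 - (1 - 2 * real k / real b) ^ d) * fac < \<epsilon> / 8) sequentially"
      by (rule order_tendstoD) (use \<epsilon> in simp)
    have "eventually (\<lambda>b. b > 0 \<and> 2 * k \<le> b \<and> real d * (2 * pi / real b) < \<delta>1 / 2 \<and>
      C1 * (1 - (1 - 2 * real k / real b) ^ d) * fac < \<epsilon> / 8) sequentially"
      using 1 2 eventually_gt_at_top[of 0] eventually_ge_at_top[of "2 * k"] by eventually_elim auto
    thus ?thesis using that by (auto simp: eventually_sequentially)
  qed
  \<comment> \<open>The three entries serve the hypothesis of \<open>model_acs_size\<close>, its
    error term, and the wild rows in the Frobenius bound; \<open>C1 + 1\<close> avoids a division by
    zero.\<close>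
  define \<beta> where "\<beta> = min (\<mu> / 2) (min (\<epsilon> / 8 / (2 / \<mu>\<^sup>2 + 2 / \<mu>)) (\<epsilon> / 8 / ((C1 + 1) * fac)))"
  have \<beta>: "\<beta> > 0" "\<beta> \<le> \<mu> / 2"
  proof -
    have "2 / \<mu>\<^sup>2 + 2 / \<mu> > 0" "(C1 + 1) * fac > 0" using \<mu> C1 fac by (auto intro!: add_pos_pos)
    thus "\<beta> > 0" using \<mu> \<epsilon> unfolding \<beta>_def min_less_iff_conj by (intro conjI divide_pos_pos) auto
    show "\<beta> \<le> \<mu> / 2" unfolding \<beta>_def by (rule min.cobounded1)
  qed
  have \<beta>1: "2 * \<beta> / \<mu>\<^sup>2 + 2 * \<beta> / \<mu> \<le> \<epsilon> / 8"
  proof -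
    have p: "2 / \<mu>\<^sup>2 + 2 / \<mu> > 0" using \<mu> by (simp add: add_pos_pos)
    have "\<beta> \<le> \<epsilon> / 8 / (2 / \<mu>\<^sup>2 + 2 / \<mu>)" by (simp add: \<beta>_def)
    hence "\<beta> * (2 / \<mu>\<^sup>2 + 2 / \<mu>) \<le> \<epsilon> / 8" using p by (simp only: pos_le_divide_eq)
    thus ?thesis by (simp add: algebra_simps)
  qed
  have \<beta>2: "C1 * \<beta> * fac \<le> \<epsilon> / 8"
  proof -
    have p: "(C1 + 1) * fac > 0" using C1 fac by simp
    have "\<beta> \<le> \<epsilon> / 8 / ((C1 + 1) * fac)" by (simp add: \<beta>_def)
    hence "\<beta> * ((C1 + 1) * fac) \<le> \<epsilon> / 8" using p by (simp only: pos_le_divide_eq)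
    moreover have "C1 * \<beta> * fac \<le> \<beta> * ((C1 + 1) * fac)" using \<beta> fac by (simp add: algebra_simps)
    ultimately show ?thesis by linarith
  qed
  \<comment> \<open>Once all components of \<open>n\<close> exceed \<open>m\<close>, points at most
    one block side apart in each coordinate are closer than both moduli of continuity
    require.\<close>
  obtain m :: nat where m: "real d * real b / min (\<delta>1 / 2) \<delta>2 < real m" using reals_Archimedean2[of "real d * real b / min (\<delta>1 / 2) \<delta>2"] by blast
  have "eventually (\<lambda>n. Suc m \<le> Min (range (\<lambda>l. \<nu> n $ l))) sequentially"
    using \<nu> by (auto simp: filterlim_at_top)
  moreover have "eventually (\<lambda>n. real (card {i \<in> grid (\<nu> n). \<not> tame \<Omega> (\<nu> n) b i}) \<le> \<beta> * real (grid_size (\<nu> n))) sequentially"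
    by (rule few_wild_indices[OF \<nu> \<Omega>(1,2) \<beta>(1)])
  ultimately have "eventually (\<lambda>n. norm (acs_size (grid_in \<Omega> (\<nu> n)) (band_kernel (\<nu> n) K h) - mea_size \<Omega> (grid_symbol K h)) < \<epsilon>) sequentially"
  proof eventually_elim
    case (elim n)
    have nl: "Suc m \<le> \<nu> n $ l" for l
    proof -
      have "Min (range (\<lambda>l. \<nu> n $ l)) \<le> \<nu> n $ l" by (rule Min_le) auto
      thus ?thesis using elim(1) by linarith
    qed
    hence n0: "\<nu> n $ l > 0" for l using less_le_trans[of 0 "Suc m"] by blast
    have bn: "real d * (real b / real (\<nu> n $ l)) < min (\<delta>1 / 2) \<delta>2" for l
    proof -
      have "min (\<delta>1 / 2) \<delta>2 > 0" using \<delta>1 \<delta>2 by simp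
      hence "real d * real b < real m * min (\<delta>1 / 2) \<delta>2" using m by (simp add: pos_divide_less_eq)
      also have "\<dots> \<le> real (\<nu> n $ l) * min (\<delta>1 / 2) \<delta>2" using nl[of l] \<delta>1 \<delta>2 by (intro mult_right_mono) auto
      finally have f: "real d * real b < min (\<delta>1 / 2) \<delta>2 * real (\<nu> n $ l)" by (simp only: mult.commute)
      have "real (\<nu> n $ l) > 0" using n0[of l] by simp
      from f pos_divide_less_eq[OF this, of "real d * real b" "min (\<delta>1 / 2) \<delta>2"]
      show ?thesis by (simp only: times_divide_eq_right)
    qed
    have dx: "dist x y < min (\<delta>1 / 2) \<delta>2" if "\<And>l. \<bar>x $ l - y $ l\<bar> \<le> real b / real (\<nu> n $ l)" for x y :: "'d point"
    proof -
      define t where "t = Max (range (\<lambda>l. real b / real (\<nu> n $ l)))"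
      have "t \<in> range (\<lambda>l. real b / real (\<nu> n $ l))" unfolding t_def by (rule Max_in) auto
      hence "real d * t < min (\<delta>1 / 2) \<delta>2" using bn by auto
      moreover have "real b / real (\<nu> n $ l) \<le> t" for l unfolding t_def by (rule Max_ge) auto
      hence "\<bar>x $ l - y $ l\<bar> \<le> t" for l using that[of l] order_trans by blast
      hence "dist x y \<le> real d * t" unfolding d_def by (rule dist_le_componentwise)
      ultimately show ?thesis by linarith
    qed
    note mpos = \<Omega>(3) and bb = b
    interpret symbol_model "\<nu> n" \<Omega> b K h "\<epsilon> / 8"
    proof
      fix x y \<theta> \<theta>' :: "'d point"
      assume a: "x \<in> cbox 0 1" "y \<in> cbox 0 1" "\<theta> \<in> freq_box" "\<theta>' \<in> freq_box"
        "\<And>l. \<bar>x $ l - y $ l\<bar> \<le> real b / real (\<nu> n $ l)" "\<And>l. \<bar>\<theta> $ l - \<theta>' $ l\<bar> \<le> 2 * pi / real b"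
      have "dist (x, \<theta>) (y, \<theta>') \<le> dist x y + dist \<theta> \<theta>'"
        unfolding dist_Pair_Pair by (rule sqrt_sum_squares_le_sum) auto
      also have "\<dots> < \<delta>1 / 2 + \<delta>1 / 2"
        using dx[OF a(5)] dist_le_componentwise[OF a(6)] b(3) by (intro add_strict_mono) (auto simp: d_def)
      finally have "cmod (gs (x, \<theta>) - gs (y, \<theta>')) < \<epsilon> / 8" using a by (intro \<delta>1(2)) auto
      thus "cmod (grid_symbol K h (x, \<theta>) - grid_symbol K h (y, \<theta>')) \<le> \<epsilon> / 8" by (simp add: gs_def)
    qed (use b K n0 \<Omega> cont in \<open>auto simp: gs_def\<close>)
    have W: "real (card wild) \<le> \<beta> * real (grid_size (\<nu> n))" using elim(2) by (simp add: wild_def)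
    define S where "S = grid_in \<Omega> (\<nu> n)"
    have S: "finite S" by (simp add: S_def)
    define H where "H = band_kernel (\<nu> n) K h"
    define F where "F = (\<Sum>i\<in>S. \<Sum>j\<in>S. (cmod (H i j - model i j))\<^sup>2)"
    note ma = model_acs_size[OF mpos \<beta>(2)[unfolded \<mu>_def] W]
    have D: "real (card S) > 0" using ma(3) \<epsilon> by (simp add: S_def)
    have F: "F \<le> real (grid_size (\<nu> n)) * (real (card K) * \<eta>1\<^sup>2 + C1 * (\<beta> + (1 - (1 - 2 * real k / real b) ^ d)))"
      unfolding F_def S_def H_def C1_def d_def
    proof (rule frobenius_bound[OF bb(2) k _ _ C])
      show "cmod (h x \<kappa> - h y \<kappa>) \<le> \<eta>1"
        if "x \<in> cbox 0 1" "y \<in> cbox 0 1" "\<kappa> \<in> K" "\<And>l. \<bar>x $ l - y $ l\<bar> \<le> real b / real (\<nu> n $ l)" for x y \<kappa>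
        using \<delta>2(2)[OF that(1-3)] dx[OF that(4)] by simp
    qed (use \<eta>1 elim(2) in auto)
    have q: "F / real (card S) / \<delta>\<^sup>2 \<le> 3 * \<epsilon> / 8"
    proof -
      define X where "X = real (card K) * \<eta>1\<^sup>2 + C1 * (\<beta> + (1 - (1 - 2 * real k / real b) ^ d))"
      have X0: "X \<ge> 0"
      proof -
        have "2 * real k / real b \<le> 1" using bb by (simp add: divide_le_eq_1)
        hence "(1 - 2 * real k / real b) ^ d \<le> 1" using bb by (intro power_le_one) auto
        thus ?thesis using C1 \<beta> by (auto simp: X_def intro!: add_nonneg_nonneg mult_nonneg_nonneg)
      qed
      have "F / real (card S) \<le> (real (grid_size (\<nu> n)) * X) / real (card S)"
        using F D by (intro divide_right_mono) (auto simp: X_def)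
      also have "\<dots> = real (grid_size (\<nu> n)) / real (card S) * X" by simp
      also have "\<dots> \<le> 2 / \<mu> * X" using ma(2) \<epsilon> X0 by (intro mult_right_mono) (auto simp: \<mu>_def S_def)
      finally have "F / real (card S) / \<delta>\<^sup>2 \<le> 2 / \<mu> * X / \<delta>\<^sup>2" by (intro divide_right_mono) auto
      also have "\<dots> = real (card K) * \<eta>1\<^sup>2 * fac + C1 * \<beta> * fac + C1 * (1 - (1 - 2 * real k / real b) ^ d) * fac"
        by (simp add: X_def fac_def algebra_simps add_divide_distrib diff_divide_distrib)
      finally show ?thesis using \<eta>1b \<beta>2 bb(4) by linarith
    qed
    obtain r where r: "sv_bound S (\<lambda>i j. H i j - model i j) r \<delta>" "real r * \<delta>\<^sup>2 \<le> F"
      using sv_bound_frobenius[OF S \<delta>, of "\<lambda>i j. H i j - model i j"] unfolding F_def by blast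
    have "acs_size S (\<lambda>i j. H i j - model i j) \<le> real r / real (card S) + \<delta>"
      by (rule acs_size_le[OF r(1)]) (use \<delta> in simp)
    also have "real r / real (card S) \<le> F / real (card S) / \<delta>\<^sup>2"
    proof -
      have "real r \<le> F / \<delta>\<^sup>2" using r(2) \<delta> by (simp add: pos_le_divide_eq)
      hence "real r / real (card S) \<le> F / \<delta>\<^sup>2 / real (card S)" by (intro divide_right_mono) auto
      thus ?thesis by (simp add: mult.commute)
    qed
    finally have "acs_size S (\<lambda>i j. H i j - model i j) \<le> 3 * \<epsilon> / 8 + \<delta>" using q by linarith
    moreover have "\<bar>acs_size S H - acs_size S model\<bar> \<le> acs_size S (\<lambda>i j. H i j - model i j)"
      by (rule acs_size_diff_triangle[OF S])
    moreover have "\<bar>acs_size S model - mea_size \<Omega> (grid_symbol K h)\<bar> \<le> \<epsilon> / 8 + \<epsilon> / 8"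
      using ma(1) \<beta>1 \<epsilon> unfolding S_def \<mu>_def by linarith
    ultimately show ?case using \<epsilon> unfolding S_def H_def \<delta>_def real_norm_def by linarith
  qed
  thus "\<exists>no. \<forall>n\<ge>no. norm (acs_size (grid_in \<Omega> (\<nu> n)) (band_kernel (\<nu> n) K h) - mea_size \<Omega> (grid_symbol K h)) < \<epsilon>"
    by (simp add: eventually_sequentially)
qed

section \<open>Convergence in measure on the domain\<close>

lemma d_mea_mea_size: "d_mea \<Omega> f g = mea_size \<Omega> (\<lambda>z. f z - g z)"
  by (simp add: d_mea_def mea_size_def)

lemma mea_size_cong:
  fixes \<Omega> :: "('d :: finite) point set"
  assumes "\<And>z. z \<in> \<Omega> \<times> freq_box \<Longrightarrow> cmod (f z) = cmod (g z)"
  shows "mea_size \<Omega> f = mea_size \<Omega> g"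
proof -
  have "{z \<in> \<Omega> \<times> freq_box. cmod (f z) > L} = {z \<in> \<Omega> \<times> freq_box. cmod (g z) > L}" for L using assms by auto
  thus ?thesis by (simp add: mea_size_def)
qed

lemma mea_size_nonneg: "0 \<le> mea_size \<Omega> f"
  by (rule mea_size_greatest) simp

locale jordan_domain =
  fixes \<Omega> :: "('d :: {finite, linorder}) point set"
  assumes \<Omega>: "\<Omega> \<subseteq> cbox 0 1" "peano_jordan \<Omega>" "measure lebesgue \<Omega> > 0"
begin

lemma domain_lmeasurable: "\<Omega> \<times> (freq_box :: 'd point set) \<in> lmeasurable"
  by (rule peano_jordan_Times_freq_box(1)[OF \<Omega>(2)])

lemma volume_pos: "measure lebesgue \<Omega> * (2 * pi) ^ CARD('d) > 0"
  using \<Omega> by simp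

text \<open>The scheme of \<open>acs_size_triangle\<close>: the superlevel set of a sum at
  \<open>L + M\<close> is covered by those of the summands at \<open>L\<close> and
  \<open>M\<close>.\<close>

lemma mea_size_triangle:
  assumes f: "f \<in> symbol_space \<Omega>" and g: "g \<in> symbol_space \<Omega>"
  shows "mea_size \<Omega> (\<lambda>z. f z + g z) \<le> mea_size \<Omega> f + mea_size \<Omega> g"
proof -
  let ?V = "measure lebesgue \<Omega> * (2 * pi) ^ CARD('d)"
  let ?m = "\<lambda>f L. measure lebesgue {z \<in> \<Omega> \<times> (freq_box :: 'd point set). cmod (f z :: complex) > (L :: real)}"
  let ?s = "mea_size \<Omega> (\<lambda>z. f z + g z)"
  have meas: "{z \<in> \<Omega> \<times> freq_box. cmod (f z) > L} \<in> lmeasurable" "{z \<in> \<Omega> \<times> freq_box. cmod (g z) > L} \<in> lmeasurable"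
     "{z \<in> \<Omega> \<times> freq_box. cmod (f z + g z) > L} \<in> lmeasurable" for L
    using f g by (auto intro!: super_level_lmeasurable[OF domain_lmeasurable] simp: symbol_space_def)
  have 1: "?s \<le> (?m f L / ?V + L) + (?m g M / ?V + M)" if "0 \<le> L" "0 \<le> M" for L M
  proof -
    have "?m (\<lambda>z. f z + g z) (L + M) \<le> measure lebesgue ({z \<in> \<Omega> \<times> freq_box. cmod (f z) > L} \<union> {z \<in> \<Omega> \<times> freq_box. cmod (g z) > M})"
    proof (rule measure_mono_fmeasurable)
      show "{z \<in> \<Omega> \<times> freq_box. cmod (f z + g z) > L + M} \<subseteq> {z \<in> \<Omega> \<times> freq_box. cmod (f z) > L} \<union> {z \<in> \<Omega> \<times> freq_box. cmod (g z) > M}"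
      proof
        fix z assume "z \<in> {z \<in> \<Omega> \<times> freq_box. cmod (f z + g z) > L + M}"
        thus "z \<in> {z \<in> \<Omega> \<times> freq_box. cmod (f z) > L} \<union> {z \<in> \<Omega> \<times> freq_box. cmod (g z) > M}"
          using norm_triangle_ineq[of "f z" "g z"] by auto
      qed
    qed (use meas in auto)
    also have "\<dots> \<le> ?m f L + ?m g M" by (rule measure_Un_le) (use meas in auto)
    finally have "?m (\<lambda>z. f z + g z) (L + M) / ?V \<le> (?m f L + ?m g M) / ?V"
      using volume_pos by (intro divide_right_mono) auto
    thus ?thesis using mea_size_le[of "L + M" \<Omega> "\<lambda>z. f z + g z"] that by (simp add: add_divide_distrib)
  qed
  have "?s - (?m f L / ?V + L) \<le> mea_size \<Omega> g" if "0 \<le> L" for L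
    by (rule mea_size_greatest) (use 1[OF that] in \<open>simp add: algebra_simps\<close>)
  hence "?s - mea_size \<Omega> g \<le> mea_size \<Omega> f"
    by (intro mea_size_greatest) (simp add: algebra_simps)
  thus ?thesis by simp
qed

lemma symbol_space_diff: "f \<in> symbol_space \<Omega> \<Longrightarrow> g \<in> symbol_space \<Omega> \<Longrightarrow> (\<lambda>z. f z - g z) \<in> symbol_space \<Omega>"
  by (simp add: symbol_space_def)

lemma d_mea_refl: "d_mea \<Omega> f f = 0"
proof -
  have "mea_size \<Omega> (\<lambda>z. f z - f z) \<le> 0" using mea_size_le[of 0 \<Omega> "\<lambda>z. f z - f z"] by simp
  thus ?thesis using mea_size_nonneg[of \<Omega> "\<lambda>z. f z - f z"] by (simp add: d_mea_mea_size)
qed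

lemma d_mea_commute: "d_mea \<Omega> f g = d_mea \<Omega> g f"
  unfolding d_mea_mea_size by (rule mea_size_cong) (rule norm_minus_commute)

lemma d_mea_triangle:
  assumes "f \<in> symbol_space \<Omega>" "g \<in> symbol_space \<Omega>" "k \<in> symbol_space \<Omega>"
  shows "d_mea \<Omega> f k \<le> d_mea \<Omega> f g + d_mea \<Omega> g k"
  using mea_size_triangle[OF symbol_space_diff[OF assms(1,2)] symbol_space_diff[OF assms(2,3)]]
  by (simp add: d_mea_mea_size)

lemma pseudometric_d_mea: "pseudometric_on (symbol_space \<Omega>) (d_mea \<Omega>)"
  unfolding pseudometric_on_def
  using d_mea_refl d_mea_commute d_mea_triangle mea_size_nonneg by (auto simp: d_mea_mea_size)

text \<open>If the distance vanishes, every \<open>G t\<close> with \<open>t > 0\<close> is null: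
  for \<open>e \<le> t\<close> a measure of \<open>G t\<close> above \<open>e * ?V\<close> would
  bound all terms of the infimum below by \<open>e\<close>, through the volume for
  \<open>L \<le> t\<close> and through \<open>L\<close> itself beyond. Countably many
  \<open>G t\<close> exhaust \<open>G 0\<close>. Conversely, the term at \<open>L = 0\<close> is
  zero.\<close>

lemma d_mea_eq_0_iff:
  assumes f: "f \<in> symbol_space \<Omega>" and g: "g \<in> symbol_space \<Omega>"
  shows "d_mea \<Omega> f g = 0 \<longleftrightarrow> (AE z in lebesgue_on (\<Omega> \<times> freq_box). f z = g z)"
proof -
  let ?V = "measure lebesgue \<Omega> * (2 * pi) ^ CARD('d)"
  define u where "u z = f z - g z" for z
  define G where "G L = {z \<in> \<Omega> \<times> (freq_box :: 'd point set). cmod (u z) > (L :: real)}" for L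
  have u: "u \<in> borel_measurable (lebesgue_on (\<Omega> \<times> freq_box))"
    using symbol_space_diff[OF f g] by (simp add: symbol_space_def u_def[abs_def])
  have G: "G L \<in> lmeasurable" for L unfolding G_def by (rule super_level_lmeasurable[OF domain_lmeasurable u])
  have ae: "(AE z in lebesgue_on (\<Omega> \<times> freq_box). f z = g z) \<longleftrightarrow> G 0 \<in> null_sets lebesgue"
  proof -
    have "(AE z in lebesgue_on (\<Omega> \<times> freq_box). f z = g z) \<longleftrightarrow> {z \<in> space (lebesgue_on (\<Omega> \<times> freq_box)). f z \<noteq> g z} \<in> null_sets (lebesgue_on (\<Omega> \<times> freq_box))"
    proof (rule AE_iff_null)
      have "G 0 \<in> sets (lebesgue_on (\<Omega> \<times> freq_box))"
        using G[of 0] domain_lmeasurable by (auto simp: sets_restrict_space_iff fmeasurable_def G_def)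
      moreover have "G 0 = {x \<in> space (lebesgue_on (\<Omega> \<times> freq_box)). f x \<noteq> g x}" by (auto simp: G_def u_def)
      ultimately show "{x \<in> space (lebesgue_on (\<Omega> \<times> freq_box)). f x \<noteq> g x} \<in> sets (lebesgue_on (\<Omega> \<times> freq_box))" by simp
    qed
    also have "{z \<in> space (lebesgue_on (\<Omega> \<times> freq_box)). f z \<noteq> g z} = G 0" by (auto simp: G_def u_def)
    also have "G 0 \<in> null_sets (lebesgue_on (\<Omega> \<times> freq_box)) \<longleftrightarrow> G 0 \<in> null_sets lebesgue"
      using domain_lmeasurable by (subst null_sets_restrict_space) (auto simp: G_def fmeasurable_def)
    finally show ?thesis .
  qed
  show ?thesis
  proof
    assume 0: "d_mea \<Omega> f g = 0"
    have null: "G t \<in> null_sets lebesgue" if t: "t > 0" for t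
    proof -
      have "measure lebesgue (G t) \<le> e * ?V" if e: "0 < e" "e \<le> t" for e
      proof (rule ccontr)
        assume *: "\<not> ?thesis"
        have "e \<le> mea_size \<Omega> u"
        proof (rule mea_size_greatest)
          fix L :: real assume L: "0 \<le> L"
          show "e \<le> measure lebesgue {z \<in> \<Omega> \<times> freq_box. cmod (u z) > L} / ?V + L"
          proof (cases "L \<le> t")
            case True
            have "measure lebesgue (G t) \<le> measure lebesgue (G L)"
              by (rule measure_mono_fmeasurable) (use G True in \<open>auto simp: G_def\<close>)
            hence "e * ?V \<le> measure lebesgue (G L)" using * by linarith
            hence "e \<le> measure lebesgue (G L) / ?V" using volume_pos by (simp only: pos_le_divide_eq)
            thus ?thesis using L by (simp add: G_def)
          next
            case False
            moreover have "0 \<le> measure lebesgue {z \<in> \<Omega> \<times> (freq_box :: 'd point set). cmod (u z) > L} / ?V"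
              using volume_pos by (intro divide_nonneg_pos) auto
            ultimately show ?thesis using e by linarith
          qed
        qed
        thus False using 0 e by (simp add: d_mea_mea_size u_def[abs_def])
      qed
      hence le: "measure lebesgue (G t) \<le> e * ?V" if "0 < e" "e \<le> t" for e using that by blast
      have "measure lebesgue (G t) = 0"
      proof (rule ccontr)
        assume "measure lebesgue (G t) \<noteq> 0"
        hence p: "measure lebesgue (G t) > 0" by (simp add: zero_less_measure_iff)
        define e where "e = min t (measure lebesgue (G t) / ?V / 2)"
        have "e > 0" "e \<le> t" using p t volume_pos by (auto simp: e_def)
        from le[OF this] have "measure lebesgue (G t) \<le> e * ?V" .
        also have "\<dots> \<le> measure lebesgue (G t) / ?V / 2 * ?V" using volume_pos by (intro mult_right_mono) (auto simp: e_def)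
        also have "\<dots> = measure lebesgue (G t) / 2" using \<Omega>(3) by simp
        finally show False using p by simp
      qed
      thus ?thesis using G[of t] by (simp add: null_sets_def fmeasurable_def emeasure_eq_ennreal_measure less_top[symmetric])
    qed
    have "G 0 = (\<Union>n. G (1 / real (Suc n)))"
    proof safe
      fix z assume z: "z \<in> G 0"
      then obtain n where "1 / real (Suc n) < cmod (u z)" using nat_approx_posE[of "cmod (u z)"] by (auto simp: G_def)
      thus "z \<in> (\<Union>n. G (1 / real (Suc n)))" using z by (auto simp: G_def)
    next
      fix z n assume z: "z \<in> G (1 / real (Suc n))"
      have "0 < 1 / real (Suc n)" by simp
      with z show "z \<in> G 0" unfolding G_def by (auto intro: less_trans)
    qed
    also have "\<dots> \<in> null_sets lebesgue" using null by (intro null_sets_UN) auto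
    finally show "AE z in lebesgue_on (\<Omega> \<times> freq_box). f z = g z" using ae by simp
  next
    assume "AE z in lebesgue_on (\<Omega> \<times> freq_box). f z = g z"
    hence "measure lebesgue (G 0) = 0" using ae by (simp add: measure_eq_0_null_sets)
    hence "mea_size \<Omega> u \<le> 0" using mea_size_le[of 0 \<Omega> u] by (simp add: G_def)
    thus "d_mea \<Omega> f g = 0" using mea_size_nonneg[of \<Omega> u] by (simp add: d_mea_mea_size u_def[abs_def])
  qed
qed

lemma cube_measurable_imp_symbol_space:
  assumes "k \<in> borel_measurable (lebesgue_on (cbox 0 1 \<times> freq_box))"
  shows "k \<in> symbol_space \<Omega>"
  unfolding symbol_space_def
  by (rule measurable_restrict_mono[OF assms]) (use \<Omega> in auto)

text \<open>The level \<open>e / 2\<close> already makes the infimum small, and passing from the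
  cube to the domain only shrinks the superlevel set.\<close>

lemma conv_in_measure_mea_size:
  assumes conv: "conv_in_measure (cbox 0 1 \<times> freq_box) g k"
    and g: "\<And>m. g m \<in> borel_measurable (lebesgue_on (cbox 0 1 \<times> freq_box))"
    and k: "k \<in> borel_measurable (lebesgue_on (cbox 0 1 \<times> freq_box))"
  shows "(\<lambda>m. mea_size \<Omega> (\<lambda>z. g m z - k z)) \<longlonglongrightarrow> 0"
proof (rule LIMSEQ_I)
  fix e :: real assume e: "0 < e"
  let ?V = "measure lebesgue \<Omega> * (2 * pi) ^ CARD('d)"
  let ?Q = "(cbox 0 1 :: 'd point set) \<times> (freq_box :: 'd point set)"
  have Q: "?Q \<in> lmeasurable" by (rule cube_Times_freq_box_lmeasurable)
  have "(\<lambda>m. measure lebesgue {z \<in> ?Q. cmod (g m z - k z) > e / 2}) \<longlonglongrightarrow> 0"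
  proof -
    have "e / 2 > 0" using e by simp
    thus ?thesis using conv unfolding conv_in_measure_def by blast
  qed
  hence "eventually (\<lambda>m. measure lebesgue {z \<in> ?Q. cmod (g m z - k z) > e / 2} < e / 2 * ?V) sequentially"
    by (rule order_tendstoD) (use e volume_pos in simp)
  hence "eventually (\<lambda>m. norm (mea_size \<Omega> (\<lambda>z. g m z - k z) - 0) < e) sequentially"
  proof eventually_elim
    case (elim m)
    have d: "(\<lambda>z. g m z - k z) \<in> borel_measurable (lebesgue_on ?Q)" using g k by simp
    have "measure lebesgue {z \<in> \<Omega> \<times> freq_box. cmod (g m z - k z) > e / 2} \<le> measure lebesgue {z \<in> ?Q. cmod (g m z - k z) > e / 2}"
    proof (rule measure_mono_fmeasurable)
      show "{z \<in> \<Omega> \<times> freq_box. cmod (g m z - k z) > e / 2} \<in> sets lebesgue"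
        using super_level_lmeasurable[OF domain_lmeasurable, of "\<lambda>z. g m z - k z" "e / 2"] cube_measurable_imp_symbol_space[OF d]
        by (auto simp: symbol_space_def)
      show "{z \<in> ?Q. cmod (g m z - k z) > e / 2} \<in> lmeasurable" by (rule super_level_lmeasurable[OF Q d])
    qed (use \<Omega> in auto)
    hence "measure lebesgue {z \<in> \<Omega> \<times> freq_box. cmod (g m z - k z) > e / 2} < e / 2 * ?V" using elim by linarith
    hence "measure lebesgue {z \<in> \<Omega> \<times> freq_box. cmod (g m z - k z) > e / 2} / ?V < e / 2"
      using volume_pos by (simp only: pos_divide_less_eq)
    moreover have "mea_size \<Omega> (\<lambda>z. g m z - k z) \<le> measure lebesgue {z \<in> \<Omega> \<times> freq_box. cmod (g m z - k z) > e / 2} / ?V + e / 2"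
      by (rule mea_size_le) (use e in simp)
    ultimately have "mea_size \<Omega> (\<lambda>z. g m z - k z) < e" by linarith
    thus ?case using mea_size_nonneg[of \<Omega> "\<lambda>z. g m z - k z"] by simp
  qed
  thus "\<exists>no. \<forall>n\<ge>no. norm (mea_size \<Omega> (\<lambda>z. g n z - k z) - 0) < e" by (simp add: eventually_sequentially)
qed

end

section \<open>GLT sequences\<close>

lemma trig_poly_support:
  assumes "trig_poly f"
  shows "finite {k. fourier_coeff f k \<noteq> 0}" and "f \<theta> = (\<Sum>k | fourier_coeff f k \<noteq> 0. fourier_coeff f k * freq_char k \<theta>)"
proof -
  obtain K c where K: "finite K" "f = (\<lambda>\<theta>. \<Sum>k\<in>K. c k * freq_char k \<theta>)" using assms unfolding trig_poly_def by blast
  have fc: "fourier_coeff f k = (if k \<in> K then c k else 0)" for k unfolding K(2) by (rule fourier_coeff_trig_sum[OF K(1)])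
  have sub: "{k. fourier_coeff f k \<noteq> 0} \<subseteq> K" by (auto simp: fc)
  show "finite {k. fourier_coeff f k \<noteq> 0}" by (rule finite_subset[OF sub K(1)])
  have "f \<theta> = (\<Sum>k\<in>K. fourier_coeff f k * freq_char k \<theta>)" unfolding K(2) by (intro sum.cong) (simp_all add: fc[unfolded K(2)])
  also have "\<dots> = (\<Sum>k | fourier_coeff f k \<noteq> 0. fourier_coeff f k * freq_char k \<theta>)"
    by (rule sum.mono_neutral_right[OF K(1) sub]) auto
  finally show "f \<theta> = (\<Sum>k | fourier_coeff f k \<noteq> 0. fourier_coeff f k * freq_char k \<theta>)" .
qed

text \<open>Terms are collected by frequency: \<open>K\<close> is the union of the supports, and
  \<open>h x k\<close> gathers the coefficients of \<open>k\<close>. The approximant then agrees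
  with a banded kernel entry by entry, without error.\<close>

lemma glt_approx_band:
  fixes a :: "nat \<Rightarrow> ('d :: {finite, linorder}) point \<Rightarrow> complex"
  assumes af: "\<And>i. i < r \<Longrightarrow> smooth_on_set (cbox 0 1) (a i) \<and> trig_poly (f i)"
  obtains K h where "finite K" "\<And>\<kappa>. \<kappa> \<in> K \<Longrightarrow> continuous_on (cbox 0 1) (\<lambda>x. h x \<kappa>)"
    "\<And>x \<theta>. grid_symbol K h (x, \<theta>) = (\<Sum>i<r. a i x * f i \<theta>)"
    "\<And>n i j. i \<in> grid n \<Longrightarrow> j \<in> grid n \<Longrightarrow> grid_kernel n (glt_approx n r a f) i j = band_kernel n K h i j"
proof
  define K where "K = (\<Union>i<r. {k. fourier_coeff (f i) k \<noteq> 0})"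
  define h where "h x \<kappa> = (\<Sum>i<r. a i x * fourier_coeff (f i) \<kappa>)" for x \<kappa>
  show K: "finite K" unfolding K_def using af trig_poly_support(1) by blast
  show "continuous_on (cbox 0 1) (\<lambda>x. h x \<kappa>)" for \<kappa>
  proof -
    have "continuous_on (cbox 0 1) (a i)" if "i < r" for i
      using af[OF that] unfolding smooth_on_set_def by (metis Ck_on.simps(1))
    thus ?thesis unfolding h_def by (intro continuous_intros) auto
  qed
  show "grid_symbol K h (x, \<theta>) = (\<Sum>i<r. a i x * f i \<theta>)" for x \<theta>
  proof -
    have "grid_symbol K h (x, \<theta>) = (\<Sum>i<r. a i x * (\<Sum>\<kappa>\<in>K. fourier_coeff (f i) \<kappa> * freq_char \<kappa> \<theta>))"
      unfolding grid_symbol_def h_def fst_conv snd_conv sum_distrib_left sum_distrib_right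
      by (subst sum.swap) (simp add: mult_ac)
    also have "\<dots> = (\<Sum>i<r. a i x * f i \<theta>)"
    proof (intro sum.cong refl arg_cong2[of _ _ _ _ "(*)"])
      fix i assume i: "i \<in> {..<r}"
      hence t: "trig_poly (f i)" using af by simp
      show "(\<Sum>\<kappa>\<in>K. fourier_coeff (f i) \<kappa> * freq_char \<kappa> \<theta>) = f i \<theta>"
        unfolding trig_poly_support(2)[OF t, of \<theta>] using K i by (intro sum.mono_neutral_right) (auto simp: K_def)
    qed
    finally show ?thesis .
  qed
  show "grid_kernel n (glt_approx n r a f) i j = band_kernel n K h i j" if "i \<in> grid n" "j \<in> grid n" for n i j
  proof -
    have e: "(\<chi> l. int (i $ l) - int (j $ l)) = idx i - idx j" by (simp add: idx_def Finite_Cartesian_Product.vec_eq_iff)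
    have "h (sample_pt n i) \<kappa> = 0" if "\<kappa> \<notin> K" for \<kappa> using that by (auto simp: h_def K_def intro!: sum.neutral)
    thus ?thesis unfolding grid_kernel_glt_approx[OF that] e band_kernel_def by (auto simp: h_def sample_pt_def)
  qed
qed

text \<open>The norm term moves the level, the rank term the count. Both bounds hold on the full
  grid and pass to \<open>S\<close> by restriction; as the rank is measured against the full grid,
  the ratio of the sizes enters. Absolute values appear because \<open>\<omega>\<close> and
  \<open>c\<close> are not assumed nonnegative.\<close>

lemma acs_remainder_bound:
  assumes A: "A \<in> carrier_mat (grid_size n) (grid_size n)" and G: "G \<in> carrier_mat (grid_size n) (grid_size n)"
    and NR: "N \<in> carrier_mat (grid_size n) (grid_size n)" "R \<in> carrier_mat (grid_size n) (grid_size n)" "A = G + N + R"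
    and N: "spectral_norm N \<le> \<omega>" and R: "real (vec_space.rank (grid_size n) R) \<le> c * real (grid_size n)"
    and S: "S \<subseteq> grid n"
  shows "acs_size S (\<lambda>i j. grid_kernel n A i j - grid_kernel n G i j) \<le> \<bar>c\<bar> * (real (grid_size n) / real (card S)) + \<bar>\<omega>\<bar>"
proof -
  let ?r = "vec_space.rank (grid_size n) R"
  have "sv_bound (grid n) (grid_kernel n N) 0 \<bar>\<omega>\<bar>"
    unfolding sv_bound_grid_kernel by (rule sv_bound_spectral_norm[OF NR(1)]) (use N in linarith)
  moreover have "sv_bound (grid n) (grid_kernel n R) ?r 0"
    unfolding sv_bound_grid_kernel by (rule sv_bound_rank[OF NR(2)])
  ultimately have "sv_bound (grid n) (\<lambda>i j. grid_kernel n N i j + grid_kernel n R i j) (0 + ?r) (\<bar>\<omega>\<bar> + 0)"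
    by (rule sv_bound_add) auto
  hence "sv_bound (grid n) (\<lambda>i j. grid_kernel n A i j - grid_kernel n G i j) ?r \<bar>\<omega>\<bar>"
  proof (subst sv_bound_cong[where b = "\<lambda>i j. grid_kernel n N i j + grid_kernel n R i j"])
    fix i j assume "i \<in> grid n" "j \<in> grid n"
    hence "lex_pos (grid n) i < grid_size n" "lex_pos (grid n) j < grid_size n" by (auto intro: lex_pos_grid_less)
    thus "grid_kernel n A i j - grid_kernel n G i j = grid_kernel n N i j + grid_kernel n R i j"
      unfolding grid_kernel_def NR(3) using NR(1,2) G by simp
  qed simp
  hence "sv_bound S (\<lambda>i j. grid_kernel n A i j - grid_kernel n G i j) ?r \<bar>\<omega>\<bar>"
    by (rule sv_bound_subset[OF _ S]) simp
  from acs_size_le[OF this] have "acs_size S (\<lambda>i j. grid_kernel n A i j - grid_kernel n G i j) \<le> real ?r / real (card S) + \<bar>\<omega>\<bar>" by simp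
  also have "real ?r / real (card S) \<le> (\<bar>c\<bar> * real (grid_size n)) / real (card S)"
  proof (rule divide_right_mono)
    have "c * real (grid_size n) \<le> \<bar>c\<bar> * real (grid_size n)" by (intro mult_right_mono) auto
    thus "real ?r \<le> \<bar>c\<bar> * real (grid_size n)" using R by linarith
  qed auto
  finally show ?thesis by simp
qed

lemma grid_symbol_cube_measurable:
  assumes "\<And>\<kappa>. \<kappa> \<in> K \<Longrightarrow> continuous_on (cbox 0 1) (\<lambda>x. h x \<kappa>)"
  shows "grid_symbol K h \<in> borel_measurable (lebesgue_on (cbox 0 1 \<times> freq_box))"
proof (rule continuous_imp_measurable_on_sets_lebesgue[OF grid_symbol_continuous[OF assms]])
  show "(cbox 0 1 :: 'a point set) \<times> (freq_box :: 'a point set) \<in> sets lebesgue"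
    using cube_Times_freq_box_lmeasurable by auto
qed auto

text \<open>The definition of a GLT sequence in the language of kernels. The estimate is uniform in
  \<open>S\<close>, so that \<open>S\<close> may be the part of the grid in the domain, which varies
  with \<open>n\<close>.\<close>

lemma GLT_approximation:
  fixes A :: "nat \<Rightarrow> complex mat" and \<nu> :: "nat \<Rightarrow> ('d :: {finite, linorder}) multi_index"
  assumes "GLT \<nu> A k"
  obtains K h \<gamma> where "\<And>m. finite (K m)" "\<And>m \<kappa>. \<kappa> \<in> K m \<Longrightarrow> continuous_on (cbox 0 1) (\<lambda>x. h m x \<kappa>)"
    "conv_in_measure (cbox 0 1 \<times> freq_box) (\<lambda>m. grid_symbol (K m) (h m)) k" "\<gamma> \<longlonglongrightarrow> 0"
    "\<And>m. eventually (\<lambda>n. \<forall>S \<subseteq> grid (\<nu> n). acs_size S (\<lambda>i j. grid_kernel (\<nu> n) (A n) i j - band_kernel (\<nu> n) (K m) (h m) i j)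
        \<le> \<gamma> m * (1 + real (grid_size (\<nu> n)) / real (card S))) sequentially"
proof -
  obtain r a f where carr: "\<And>n. A n \<in> carrier_mat (grid_size (\<nu> n)) (grid_size (\<nu> n))"
    and af: "\<And>m i. i < r m \<Longrightarrow> smooth_on_set (cbox 0 1) (a m i) \<and> trig_poly (f m i)"
    and conv: "conv_in_measure (cbox 0 1 \<times> freq_box) (\<lambda>m (x, \<theta>). \<Sum>i<r m. a m i x * f m i \<theta>) k"
    and acs: "acs_conv (\<lambda>n. grid_size (\<nu> n)) (\<lambda>m n. glt_approx (\<nu> n) (r m) (a m) (f m)) A"
    using assms unfolding GLT_def by blast
  define P where "P m K h \<longleftrightarrow> finite K \<and> (\<forall>\<kappa>\<in>K. continuous_on (cbox 0 1) (\<lambda>x. h x \<kappa>)) \<and>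
    (\<forall>x \<theta>. grid_symbol K h (x, \<theta>) = (\<Sum>i<r m. a m i x * f m i \<theta>)) \<and>
    (\<forall>n i j. i \<in> grid n \<longrightarrow> j \<in> grid n \<longrightarrow> grid_kernel n (glt_approx n (r m) (a m) (f m)) i j = band_kernel n K h i j)" for m K h
  have "\<exists>F. P m (fst F) (snd F)" for m
  proof (rule glt_approx_band[of "r m" "a m" "f m"])
    fix K h
    assume "finite K" "\<And>\<kappa>. \<kappa> \<in> K \<Longrightarrow> continuous_on (cbox 0 1) (\<lambda>x. h x \<kappa>)"
      "\<And>x \<theta>. grid_symbol K h (x, \<theta>) = (\<Sum>i<r m. a m i x * f m i \<theta>)"
      "\<And>n i j. i \<in> grid n \<Longrightarrow> j \<in> grid n \<Longrightarrow> grid_kernel n (glt_approx n (r m) (a m) (f m)) i j = band_kernel n K h i j"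
    hence "P m (fst (K, h)) (snd (K, h))" by (simp add: P_def)
    thus "\<exists>F. P m (fst F) (snd F)" by blast
  qed (rule af)
  then obtain F where F: "\<And>m. P m (fst (F m)) (snd (F m))" by metis
  define K where "K m = fst (F m)" for m
  define h where "h m = snd (F m)" for m
  have P: "P m (K m) (h m)" for m using F by (simp add: K_def h_def)
  have Kh: "\<And>m. finite (K m)" "\<And>m \<kappa>. \<kappa> \<in> K m \<Longrightarrow> continuous_on (cbox 0 1) (\<lambda>x. h m x \<kappa>)"
    "\<And>m x \<theta>. grid_symbol (K m) (h m) (x, \<theta>) = (\<Sum>i<r m. a m i x * f m i \<theta>)"
    "\<And>m n i j. i \<in> grid n \<Longrightarrow> j \<in> grid n \<Longrightarrow> grid_kernel n (glt_approx n (r m) (a m) (f m)) i j = band_kernel n (K m) (h m) i j"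
    using P by (auto simp: P_def)
  have sy: "(\<lambda>m (x, \<theta>). \<Sum>i<r m. a m i x * f m i \<theta>) = (\<lambda>m. grid_symbol (K m) (h m))"
    by (intro ext) (auto simp: Kh(3))
  from acs obtain \<omega> c :: "nat \<Rightarrow> real" where \<omega>c: "\<omega> \<longlonglongrightarrow> 0" "c \<longlonglongrightarrow> 0" and
    dec: "\<And>m. \<exists>n0. \<forall>n>n0. \<exists>N \<in> carrier_mat (grid_size (\<nu> n)) (grid_size (\<nu> n)). \<exists>R \<in> carrier_mat (grid_size (\<nu> n)) (grid_size (\<nu> n)).
            A n = glt_approx (\<nu> n) (r m) (a m) (f m) + N + R \<and> spectral_norm N \<le> \<omega> m \<and>
            real (vec_space.rank (grid_size (\<nu> n)) R) \<le> c m * real (grid_size (\<nu> n))"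
    unfolding acs_conv_def by blast
  define \<gamma> where "\<gamma> m = \<bar>\<omega> m\<bar> + \<bar>c m\<bar>" for m
  have \<gamma>: "\<gamma> \<longlonglongrightarrow> 0" unfolding \<gamma>_def using tendsto_add[OF tendsto_rabs[OF \<omega>c(1)] tendsto_rabs[OF \<omega>c(2)]] by simp
  show ?thesis
  proof (rule that[OF Kh(1,2) conv[unfolded sy] \<gamma>])
    fix m
    obtain n0 where n0: "\<And>n. n > n0 \<Longrightarrow> \<exists>N \<in> carrier_mat (grid_size (\<nu> n)) (grid_size (\<nu> n)). \<exists>R \<in> carrier_mat (grid_size (\<nu> n)) (grid_size (\<nu> n)).
            A n = glt_approx (\<nu> n) (r m) (a m) (f m) + N + R \<and> spectral_norm N \<le> \<omega> m \<and>
            real (vec_space.rank (grid_size (\<nu> n)) R) \<le> c m * real (grid_size (\<nu> n))" using dec by blast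
    show "eventually (\<lambda>n. \<forall>S \<subseteq> grid (\<nu> n). acs_size S (\<lambda>i j. grid_kernel (\<nu> n) (A n) i j - band_kernel (\<nu> n) (K m) (h m) i j)
        \<le> \<gamma> m * (1 + real (grid_size (\<nu> n)) / real (card S))) sequentially"
      using eventually_gt_at_top[of n0]
    proof eventually_elim
      case (elim n)
      show ?case
      proof (intro allI impI)
        fix S assume S: "S \<subseteq> grid (\<nu> n)"
        define G where "G = glt_approx (\<nu> n) (r m) (a m) (f m)"
        have G: "G \<in> carrier_mat (grid_size (\<nu> n)) (grid_size (\<nu> n))" by (simp add: G_def glt_approx_def)
        obtain N R where NR: "N \<in> carrier_mat (grid_size (\<nu> n)) (grid_size (\<nu> n))" "R \<in> carrier_mat (grid_size (\<nu> n)) (grid_size (\<nu> n))"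
            "A n = G + N + R" "spectral_norm N \<le> \<omega> m"
            "real (vec_space.rank (grid_size (\<nu> n)) R) \<le> c m * real (grid_size (\<nu> n))"
          using n0[OF elim] by (auto simp: G_def)
        have "acs_size S (\<lambda>i j. grid_kernel (\<nu> n) (A n) i j - band_kernel (\<nu> n) (K m) (h m) i j) =
           acs_size S (\<lambda>i j. grid_kernel (\<nu> n) (A n) i j - grid_kernel (\<nu> n) G i j)"
        proof (rule acs_size_cong)
          fix i j assume "i \<in> S" "j \<in> S"
          hence "i \<in> grid (\<nu> n)" "j \<in> grid (\<nu> n)" using S by auto
          thus "grid_kernel (\<nu> n) (A n) i j - band_kernel (\<nu> n) (K m) (h m) i j = grid_kernel (\<nu> n) (A n) i j - grid_kernel (\<nu> n) G i j"
            by (simp only: G_def Kh(4))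
        qed
        also have "\<dots> \<le> \<bar>c m\<bar> * (real (grid_size (\<nu> n)) / real (card S)) + \<bar>\<omega> m\<bar>"
          by (rule acs_remainder_bound[OF carr G NR S])
        also have "\<dots> \<le> \<gamma> m * (real (grid_size (\<nu> n)) / real (card S)) + \<gamma> m"
          by (intro add_mono mult_right_mono) (auto simp: \<gamma>_def)
        finally show "acs_size S (\<lambda>i j. grid_kernel (\<nu> n) (A n) i j - band_kernel (\<nu> n) (K m) (h m) i j)
            \<le> \<gamma> m * (1 + real (grid_size (\<nu> n)) / real (card S))" by (simp add: algebra_simps)
      qed
    qed
  qed
qed

text \<open>The coefficients are extended by zero to the union of the bands. Differences of banded
  kernels are thereby banded kernels, and the limit for a single one serves for differences.\<close>

lemma band_kernel_diff:
  assumes "finite K1" "finite K2" "\<And>\<kappa>. \<kappa> \<in> K1 \<Longrightarrow> continuous_on (cbox 0 1) (\<lambda>x. h1 x \<kappa>)" "\<And>\<kappa>. \<kappa> \<in> K2 \<Longrightarrow> continuous_on (cbox 0 1) (\<lambda>x. h2 x \<kappa>)"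
  defines "h \<equiv> \<lambda>x \<kappa>. (if \<kappa> \<in> K1 then h1 x \<kappa> else 0) - (if \<kappa> \<in> K2 then h2 x \<kappa> else 0)"
  shows "band_kernel n (K1 \<union> K2) h i j = band_kernel n K1 h1 i j - band_kernel n K2 h2 i j"
    and "grid_symbol (K1 \<union> K2) h z = grid_symbol K1 h1 z - grid_symbol K2 h2 z"
    and "continuous_on (cbox 0 1) (\<lambda>x. h x \<kappa>)"
proof -
  show "band_kernel n (K1 \<union> K2) h i j = band_kernel n K1 h1 i j - band_kernel n K2 h2 i j"
    by (auto simp: band_kernel_def h_def)
  have "grid_symbol (K1 \<union> K2) h z = (\<Sum>k\<in>K1 \<union> K2. (if k \<in> K1 then h1 (fst z) k else 0) * freq_char k (snd z)) -
      (\<Sum>k\<in>K1 \<union> K2. (if k \<in> K2 then h2 (fst z) k else 0) * freq_char k (snd z))"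
    by (simp add: grid_symbol_def h_def left_diff_distrib sum_subtractf)
  also have "(\<Sum>k\<in>K1 \<union> K2. (if k \<in> K1 then h1 (fst z) k else 0) * freq_char k (snd z)) = grid_symbol K1 h1 z"
    unfolding grid_symbol_def using assms(1,2) by (intro sum.mono_neutral_cong_right) auto
  also have "(\<Sum>k\<in>K1 \<union> K2. (if k \<in> K2 then h2 (fst z) k else 0) * freq_char k (snd z)) = grid_symbol K2 h2 z"
    unfolding grid_symbol_def using assms(1,2) by (intro sum.mono_neutral_cong_right) auto
  finally show "grid_symbol (K1 \<union> K2) h z = grid_symbol K1 h1 z - grid_symbol K2 h2 z" .
  show "continuous_on (cbox 0 1) (\<lambda>x. h x \<kappa>)"
    unfolding h_def using assms(3,4) by (cases "\<kappa> \<in> K1"; cases "\<kappa> \<in> K2") (auto intro!: continuous_intros)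
qed

section \<open>The limit for differences of GLT sequences\<close>

locale reduced_setting = jordan_domain \<Omega>
  for \<Omega> :: "('d :: {finite, linorder}) point set" +
  fixes \<nu> :: "nat \<Rightarrow> 'd multi_index"
  assumes \<nu>: "filterlim (\<lambda>n. Min (range (\<lambda>l. \<nu> n $ l))) at_top sequentially"
begin

lemma eventually_components_pos: "eventually (\<lambda>n. \<forall>l. \<nu> n $ l > 0) sequentially"
proof -
  have "eventually (\<lambda>n. Suc 0 \<le> Min (range (\<lambda>l. \<nu> n $ l))) sequentially"
    using \<nu> by (auto simp: filterlim_at_top)
  thus ?thesis
  proof eventually_elim
    case (elim n)
    show ?case
    proof
      fix l
      have "Min (range (\<lambda>l. \<nu> n $ l)) \<le> \<nu> n $ l" by (rule Min_le) auto
      thus "\<nu> n $ l > 0" using elim by linarith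
    qed
  qed
qed

lemma eventually_size_ratio:
  "eventually (\<lambda>n. card (grid_in \<Omega> (\<nu> n)) > 0 \<and>
     real (grid_size (\<nu> n)) / real (card (grid_in \<Omega> (\<nu> n))) \<le> 2 / measure lebesgue \<Omega>) sequentially"
  using few_wild_indices[OF \<nu> \<Omega>(1,2) half_gt_zero[OF \<Omega>(3)], of 1] eventually_components_pos
proof eventually_elim
  case (elim n)
  \<comment> \<open>Blocks of side 1 and an empty band: only the count of the grid points in the
    domain is wanted.\<close>
  interpret block_model "\<nu> n" \<Omega> 1 "{}" "\<lambda>_ _. 0"
    by standard (use elim in auto)
  define N D where "N = real (grid_size (\<nu> n))" and "D = real (card (grid_in \<Omega> (\<nu> n)))"
  have N: "N > 0" using elim(2) by (auto simp: N_def grid_size_def intro!: prod_pos)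
  have W: "real (card wild) \<le> measure lebesgue \<Omega> / 2 * N" using elim(1) unfolding wild_def N_def .
  hence "real (card wild) / N \<le> measure lebesgue \<Omega> / 2" using N by (simp only: pos_divide_le_eq)
  hence h: "D / N \<ge> measure lebesgue \<Omega> / 2"
    using grid_in_size_approx[OF \<Omega>(1,2)] unfolding N_def D_def by linarith
  hence "D / N > 0" using \<Omega>(3) by linarith
  hence D: "D > 0" using N by (simp add: zero_less_divide_iff)
  have "N / D \<le> 2 / measure lebesgue \<Omega>" using h D N \<Omega>(3) by (simp add: field_simps)
  thus ?case using D by (simp add: N_def D_def)
qed

text \<open>For one fixed \<open>m\<close> both sequences are replaced by banded approximants. The
  cost is controlled by \<open>\<gamma>1 m\<close> and \<open>\<gamma>2 m\<close> on the matrix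
  side, for large \<open>n\<close>, and by \<open>d_mea\<close> on the symbol side. The result is a
  limit and not only a limsup, on which the description of distance zero rests.\<close>

lemma GLT_diff_acs_size_tendsto:
  assumes A: "GLT \<nu> A k" and B: "GLT \<nu> B k'"
  shows "(\<lambda>n. acs_size (grid_in \<Omega> (\<nu> n)) (\<lambda>i j. grid_kernel (\<nu> n) (A n) i j - grid_kernel (\<nu> n) (B n) i j)) \<longlonglongrightarrow> d_mea \<Omega> k k'"
proof -
  obtain K1 h1 \<gamma>1 where 1: "\<And>m. finite (K1 m)" "\<And>m \<kappa>. \<kappa> \<in> K1 m \<Longrightarrow> continuous_on (cbox 0 1) (\<lambda>x. h1 m x \<kappa>)"
    "conv_in_measure (cbox 0 1 \<times> freq_box) (\<lambda>m. grid_symbol (K1 m) (h1 m)) k" "\<gamma>1 \<longlonglongrightarrow> 0"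
    "\<And>m. eventually (\<lambda>n. \<forall>S \<subseteq> grid (\<nu> n). acs_size S (\<lambda>i j. grid_kernel (\<nu> n) (A n) i j - band_kernel (\<nu> n) (K1 m) (h1 m) i j)
        \<le> \<gamma>1 m * (1 + real (grid_size (\<nu> n)) / real (card S))) sequentially"
    by (rule GLT_approximation[OF A]) blast
  obtain K2 h2 \<gamma>2 where 2: "\<And>m. finite (K2 m)" "\<And>m \<kappa>. \<kappa> \<in> K2 m \<Longrightarrow> continuous_on (cbox 0 1) (\<lambda>x. h2 m x \<kappa>)"
    "conv_in_measure (cbox 0 1 \<times> freq_box) (\<lambda>m. grid_symbol (K2 m) (h2 m)) k'" "\<gamma>2 \<longlonglongrightarrow> 0"
    "\<And>m. eventually (\<lambda>n. \<forall>S \<subseteq> grid (\<nu> n). acs_size S (\<lambda>i j. grid_kernel (\<nu> n) (B n) i j - band_kernel (\<nu> n) (K2 m) (h2 m) i j)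
        \<le> \<gamma>2 m * (1 + real (grid_size (\<nu> n)) / real (card S))) sequentially"
    by (rule GLT_approximation[OF B]) blast
  define g1 where "g1 m = grid_symbol (K1 m) (h1 m)" for m
  define g2 where "g2 m = grid_symbol (K2 m) (h2 m)" for m
  have kms: "k \<in> borel_measurable (lebesgue_on (cbox 0 1 \<times> freq_box))" "k' \<in> borel_measurable (lebesgue_on (cbox 0 1 \<times> freq_box))"
    using A B unfolding GLT_def by blast+
  have gms: "g1 m \<in> borel_measurable (lebesgue_on (cbox 0 1 \<times> freq_box))" "g2 m \<in> borel_measurable (lebesgue_on (cbox 0 1 \<times> freq_box))" for m
    unfolding g1_def g2_def by (auto intro!: grid_symbol_cube_measurable 1(2) 2(2))
  have ss: "k \<in> symbol_space \<Omega>" "k' \<in> symbol_space \<Omega>" "g1 m \<in> symbol_space \<Omega>" "g2 m \<in> symbol_space \<Omega>" for m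
    using kms gms cube_measurable_imp_symbol_space by auto
  have c1: "(\<lambda>m. d_mea \<Omega> (g1 m) k) \<longlonglongrightarrow> 0" unfolding d_mea_mea_size
    by (rule conv_in_measure_mea_size) (use 1(3) gms kms in \<open>auto simp: g1_def[abs_def]\<close>)
  have c2: "(\<lambda>m. d_mea \<Omega> (g2 m) k') \<longlonglongrightarrow> 0" unfolding d_mea_mea_size
    by (rule conv_in_measure_mea_size) (use 2(3) gms kms in \<open>auto simp: g2_def[abs_def]\<close>)
  \<comment> \<open>Bounds the factor \<open>1 + grid size / domain size\<close> of the
    approximation for large \<open>n\<close>.\<close>
  define \<rho> where "\<rho> = 1 + 2 / measure lebesgue \<Omega>"
  have \<rho>: "\<rho> > 0" using \<Omega>(3) by (simp add: \<rho>_def add_pos_pos)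
  show ?thesis
  proof (rule LIMSEQ_I)
    fix e :: real assume e: "0 < e"
    have "(\<lambda>m. (d_mea \<Omega> (g1 m) k + d_mea \<Omega> (g2 m) k') + (\<bar>\<gamma>1 m\<bar> + \<bar>\<gamma>2 m\<bar>) * \<rho>) \<longlonglongrightarrow> (0 + 0) + (\<bar>0\<bar> + \<bar>0\<bar>) * \<rho>"
      by (intro tendsto_intros c1 c2 1(4) 2(4))
    hence "eventually (\<lambda>m. (d_mea \<Omega> (g1 m) k + d_mea \<Omega> (g2 m) k') + (\<bar>\<gamma>1 m\<bar> + \<bar>\<gamma>2 m\<bar>) * \<rho> < e / 2) sequentially"
      by (rule order_tendstoD) (use e in simp)
    then obtain m where m: "(d_mea \<Omega> (g1 m) k + d_mea \<Omega> (g2 m) k') + (\<bar>\<gamma>1 m\<bar> + \<bar>\<gamma>2 m\<bar>) * \<rho> < e / 2"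
      by (auto simp: eventually_sequentially)
    define h where "h = (\<lambda>x \<kappa>. (if \<kappa> \<in> K1 m then h1 m x \<kappa> else 0) - (if \<kappa> \<in> K2 m then h2 m x \<kappa> else 0))"
    define K where "K = K1 m \<union> K2 m"
    note bd = band_kernel_diff[of "K1 m" "K2 m" "h1 m" "h2 m", OF 1(1) 2(1) 1(2) 2(2), folded h_def K_def]
    have sym: "mea_size \<Omega> (grid_symbol K h) = d_mea \<Omega> (g1 m) (g2 m)"
      unfolding d_mea_mea_size g1_def g2_def by (rule mea_size_cong) (simp add: bd(2))
    have "(\<lambda>n. acs_size (grid_in \<Omega> (\<nu> n)) (band_kernel (\<nu> n) K h)) \<longlonglongrightarrow> d_mea \<Omega> (g1 m) (g2 m)"
      unfolding sym[symmetric] by (rule band_kernel_acs_size_tendsto[OF \<nu> \<Omega>]) (use 1(1) 2(1) bd(3) in \<open>auto simp: K_def h_def\<close>)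
    hence "eventually (\<lambda>n. dist (acs_size (grid_in \<Omega> (\<nu> n)) (band_kernel (\<nu> n) K h)) (d_mea \<Omega> (g1 m) (g2 m)) < e / 2) sequentially"
      by (rule tendstoD) (use e in simp)
    hence "eventually (\<lambda>n. norm (acs_size (grid_in \<Omega> (\<nu> n)) (\<lambda>i j. grid_kernel (\<nu> n) (A n) i j - grid_kernel (\<nu> n) (B n) i j) - d_mea \<Omega> k k') < e) sequentially"
      using 1(5)[of m] 2(5)[of m] eventually_size_ratio
    proof eventually_elim
      case (elim n)
      define S where "S = grid_in \<Omega> (\<nu> n)"
      have S: "S \<subseteq> grid (\<nu> n)" "finite S" using grid_in_subset by (auto simp: S_def)
      let ?A = "grid_kernel (\<nu> n) (A n)" and ?B = "grid_kernel (\<nu> n) (B n)"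
      let ?a = "band_kernel (\<nu> n) (K1 m) (h1 m)" and ?b = "band_kernel (\<nu> n) (K2 m) (h2 m)"
      have rat: "1 + real (grid_size (\<nu> n)) / real (card S) \<le> \<rho>" "0 \<le> 1 + real (grid_size (\<nu> n)) / real (card S)"
        using elim(4) by (auto simp: \<rho>_def S_def)
      have bnd: "\<gamma> * (1 + real (grid_size (\<nu> n)) / real (card S)) \<le> \<bar>\<gamma>\<bar> * \<rho>" for \<gamma> :: real
        using rat \<rho> by (intro mult_mono) auto
      have r1: "acs_size S (\<lambda>i j. ?A i j - ?a i j) \<le> \<bar>\<gamma>1 m\<bar> * \<rho>"
        using elim(2) S(1) bnd[of "\<gamma>1 m"] by (meson order_trans)
      have r2: "acs_size S (\<lambda>i j. ?B i j - ?b i j) \<le> \<bar>\<gamma>2 m\<bar> * \<rho>"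
        using elim(3) S(1) bnd[of "\<gamma>2 m"] by (meson order_trans)
      have "\<bar>acs_size S (\<lambda>i j. ?A i j - ?B i j) - acs_size S (band_kernel (\<nu> n) K h)\<bar> \<le>
         acs_size S (\<lambda>i j. (?A i j - ?B i j) - band_kernel (\<nu> n) K h i j)"
        by (rule acs_size_diff_triangle[OF S(2)])
      also have "\<dots> = acs_size S (\<lambda>i j. (?A i j - ?a i j) + - (?B i j - ?b i j))"
        by (rule acs_size_cong) (simp add: bd(1))
      also have "\<dots> \<le> acs_size S (\<lambda>i j. ?A i j - ?a i j) + acs_size S (\<lambda>i j. - (?B i j - ?b i j))"
        by (rule acs_size_triangle[OF S(2)])
      also have "acs_size S (\<lambda>i j. - (?B i j - ?b i j)) = acs_size S (\<lambda>i j. ?B i j - ?b i j)"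
        by (rule acs_size_uminus)
      finally have 3: "\<bar>acs_size S (\<lambda>i j. ?A i j - ?B i j) - acs_size S (band_kernel (\<nu> n) K h)\<bar> \<le> (\<bar>\<gamma>1 m\<bar> + \<bar>\<gamma>2 m\<bar>) * \<rho>"
        using r1 r2 by (simp add: algebra_simps)
      have 4: "\<bar>d_mea \<Omega> (g1 m) (g2 m) - d_mea \<Omega> k k'\<bar> \<le> d_mea \<Omega> (g1 m) k + d_mea \<Omega> (g2 m) k'"
        using d_mea_triangle[OF ss(3)[of m] ss(1) ss(4)[of m]] d_mea_triangle[OF ss(1) ss(2) ss(4)[of m]]
          d_mea_triangle[OF ss(1) ss(3)[of m] ss(2)] d_mea_triangle[OF ss(3)[of m] ss(4)[of m] ss(2)]
          d_mea_commute[of k "g1 m"] d_mea_commute[of k' "g2 m"] by linarith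
      show ?case using 3 4 elim(1) m unfolding S_def dist_real_def real_norm_def by linarith
    qed
    thus "\<exists>no. \<forall>n\<ge>no. norm (acs_size (grid_in \<Omega> (\<nu> n)) (\<lambda>i j. grid_kernel (\<nu> n) (A n) i j - grid_kernel (\<nu> n) (B n) i j) - d_mea \<Omega> k k') < e"
      by (simp add: eventually_sequentially)
  qed
qed

end

section \<open>The isometry\<close>

text \<open>Identification of points at distance zero, stated abstractly because it is applied both
  to sequences and to symbols.\<close>

lemma pseudometric_quotient:
  assumes d: "pseudometric_on S d" and r: "r = {(x, y). x \<in> S \<and> y \<in> S \<and> d x y = (0 :: real)}"
  shows "equiv S r" "d respects2 r"
    "\<And>x y. x \<in> S \<Longrightarrow> y \<in> S \<Longrightarrow> class_dist d (r `` {x}) (r `` {y}) = d x y"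
    "pseudometric_on (S // r) (class_dist d)"
proof -
  have pos: "0 \<le> d x y" and sym: "d x y = d y x" and refl: "d x x = 0" if "x \<in> S" "y \<in> S" for x y
    using d that by (auto simp: pseudometric_on_def)
  have tri: "d x z \<le> d x y + d y z" if "x \<in> S" "y \<in> S" "z \<in> S" for x y z
    using d that by (auto simp: pseudometric_on_def)
  show eq: "equiv S r"
  proof (rule equivI)
    show "r \<subseteq> S \<times> S" by (auto simp: r)
    show "refl_on S r" using refl by (auto simp: refl_on_def r)
    show "sym_on UNIV r" by (rule symI) (auto simp: r sym)
    show "trans_on UNIV r"
    proof (rule transI)
      fix x y z assume "(x, y) \<in> r" "(y, z) \<in> r"
      hence xyz: "x \<in> S" "y \<in> S" "z \<in> S" "d x y = 0" "d y z = 0" by (auto simp: r)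
      hence "d x z = 0" using tri[OF xyz(1-3)] pos[OF xyz(1,3)] by simp
      thus "(x, z) \<in> r" using xyz by (auto simp: r)
    qed
  qed
  have eqd: "d x y = d x' y'" if "(x, x') \<in> r" "(y, y') \<in> r" for x x' y y'
  proof -
    have m: "x \<in> S" "x' \<in> S" "y \<in> S" "y' \<in> S" "d x x' = 0" "d y y' = 0" using that by (auto simp: r)
    have "d x y \<le> d x x' + (d x' y' + d y' y)" using tri[OF m(1,2,3)] tri[OF m(2,4,3)] by linarith
    moreover have "d x' y' \<le> d x' x + (d x y + d y y')" using tri[OF m(2,1,4)] tri[OF m(1,3,4)] by linarith
    ultimately show ?thesis using m sym[OF m(1,2)] sym[OF m(3,4)] by linarith
  qed
  show "d respects2 r" by (rule congruent2I') (rule eqd)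
  show cd: "class_dist d (r `` {x}) (r `` {y}) = d x y" if "x \<in> S" "y \<in> S" for x y
  proof -
    have "(\<Union>x'\<in>r `` {x}. \<Union>y'\<in>r `` {y}. {d x' y'}) = {d x y}"
    proof (intro equalityI subsetI)
      fix t assume "t \<in> (\<Union>x'\<in>r `` {x}. \<Union>y'\<in>r `` {y}. {d x' y'})"
      then obtain x' y' where "(x, x') \<in> r" "(y, y') \<in> r" "t = d x' y'" by auto
      thus "t \<in> {d x y}" using eqd by force
    next
      fix t assume "t \<in> {d x y}"
      moreover have "x \<in> r `` {x}" "y \<in> r `` {y}" using that refl by (auto simp: r)
      ultimately show "t \<in> (\<Union>x'\<in>r `` {x}. \<Union>y'\<in>r `` {y}. {d x' y'})" by blast
    qed
    thus ?thesis by (simp add: class_dist_def)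
  qed
  show "pseudometric_on (S // r) (class_dist d)"
    unfolding pseudometric_on_def
  proof (intro conjI ballI)
    fix X Y assume "X \<in> S // r" "Y \<in> S // r"
    then obtain x y where xy: "x \<in> S" "X = r `` {x}" "y \<in> S" "Y = r `` {y}" by (auto elim!: quotientE)
    thus "0 \<le> class_dist d X Y" "class_dist d X Y = class_dist d Y X" "class_dist d X X = 0"
      using pos sym refl by (auto simp: cd)
    fix Z assume "Z \<in> S // r"
    then obtain z where "z \<in> S" "Z = r `` {z}" by (auto elim!: quotientE)
    thus "class_dist d X Z \<le> class_dist d X Y + class_dist d Y Z" using xy tri by (auto simp: cd)
  qed
qed

text \<open>No measurability is assumed: by completeness either both sets are measurable or neither
  is, and in the latter case both measures are 0 by convention.\<close>

lemma measure_eq_mod_null: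
  assumes N: "N \<in> null_sets lebesgue" and AB: "A - N = B - N"
  shows "measure lebesgue A = measure lebesgue B"
proof -
  have sets: "T \<in> sets lebesgue" if S: "S \<in> sets lebesgue" and "S - N = T - N" for S T
  proof -
    have "T = (S - N) \<union> (T \<inter> N)" using that by blast
    moreover have "T \<inter> N \<in> null_sets lebesgue" using N by (rule null_sets_completion_subset[rotated]) auto
    ultimately show ?thesis using S N by (metis null_setsD2 sets.Diff sets.Un)
  qed
  show ?thesis
  proof (cases "A \<in> sets lebesgue")
    case True
    show ?thesis
      using measure_Diff_null_set[OF True N] measure_Diff_null_set[OF sets[OF True AB] N] AB by simp
  next
    case False
    hence "B \<notin> sets lebesgue" using sets[of B A] AB by auto
    thus ?thesis using False by (simp add: measure_notin_sets)
  qed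
qed

context reduced_setting
begin

section \<open>Reduced sequences, zero-distributed sequences and classes of symbols\<close>

lemma reduced_GLT_acs_size_tendsto:
  assumes "reduced_GLT \<nu> \<Omega> A \<kappa>" "reduced_GLT \<nu> \<Omega> B \<xi>"
  shows "(\<lambda>n. acs_size {..<grid_in_size \<Omega> (\<nu> n)} (\<lambda>p q. (A n - B n) $$ (p,q))) \<longlonglongrightarrow> d_mea \<Omega> \<kappa> \<xi>"
proof -
  obtain A' k where A: "GLT \<nu> A' k" "A = (\<lambda>n. restrict_mat \<Omega> (\<nu> n) (A' n))" "\<And>z. z \<in> \<Omega> \<times> freq_box \<Longrightarrow> \<kappa> z = k z"
    using assms(1) unfolding reduced_GLT_def by blast
  obtain B' k' where B: "GLT \<nu> B' k'" "B = (\<lambda>n. restrict_mat \<Omega> (\<nu> n) (B' n))" "\<And>z. z \<in> \<Omega> \<times> freq_box \<Longrightarrow> \<xi> z = k' z"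
    using assms(2) unfolding reduced_GLT_def by blast
  have "d_mea \<Omega> k k' = d_mea \<Omega> \<kappa> \<xi>"
    unfolding d_mea_mea_size by (rule mea_size_cong) (simp add: A(3) B(3))
  thus ?thesis using GLT_diff_acs_size_tendsto[OF A(1) B(1)]
    unfolding A(2) B(2) restrict_mat_diff_acs_size by simp
qed

lemma reduced_GLT_carrier:
  assumes "A \<in> reduced_GLT_seqs \<nu> \<Omega>"
  shows "A n \<in> carrier_mat (grid_in_size \<Omega> (\<nu> n)) (grid_in_size \<Omega> (\<nu> n))"
proof -
  obtain A' where "A = (\<lambda>n. restrict_mat \<Omega> (\<nu> n) (A' n))"
    using assms unfolding reduced_GLT_seqs_def reduced_GLT_def by blast
  thus ?thesis by (simp only: restrict_mat_carrier)
qed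

text \<open>The sequence under the limsup in \<open>d_acs\<close> converges, so the limsup is its
  limit.\<close>

lemma reduced_GLT_d_acs:
  assumes "reduced_GLT \<nu> \<Omega> A \<kappa>" "reduced_GLT \<nu> \<Omega> B \<xi>"
  shows "d_acs \<nu> \<Omega> A B = d_mea \<Omega> \<kappa> \<xi>"
proof -
  have AB: "A \<in> reduced_GLT_seqs \<nu> \<Omega>" "B \<in> reduced_GLT_seqs \<nu> \<Omega>" using assms by (auto simp: reduced_GLT_seqs_def)
  have c: "A n - B n \<in> carrier_mat (grid_in_size \<Omega> (\<nu> n)) (grid_in_size \<Omega> (\<nu> n))" for n
    using reduced_GLT_carrier[OF AB(2), of n] by (rule minus_carrier_mat)
  have "limsup (\<lambda>n. ereal (acs_size {..<grid_in_size \<Omega> (\<nu> n)} (\<lambda>p q. (A n - B n) $$ (p,q)))) = ereal (d_mea \<Omega> \<kappa> \<xi>)"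
    by (rule lim_imp_Limsup) (use reduced_GLT_acs_size_tendsto[OF assms] in auto)
  thus ?thesis unfolding d_acs_def Let_def acs_size_matrix[OF c] by simp
qed

text \<open>Both sides say that for every positive level the share of singular values above it tends
  to 0. A tent function extracts this from the averages; conversely a test function is nearly
  constant on small singular values and bounded on the few large ones.\<close>

lemma zero_distributed_iff:
  assumes Z: "\<And>n. Z n \<in> carrier_mat (grid_in_size \<Omega> (\<nu> n)) (grid_in_size \<Omega> (\<nu> n))"
  shows "Z \<in> zero_distributed \<nu> \<Omega> \<longleftrightarrow> (\<lambda>n. acs_size {..<grid_in_size \<Omega> (\<nu> n)} (\<lambda>p q. Z n $$ (p,q))) \<longlonglongrightarrow> 0"
proof -
  define D where "D n = grid_in_size \<Omega> (\<nu> n)" for n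
  define \<sigma> where "\<sigma> n = singular_value (Z n)" for n
  define p where "p n = acs_size {..<D n} (\<lambda>p q. Z n $$ (p,q))" for n
  define cnt where "cnt n L = card {i\<in>{1..D n}. \<sigma> n i > L}" for n L
  have Zc: "Z n \<in> carrier_mat (D n) (D n)" for n using Z by (simp add: D_def)
  have \<sigma>0: "0 \<le> \<sigma> n i" for n i unfolding \<sigma>_def by (rule singular_value_nonneg[OF Zc])
  have sv: "sv_bound {..<D n} (\<lambda>p q. Z n $$ (p,q)) r L \<longleftrightarrow> cnt n L \<le> r" if "0 \<le> L" for n r L
    unfolding cnt_def \<sigma>_def by (rule sv_bound_matrix_iff(1)[OF Zc that])
  have p0: "0 \<le> p n" for n unfolding p_def by (rule acs_size_nonneg) simp
  have Dpos: "eventually (\<lambda>n. D n > 0) sequentially"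
    using eventually_size_ratio by eventually_elim (simp add: D_def grid_in_size_def)
  define avg where "avg F n = (\<Sum>i=1..D n. F (\<sigma> n i)) / of_nat (D n)" for F :: "real \<Rightarrow> complex" and n
  have zd: "Z \<in> zero_distributed \<nu> \<Omega> \<longleftrightarrow> (\<forall>F. continuous_on UNIV F \<and> (\<exists>K. compact K \<and> (\<forall>x. x \<notin> K \<longrightarrow> F x = 0)) \<longrightarrow> avg F \<longlonglongrightarrow> F 0)"
    using Z by (simp add: zero_distributed_def avg_def[abs_def] D_def \<sigma>_def)
  show ?thesis
  proof
    assume zero: "Z \<in> zero_distributed \<nu> \<Omega>"
    have "p \<longlonglongrightarrow> 0"
    proof (rule LIMSEQ_I)
      fix e :: real assume e: "0 < e"
      \<comment> \<open>A tent of height 1 that vanishes from \<open>e / 2\<close> on: each singular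
        value above \<open>e / 2\<close> contributes 1 to the sum of \<open>1 - F\<close>.\<close>
      define F where "F x = complex_of_real (max 0 (1 - 2 * \<bar>x\<bar> / e))" for x :: real
      have "continuous_on UNIV F" unfolding F_def using e by (intro continuous_intros) auto
      moreover have "compact {-e..e}" "\<And>x. x \<notin> {-e..e} \<Longrightarrow> F x = 0"
      proof -
        fix x assume "x \<notin> {-e..e}"
        hence "e \<le> \<bar>x\<bar>" using e by auto
        hence "1 - 2 * \<bar>x\<bar> / e \<le> 0" using e by (simp add: field_simps)
        thus "F x = 0" by (simp add: F_def)
      qed auto
      ultimately have "avg F \<longlonglongrightarrow> F 0" using zero zd by blast
      hence "(\<lambda>n. Re (avg F n)) \<longlonglongrightarrow> 1" using tendsto_Re[of "avg F" "F 0"] by (simp add: F_def)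
      hence "eventually (\<lambda>n. Re (avg F n) > 1 - e / 2) sequentially" by (rule order_tendstoD) (use e in simp)
      hence "eventually (\<lambda>n. norm (p n - 0) < e) sequentially"
        using Dpos
      proof eventually_elim
        case (elim n)
        define c where "c = cnt n (e / 2)"
        have "real c \<le> (\<Sum>i=1..D n. 1 - Re (F (\<sigma> n i)))"
        proof -
          have "real c = (\<Sum>i\<in>{i\<in>{1..D n}. \<sigma> n i > e / 2}. 1)" by (simp add: c_def cnt_def)
          also have "\<dots> \<le> (\<Sum>i\<in>{i\<in>{1..D n}. \<sigma> n i > e / 2}. 1 - Re (F (\<sigma> n i)))"
          proof (intro sum_mono)
            fix i assume "i \<in> {i\<in>{1..D n}. \<sigma> n i > e / 2}"
            hence "1 - 2 * \<bar>\<sigma> n i\<bar> / e \<le> 0" using e by (simp add: field_simps)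
            thus "1 \<le> 1 - Re (F (\<sigma> n i))" by (simp add: F_def)
          qed
          also have "\<dots> \<le> (\<Sum>i=1..D n. 1 - Re (F (\<sigma> n i)))"
          proof (intro sum_mono2)
            fix i
            have "1 - 2 * \<bar>\<sigma> n i\<bar> / e \<le> 1" using e by simp
            thus "0 \<le> 1 - Re (F (\<sigma> n i))" by (simp add: F_def)
          qed auto
          finally show ?thesis .
        qed
        also have "\<dots> = real (D n) - real (D n) * Re (avg F n)"
          using elim(2) by (simp add: avg_def sum_subtractf Re_divide_of_nat)
        finally have "real c \<le> (1 - Re (avg F n)) * real (D n)" by (simp add: algebra_simps)
        moreover have "real (D n) > 0" using elim(2) by simp
        ultimately have "real c / real (D n) \<le> 1 - Re (avg F n)" by (simp only: pos_divide_le_eq)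
        moreover have "p n \<le> real c / real (D n) + e / 2"
          using acs_size_le[of "{..<D n}" "\<lambda>p q. Z n $$ (p,q)" c "e / 2"] sv[of "e / 2" n c] e by (simp add: p_def c_def)
        ultimately have "p n < e" using elim(1) by linarith
        thus ?case using p0[of n] by simp
      qed
      thus "\<exists>no. \<forall>n\<ge>no. norm (p n - 0) < e" by (simp add: eventually_sequentially)
    qed
    thus "(\<lambda>n. acs_size {..<grid_in_size \<Omega> (\<nu> n)} (\<lambda>p q. Z n $$ (p,q))) \<longlonglongrightarrow> 0" by (simp add: p_def[abs_def] D_def)
  next
    assume "(\<lambda>n. acs_size {..<grid_in_size \<Omega> (\<nu> n)} (\<lambda>p q. Z n $$ (p,q))) \<longlonglongrightarrow> 0"
    hence plim: "p \<longlonglongrightarrow> 0" by (simp add: p_def[abs_def] D_def)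
    have "avg F \<longlonglongrightarrow> F 0" if F: "continuous_on UNIV F" "compact K" "\<And>x. x \<notin> K \<Longrightarrow> F x = 0" for F :: "real \<Rightarrow> complex" and K
    proof (rule LIMSEQ_I)
      fix e :: real assume e: "0 < e"
      obtain M where M: "\<And>x. cmod (F x) \<le> M" "M > 0"
      proof -
        have "compact (F ` K)" by (intro compact_continuous_image continuous_on_subset[OF F(1)] F(2)) auto
        then obtain M where "\<And>x. x \<in> K \<Longrightarrow> cmod (F x) \<le> M" using compact_imp_bounded[of "F ` K"] by (auto simp: bounded_iff)
        hence "cmod (F x) \<le> max M 1" for x using F(3)[of x] by (cases "x \<in> K") (auto simp: le_max_iff_disj)
        thus ?thesis by (rule that) simp
      qed
      have "isCont F 0" using F(1) by (simp add: continuous_on_eq_continuous_at)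
      then obtain \<delta> where \<delta>: "\<delta> > 0" "\<And>x. \<bar>x\<bar> < \<delta> \<Longrightarrow> cmod (F x - F 0) < e / 2"
      proof -
        have "e / 2 > 0" using e by simp
        with \<open>isCont F 0\<close> obtain \<delta> where "\<delta> > 0" "\<forall>x. dist x 0 < \<delta> \<longrightarrow> dist (F x) (F 0) < e / 2"
          unfolding continuous_at_eps_delta by blast
        thus ?thesis using that by (auto simp: dist_norm)
      qed
      \<comment> \<open>\<open>L < \<delta>\<close> keeps \<open>F\<close> within
        \<open>e / 2\<close> of \<open>F 0\<close> on the unexceptional values. The exceptional ones
        deviate by at most \<open>2 * M\<close> and have a share below \<open>\<tau>\<close>, which
        adds at most \<open>e / 4\<close>.\<close>
      define \<tau> where "\<tau> = min \<delta> (e / 8 / M)"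
      have \<tau>: "\<tau> > 0" "\<tau> \<le> \<delta>" "2 * M * \<tau> \<le> e / 4"
      proof -
        show "\<tau> > 0" using \<delta> e M by (simp add: \<tau>_def)
        show "\<tau> \<le> \<delta>" by (simp add: \<tau>_def)
        have "\<tau> \<le> e / 8 / M" by (simp add: \<tau>_def)
        hence "\<tau> * M \<le> e / 8" using M by (simp only: pos_le_divide_eq)
        thus "2 * M * \<tau> \<le> e / 4" by (simp add: mult_ac)
      qed
      have "eventually (\<lambda>n. p n < \<tau>) sequentially" using order_tendstoD(2)[OF plim \<tau>(1)] .
      hence "eventually (\<lambda>n. norm (avg F n - F 0) < e) sequentially"
        using Dpos
      proof eventually_elim
        case (elim n)
        \<comment> \<open>The infimum \<open>p n\<close> is below \<open>\<tau>\<close>, so some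
          admissible pair is.\<close>
        have "\<exists>r L. 0 \<le> L \<and> sv_bound {..<D n} (\<lambda>p q. Z n $$ (p,q)) r L \<and> real r / real (D n) + L < \<tau>"
        proof (rule ccontr)
          assume *: "\<not> ?thesis"
          have "\<tau> \<le> p n" unfolding p_def
          proof (rule acs_size_greatest)
            fix r L assume "0 \<le> L" "sv_bound {..<D n} (\<lambda>p q. Z n $$ (p,q)) r L"
            hence "\<not> real r / real (D n) + L < \<tau>" using * by blast
            thus "\<tau> \<le> real r / real (card {..<D n}) + L" by simp
          qed simp
          thus False using elim(1) by simp
        qed
        then obtain r L where rL: "0 \<le> L" "sv_bound {..<D n} (\<lambda>p q. Z n $$ (p,q)) r L" "real r / real (D n) + L < \<tau>"
          by blast
        have r0: "0 \<le> real r / real (D n)" by simp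
        have L: "L < \<delta>" using rL(3) \<tau>(2) r0 by linarith
        have rD: "real r / real (D n) < \<tau>" using rL(1,3) by linarith
        define B where "B = {i\<in>{1..D n}. \<sigma> n i > L}"
        have cB: "card B \<le> r" using sv[OF rL(1), of n r] rL(2) by (simp add: cnt_def B_def)
        have "avg F n - F 0 = (\<Sum>i=1..D n. F (\<sigma> n i) - F 0) / of_nat (D n)"
          using elim(2) by (simp add: avg_def sum_subtractf diff_divide_distrib)
        hence "cmod (avg F n - F 0) \<le> (\<Sum>i=1..D n. cmod (F (\<sigma> n i) - F 0)) / real (D n)"
          using norm_sum[of "\<lambda>i. F (\<sigma> n i) - F 0" "{1..D n}"] by (simp add: norm_divide divide_right_mono)
        also have "(\<Sum>i=1..D n. cmod (F (\<sigma> n i) - F 0)) \<le> (\<Sum>i=1..D n. e / 2 + (if i \<in> B then 2 * M else 0))"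
        proof (intro sum_mono)
          fix i assume i: "i \<in> {1..D n}"
          show "cmod (F (\<sigma> n i) - F 0) \<le> e / 2 + (if i \<in> B then 2 * M else 0)"
          proof (cases "i \<in> B")
            case True
            have "cmod (F (\<sigma> n i) - F 0) \<le> cmod (F (\<sigma> n i)) + cmod (F 0)" by (rule norm_triangle_ineq4)
            thus ?thesis using True M(1)[of "\<sigma> n i"] M(1)[of 0] e by simp
          next
            case False
            hence "\<bar>\<sigma> n i\<bar> < \<delta>" using i L \<sigma>0[of n i] by (auto simp: B_def)
            thus ?thesis using \<delta>(2) False by (simp add: less_imp_le)
          qed
        qed
        also have "\<dots> = real (D n) * (e / 2) + real (card B) * (2 * M)"
        proof -
          have "(\<Sum>i=1..D n. if i \<in> B then 2 * M else 0) = (\<Sum>i\<in>B. 2 * M)"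
            by (rule sum.mono_neutral_cong_right) (auto simp: B_def)
          thus ?thesis by (simp add: sum.distrib)
        qed
        finally have "cmod (avg F n - F 0) \<le> (real (D n) * (e / 2) + real (card B) * (2 * M)) / real (D n)"
          by (simp add: divide_right_mono)
        also have "\<dots> = e / 2 + real (card B) / real (D n) * (2 * M)" using elim(2) by (simp add: add_divide_distrib)
        also have "\<dots> \<le> e / 2 + \<tau> * (2 * M)"
        proof (intro add_left_mono mult_right_mono)
          have "real (card B) / real (D n) \<le> real r / real (D n)" using cB by (intro divide_right_mono) auto
          thus "real (card B) / real (D n) \<le> \<tau>" using rD by linarith
        qed (use M in simp)
        also have "\<dots> < e" using \<tau>(3) e by (simp add: mult_ac)
        finally show ?case by simp
      qed
      thus "\<exists>no. \<forall>n\<ge>no. norm (avg F n - F 0) < e" by (simp add: eventually_sequentially)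
    qed
    thus "Z \<in> zero_distributed \<nu> \<Omega>" unfolding zd by blast
  qed
qed

text \<open>The sequence behind \<open>d_acs\<close> has a limit, so a vanishing limsup is
  convergence to 0, which characterises zero-distributed differences. This identifies the kernel of
  the symbol map.\<close>

lemma seq_rel_eq:
  "seq_rel \<nu> \<Omega> = {(A, B). A \<in> reduced_GLT_seqs \<nu> \<Omega> \<and> B \<in> reduced_GLT_seqs \<nu> \<Omega> \<and> d_acs \<nu> \<Omega> A B = 0}"
proof -
  have "(\<lambda>n. A n - B n) \<in> zero_distributed \<nu> \<Omega> \<longleftrightarrow> d_acs \<nu> \<Omega> A B = 0"
    if AB: "A \<in> reduced_GLT_seqs \<nu> \<Omega>" "B \<in> reduced_GLT_seqs \<nu> \<Omega>" for A B
  proof -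
    obtain \<kappa> \<xi> where s: "reduced_GLT \<nu> \<Omega> A \<kappa>" "reduced_GLT \<nu> \<Omega> B \<xi>" using AB by (auto simp: reduced_GLT_seqs_def)
    have c: "A n - B n \<in> carrier_mat (grid_in_size \<Omega> (\<nu> n)) (grid_in_size \<Omega> (\<nu> n))" for n
      using reduced_GLT_carrier[OF AB(2), of n] by (rule minus_carrier_mat)
    note iff = zero_distributed_iff[of "\<lambda>n. A n - B n", OF c]
    note lim = reduced_GLT_acs_size_tendsto[OF s]
    show ?thesis
      unfolding reduced_GLT_d_acs[OF s] iff
    proof
      assume "(\<lambda>n. acs_size {..<grid_in_size \<Omega> (\<nu> n)} (\<lambda>p q. (A n - B n) $$ (p,q))) \<longlonglongrightarrow> 0"
      thus "d_mea \<Omega> \<kappa> \<xi> = 0" by (rule LIMSEQ_unique[OF lim])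
    next
      assume "d_mea \<Omega> \<kappa> \<xi> = 0"
      thus "(\<lambda>n. acs_size {..<grid_in_size \<Omega> (\<nu> n)} (\<lambda>p q. (A n - B n) $$ (p,q))) \<longlonglongrightarrow> 0" using lim by simp
    qed
  qed
  hence "A \<in> reduced_GLT_seqs \<nu> \<Omega> \<and> B \<in> reduced_GLT_seqs \<nu> \<Omega> \<and> (\<lambda>n. A n - B n) \<in> zero_distributed \<nu> \<Omega> \<longleftrightarrow>
      A \<in> reduced_GLT_seqs \<nu> \<Omega> \<and> B \<in> reduced_GLT_seqs \<nu> \<Omega> \<and> d_acs \<nu> \<Omega> A B = 0" for A B by blast
  thus ?thesis by (simp only: seq_rel_def)
qed

lemma reduced_GLT_symbol_space:
  assumes "reduced_GLT \<nu> \<Omega> A \<kappa>"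
  shows "\<kappa> \<in> symbol_space \<Omega>"
proof -
  obtain A' k where A: "GLT \<nu> A' k" "\<forall>z \<in> \<Omega> \<times> freq_box. \<kappa> z = k z"
    using assms unfolding reduced_GLT_def by blast
  have "k \<in> symbol_space \<Omega>" by (rule cube_measurable_imp_symbol_space) (use A(1) in \<open>simp add: GLT_def\<close>)
  thus ?thesis unfolding symbol_space_def
    by (rule measurable_cong[THEN iffD1, rotated]) (use A(2) in auto)
qed

text \<open>Pulled back from \<open>d_mea\<close> along a choice of symbols.\<close>

lemma pseudometric_d_acs: "pseudometric_on (reduced_GLT_seqs \<nu> \<Omega>) (d_acs \<nu> \<Omega>)"
proof -
  have "\<exists>\<kappa>. reduced_GLT \<nu> \<Omega> A \<kappa>" if "A \<in> reduced_GLT_seqs \<nu> \<Omega>" for A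
    using that by (simp add: reduced_GLT_seqs_def)
  then obtain s where s: "\<And>A. A \<in> reduced_GLT_seqs \<nu> \<Omega> \<Longrightarrow> reduced_GLT \<nu> \<Omega> A (s A)" by metis
  have e: "d_acs \<nu> \<Omega> A B = d_mea \<Omega> (s A) (s B)" if "A \<in> reduced_GLT_seqs \<nu> \<Omega>" "B \<in> reduced_GLT_seqs \<nu> \<Omega>" for A B
    using reduced_GLT_d_acs[OF s[OF that(1)] s[OF that(2)]] .
  have m: "s A \<in> symbol_space \<Omega>" if "A \<in> reduced_GLT_seqs \<nu> \<Omega>" for A
    using reduced_GLT_symbol_space[OF s[OF that]] .
  show ?thesis using pseudometric_d_mea m unfolding pseudometric_on_def by (simp add: e)
qed

lemma symbol_rel_eq:
  "symbol_rel \<Omega> = {(f, g). f \<in> symbol_space \<Omega> \<and> g \<in> symbol_space \<Omega> \<and> d_mea \<Omega> f g = 0}"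
  unfolding symbol_rel_def using d_mea_eq_0_iff by blast

text \<open>A reduced symbol has to agree with a GLT symbol at every point over the domain, so an
  almost everywhere change must be absorbed by the GLT symbol. Overwriting \<open>k\<close> by
  \<open>s\<close> over the domain changes it on a null set only, which convergence in measure does
  not see.\<close>

lemma reduced_GLT_AE_cong:
  assumes "reduced_GLT \<nu> \<Omega> A \<kappa>" "(\<kappa>, s) \<in> symbol_rel \<Omega>"
  shows "reduced_GLT \<nu> \<Omega> A s"
proof -
  let ?Q = "(cbox 0 1 :: 'd point set) \<times> (freq_box :: 'd point set)"
  let ?E = "\<Omega> \<times> (freq_box :: 'd point set)"
  obtain A' k where A: "GLT \<nu> A' k" "A = (\<lambda>n. restrict_mat \<Omega> (\<nu> n) (A' n))" "\<And>z. z \<in> ?E \<Longrightarrow> \<kappa> z = k z"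
    using assms(1) unfolding reduced_GLT_def by blast
  have s: "s \<in> borel_measurable (lebesgue_on ?E)" and ae: "AE z in lebesgue_on ?E. \<kappa> z = s z"
    using assms(2) by (auto simp: symbol_rel_def symbol_space_def)
  define k' where "k' z = (if z \<in> ?E then s z else k z)" for z
  have Q: "?Q \<in> lmeasurable" by (rule cube_Times_freq_box_lmeasurable)
  have E: "?E \<in> sets lebesgue" using domain_lmeasurable by auto
  have EQ: "?E \<subseteq> ?Q" using \<Omega>(1) by auto
  have km: "k \<in> borel_measurable (lebesgue_on ?Q)" using A(1) by (simp add: GLT_def)
  have k'm: "k' \<in> borel_measurable (lebesgue_on ?Q)"
    unfolding k'_def
  proof (rule measurable_If_restrict_space_iff[THEN iffD2])
    show "{x \<in> space (lebesgue_on ?Q). x \<in> ?E} \<in> sets (lebesgue_on ?Q)"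
    proof -
      have "{x \<in> space (lebesgue_on ?Q). x \<in> ?E} = ?E" using EQ by auto
      thus ?thesis using E EQ Q by (auto simp: sets_restrict_space_iff fmeasurable_def)
    qed
    have "restrict_space (lebesgue_on ?Q) {x. x \<in> ?E} = lebesgue_on ?E"
      using EQ by (simp add: restrict_restrict_space Q fmeasurableD E Int_absorb1)
    moreover have "k \<in> borel_measurable (restrict_space (lebesgue_on ?Q) {x. x \<notin> ?E})"
      using km by (rule measurable_restrict_space1)
    ultimately show "s \<in> borel_measurable (restrict_space (lebesgue_on ?Q) {x. x \<in> ?E}) \<and>
       k \<in> borel_measurable (restrict_space (lebesgue_on ?Q) {x. x \<notin> ?E})" using s by simp
  qed
  obtain N where N: "N \<in> null_sets lebesgue" "\<And>z. z \<in> ?E \<Longrightarrow> z \<notin> N \<Longrightarrow> \<kappa> z = s z"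
  proof -
    from ae obtain N where "N \<in> null_sets (lebesgue_on ?E)" "{z \<in> space (lebesgue_on ?E). \<kappa> z \<noteq> s z} \<subseteq> N"
      by (auto elim: AE_E3 simp: eventually_ae_filter)
    moreover from this have "N \<in> null_sets lebesgue" using E by (simp add: null_sets_restrict_space)
    ultimately show ?thesis using that[of N] by auto
  qed
  have kk': "k' z = k z" if "z \<notin> N" for z using N(2)[of z] A(3)[of z] that by (auto simp: k'_def)
  obtain r a f where carr: "\<And>n. A' n \<in> carrier_mat (grid_size (\<nu> n)) (grid_size (\<nu> n))"
    and af: "\<forall>m. \<forall>i<r m. smooth_on_set (cbox 0 1) (a m i) \<and> trig_poly (f m i)"
    and conv: "conv_in_measure ?Q (\<lambda>m (x, \<theta>). \<Sum>i<r m. a m i x * f m i \<theta>) k"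
    and acs: "acs_conv (\<lambda>n. grid_size (\<nu> n)) (\<lambda>m n. glt_approx (\<nu> n) (r m) (a m) (f m)) A'"
    using A(1) unfolding GLT_def by blast
  have meq: "measure lebesgue {z \<in> ?Q. cmod (g z - k' z) > e} = measure lebesgue {z \<in> ?Q. cmod (g z - k z) > e}" for g :: "'d point \<times> 'd point \<Rightarrow> complex" and e
    by (rule measure_eq_mod_null[OF N(1)]) (use kk' in auto)
  have "conv_in_measure ?Q (\<lambda>m (x, \<theta>). \<Sum>i<r m. a m i x * f m i \<theta>) k'"
    using conv unfolding conv_in_measure_def meq .
  hence "GLT \<nu> A' k'" unfolding GLT_def using carr k'm af acs by blast
  moreover have "\<forall>z \<in> ?E. s z = k' z" by (simp add: k'_def)
  ultimately show ?thesis unfolding reduced_GLT_def using A(2) by blast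
qed

text \<open>One inclusion is well-definedness, from the equality of distances. The other says that
  every function almost everywhere equal to the symbol is attained, even by \<open>A\<close>
  itself.\<close>

lemma symbol_map_class:
  assumes "reduced_GLT \<nu> \<Omega> A \<kappa>"
  shows "symbol_map \<nu> \<Omega> (seq_rel \<nu> \<Omega> `` {A}) = symbol_rel \<Omega> `` {\<kappa>}"
proof (intro equalityI subsetI)
  fix s assume "s \<in> symbol_map \<nu> \<Omega> (seq_rel \<nu> \<Omega> `` {A})"
  then obtain B where B: "(A, B) \<in> seq_rel \<nu> \<Omega>" "reduced_GLT \<nu> \<Omega> B s" by (auto simp: symbol_map_def)
  hence "d_mea \<Omega> \<kappa> s = 0" using reduced_GLT_d_acs[OF assms B(2)] by (auto simp: seq_rel_eq)
  thus "s \<in> symbol_rel \<Omega> `` {\<kappa>}"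
    using reduced_GLT_symbol_space[OF assms] reduced_GLT_symbol_space[OF B(2)] by (auto simp: symbol_rel_eq)
next
  fix s assume "s \<in> symbol_rel \<Omega> `` {\<kappa>}"
  hence "reduced_GLT \<nu> \<Omega> A s" using reduced_GLT_AE_cong[OF assms] by blast
  moreover have "(A, A) \<in> seq_rel \<nu> \<Omega>"
    using assms pseudometric_d_acs by (auto simp: seq_rel_eq reduced_GLT_seqs_def pseudometric_on_def)
  ultimately show "s \<in> symbol_map \<nu> \<Omega> (seq_rel \<nu> \<Omega> `` {A})" by (auto simp: symbol_map_def)
qed

end

theorem theorem4p2:
  fixes \<nu> :: "nat \<Rightarrow> ('d :: {finite, linorder}) multi_index"
    and \<Omega> :: "'d point set"
  assumes "filterlim (\<lambda>n. Min (range (\<lambda>l. \<nu> n $ l))) at_top sequentially"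
    and "\<Omega> \<subseteq> cbox 0 1"
    and "peano_jordan \<Omega>"
    and "measure lebesgue \<Omega> > 0"
  shows "equiv (reduced_GLT_seqs \<nu> \<Omega>) (seq_rel \<nu> \<Omega>) \<and>
         d_acs \<nu> \<Omega> respects2 seq_rel \<nu> \<Omega> \<and>
         equiv (symbol_space \<Omega>) (symbol_rel \<Omega>) \<and>
         d_mea \<Omega> respects2 symbol_rel \<Omega> \<and>
         pseudometric_on (reduced_GLT_seqs \<nu> \<Omega> // seq_rel \<nu> \<Omega>) (class_dist (d_acs \<nu> \<Omega>)) \<and>
         pseudometric_on (symbol_space \<Omega> // symbol_rel \<Omega>) (class_dist (d_mea \<Omega>)) \<and>
         isometry_on (reduced_GLT_seqs \<nu> \<Omega> // seq_rel \<nu> \<Omega>) (class_dist (d_acs \<nu> \<Omega>))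
                     (symbol_space \<Omega> // symbol_rel \<Omega>) (class_dist (d_mea \<Omega>))
                     (symbol_map \<nu> \<Omega>) \<and>
         (\<forall>A B \<kappa> \<xi>. reduced_GLT \<nu> \<Omega> A \<kappa> \<and> reduced_GLT \<nu> \<Omega> B \<xi> \<longrightarrow>
            d_acs \<nu> \<Omega> A B = d_mea \<Omega> \<kappa> \<xi>)"
proof -
  interpret reduced_setting \<Omega> \<nu> by standard (use assms in auto)
  \<comment> \<open>Both equivalences are relations of distance zero, so one quotient construction
    serves twice.\<close>
  note seqs = pseudometric_quotient[OF pseudometric_d_acs seq_rel_eq]
  note syms = pseudometric_quotient[OF pseudometric_d_mea symbol_rel_eq]
  have "isometry_on (reduced_GLT_seqs \<nu> \<Omega> // seq_rel \<nu> \<Omega>) (class_dist (d_acs \<nu> \<Omega>))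
                     (symbol_space \<Omega> // symbol_rel \<Omega>) (class_dist (d_mea \<Omega>)) (symbol_map \<nu> \<Omega>)"
    unfolding isometry_on_def
  proof (intro conjI funcsetI ballI)
    fix X assume "X \<in> reduced_GLT_seqs \<nu> \<Omega> // seq_rel \<nu> \<Omega>"
    then obtain A where A: "A \<in> reduced_GLT_seqs \<nu> \<Omega>" "X = seq_rel \<nu> \<Omega> `` {A}" by (rule quotientE)
    then obtain \<kappa> where \<kappa>: "reduced_GLT \<nu> \<Omega> A \<kappa>" by (auto simp: reduced_GLT_seqs_def)
    note X = symbol_map_class[OF \<kappa>, folded A(2)]
    show "symbol_map \<nu> \<Omega> X \<in> symbol_space \<Omega> // symbol_rel \<Omega>"
      unfolding X by (rule quotientI) (rule reduced_GLT_symbol_space[OF \<kappa>])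
    fix Y assume "Y \<in> reduced_GLT_seqs \<nu> \<Omega> // seq_rel \<nu> \<Omega>"
    then obtain B where B: "B \<in> reduced_GLT_seqs \<nu> \<Omega>" "Y = seq_rel \<nu> \<Omega> `` {B}" by (rule quotientE)
    then obtain \<xi> where \<xi>: "reduced_GLT \<nu> \<Omega> B \<xi>" by (auto simp: reduced_GLT_seqs_def)
    note Y = symbol_map_class[OF \<xi>, folded B(2)]
    show "class_dist (d_mea \<Omega>) (symbol_map \<nu> \<Omega> X) (symbol_map \<nu> \<Omega> Y) = class_dist (d_acs \<nu> \<Omega>) X Y"
      unfolding X Y unfolding A(2) B(2) seqs(3)[OF A(1) B(1)]
        syms(3)[OF reduced_GLT_symbol_space[OF \<kappa>] reduced_GLT_symbol_space[OF \<xi>]]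
      by (rule reduced_GLT_d_acs[OF \<kappa> \<xi>, symmetric])
  qed
  thus ?thesis using seqs(1,2,4) syms(1,2,4) reduced_GLT_d_acs by blast
qed

end
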